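(* Let $\Omega=(0,L)$, $\Gamma=\partial\Omega=\{0,L\}$, and let $u_0$ be a monotone Lipschitz function on $\Omega$; set $\chi=1$ if $u_0$ is increasing and $\chi=-1$ if $u_0$ is decreasing. Assume that $u_0$ is strictly monotone on $[0,b_0]$, $b_0\in(0,L)$, and that it has exactly one facet $([b_0,L],\chi)$ touching the boundary at $x=L$ (so $u_0$ is constant on $[b_0,L]$), and let $v_0=u_0|_\Gamma$. Let $U(t)=(u(t),v(t))$ be the solution of the gradient flow of $E$ (with $\tau=1$) with $U(0)=(u_0,v_0)$. Then: 1) The facet at $x=L$ occupies at time $t$ an interval $[b(t),L]$, $b(0)=b_0$, and its vertical velocity is $$u_t=\frac{-\chi}{1+L-b(t)} .$$ The facet $([b_0,L],\chi)$ is calibrable and $(1,\Gamma)$-coherent. Moreover, if $h_r(t)=u(\cdot,t)|_{[b(t),L]}$, then $\frac{dh_r}{dt}=u_t$ and $h_r(0)=u(L,0)$. In addition, $b(t)$ is a solution to $h_r(t)=u_0(b(t))$, i.e. $b(t)=(u_0)^{-1}(h_r(t))$. 2) A new facet forms instantly at $x=0$, and its initial velocity is $\chi$. If $a(t)$ denotes the right endpoint of the new facet $[0,a(t)]$ at $t>0$, then its velocity is $$u_t=\frac{\chi}{1+a(t)} .$$ The facet $([0,a(t)],\chi)$ is calibrable and $(1,\Gamma)$-coherent. Moreover, if $h_l(t)=u(\cdot,t)|_{[0,a(t)]}$, then $\frac{dh_l}{dt}=u_t$ and $h_l(0)=u(0,0)$. In addition, $a(t)=(u_0)^{-1}(h_l(t))$.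 In particular, the velocity of the facet $([0,a(t)],\chi)$ is continuous at $t=0$. 3) The unique solution $U(t)=(u(t),v(t))$ is given by $$u(x,t)=\begin{cases} h_l(t), & x\in[0,a(t)], \\ u_0(x), & x\in(a(t),b(t)), \\ h_r(t), & x\in[b(t),L], \end{cases}$$ for $t<T_{cr}$, where $a(T_{cr})=b(T_{cr})$. In particular, for all $t\ge0$, $\gamma u(t)=v(t)$; in other words, $\gamma u_t=v_t$.
   Context: $H=L^2(\Omega)\times L^2(\Gamma)$ with $\Gamma=\{0,L\}$ carrying counting measure, with the standard inner product. $E(u,v)=\int_0^L|Du|+\sum_{i\in\{0,L\}}|\gamma u(i)-v(i)|$ for $u\in BV(0,L)$ and $E=+\infty$ otherwise; $\gamma$ is the trace. The gradient flow with $\tau=1$ is: $U\in W^{1,2}_{loc}([0,\infty);H)$, $\frac{dU}{dt}(t)\in-\partial E(U(t))$ for a.e. $t>0$, $U(0)=(u_0,v_0)$, with $\partial E$ the subdifferential. $u_t$, $v_t$ denote (right) time derivatives; $(u_0)^{-1}$ is the inverse of $u_0$ restricted to $[0,b_0]$. A facet is a (maximal) closed interval on which the function is constant; a facet at time $t$ refers to $u(\cdot,t)$. The outer normal is $\nu(0)=-1$, $\nu(L)=1$. For a facet $([b,L],\chi)$ (resp. $([0,a],\chi)$), where $\chi$ is the sign of monotonicity of $u_0$, the Cahn–Hoffman vector fields are the $z\in W^{1,2}(F)$ on $F=[b,L]$ (resp. $F=[0,a]$) with $|z|\le1$ and $z(b)=\chi$ (resp. $z(a)=\chi$). Let $\Gamma_F=F\cap\Gamma$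 and $I_1(z)=\int_F|z'|^2\,dx+|z\nu|^2|_{\Gamma_F}$. The facet is calibrable if there is a Cahn–Hoffman field $z$ minimizing $I_1$ with $z'$ constant on $F$; it is $(1,\Gamma)$-coherent if there is a minimizer $z$ of $I_1$ with $\frac1{|F|}\int_Fz'\,dx+(z\nu)|_{\Gamma_F}=0$.
   Formalization: The closing identity γu_t = v_t is stated for t > 0 only: at t = 0 the right derivative u_t vanishes on (0,b_0), so its trace at x = 0 is 0, while v_t = χ there; γu(t) = v(t) is kept for all t ≥ 0. *)

theory Defs
  imports "HOL-Analysis.Analysis"
begin

text \<open>
  Throughout, \<^term>\<open>\<Omega> = {0<..<L}\<close> and \<^term>\<open>\<Gamma> = {0, L}\<close>.  An element of
  \<open>H = L^2(\<Omega>) \<times> L^2(\<Gamma>)\<close> is represented by a pair \<open>(u, v)\<close> of functions: \<open>u\<close> matters only up to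
  null sets of \<open>\<Omega>\<close>, and \<open>v\<close> only at the points \<open>0\<close> and \<open>L\<close>.  Hence every equality in \<open>H\<close> is
  expressed by \<open>H_eq\<close>.
\<close>

type_synonym state = "(real \<Rightarrow> real) \<times> (real \<Rightarrow> real)"

definition L2 :: "real set \<Rightarrow> (real \<Rightarrow> real) set" where
  "L2 S = {f \<in> borel_measurable (lebesgue_on S). integrable (lebesgue_on S) (\<lambda>x. (f x)\<^sup>2)}"

definition H_space :: "real \<Rightarrow> state set" where
  "H_space L = {U. fst U \<in> L2 {0<..<L}}"

definition H_eq :: "real \<Rightarrow> state \<Rightarrow> state \<Rightarrow> bool" where
  "H_eq L U V \<longleftrightarrow>
     (AE x in lebesgue_on {0<..<L}. fst U x = fst V x) \<and> (\<forall>i\<in>{0, L}. snd U i = snd V i)"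

definition H_diff :: "state \<Rightarrow> state \<Rightarrow> state" where
  "H_diff U V = (\<lambda>x. fst U x - fst V x, \<lambda>i. snd U i - snd V i)"

definition H_scale :: "real \<Rightarrow> state \<Rightarrow> state" where
  "H_scale c U = (\<lambda>x. c * fst U x, \<lambda>i. c * snd U i)"

definition H_inner :: "real \<Rightarrow> state \<Rightarrow> state \<Rightarrow> real" where
  "H_inner L U V = (\<integral>x. fst U x * fst V x \<partial>lebesgue_on {0<..<L}) + (\<Sum>i\<in>{0, L}. snd U i * snd V i)"

definition H_norm :: "real \<Rightarrow> state \<Rightarrow> real" where
  "H_norm L U = sqrt (H_inner L U U)"


subsection \<open>The energy and its subdifferential\<close>

definition C1_compact :: "real \<Rightarrow> real \<Rightarrow> (real \<Rightarrow> real) set" where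
  "C1_compact p q = {\<phi>. \<phi> C1_differentiable_on UNIV \<and> closure {x. \<phi> x \<noteq> 0} \<subseteq> {p<..<q}}"

definition total_variation :: "real \<Rightarrow> (real \<Rightarrow> real) \<Rightarrow> ereal" where
  "total_variation L u =
     (SUP \<phi> \<in> {\<phi> \<in> C1_compact 0 L. \<forall>x. \<bar>\<phi> x\<bar> \<le> 1}.
        ereal (\<integral>x. u x * deriv \<phi> x \<partial>lebesgue_on {0<..<L}))"

definition BV :: "real \<Rightarrow> (real \<Rightarrow> real) set" where
  "BV L = {u. integrable (lebesgue_on {0<..<L}) u \<and> total_variation L u < \<infinity>}"

text \<open>
  The trace at a boundary point is the limit of the averages over shrinking one-sided
  neighbourhoods; it exists for every function in \<^const>\<open>BV\<close> and depends only on the class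
  of the function modulo null sets.
\<close>

definition has_trace :: "real \<Rightarrow> (real \<Rightarrow> real) \<Rightarrow> real \<Rightarrow> real \<Rightarrow> bool" where
  "has_trace L u i c \<longleftrightarrow>
     ((\<lambda>r. (\<integral>x. u x \<partial>lebesgue_on ({0<..<L} \<inter> ball i r)) / measure lebesgue ({0<..<L} \<inter> ball i r))
        \<longlongrightarrow> c) (at_right 0)"

definition trace_at :: "real \<Rightarrow> (real \<Rightarrow> real) \<Rightarrow> real \<Rightarrow> real" where
  "trace_at L u i = (THE c. has_trace L u i c)"

definition energy :: "real \<Rightarrow> state \<Rightarrow> ereal" where
  "energy L U =
     (if fst U \<in> BV L
      then total_variation L (fst U) + ereal (\<Sum>i\<in>{0, L}. \<bar>trace_at L (fst U) i - snd U i\<bar>)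
      else \<infinity>)"

definition subdifferential :: "real \<Rightarrow> state \<Rightarrow> state set" where
  "subdifferential L U =
     {W \<in> H_space L. energy L U < \<infinity> \<and>
        (\<forall>Y \<in> H_space L. energy L U + ereal (H_inner L W (H_diff Y U)) \<le> energy L Y)}"


subsection \<open>The gradient flow\<close>

text \<open>
  \<open>W\<close> is the limit in \<open>H\<close> of the difference quotients \<open>(U (t + h) - U t) / h\<close> as \<open>h\<close> tends to 0
  along \<open>F\<close>: the derivative for \<^term>\<open>F = at 0\<close>, the right derivative for
  \<^term>\<open>F = at_right 0\<close>.
\<close>

definition H_has_derivative :: "real \<Rightarrow> (real \<Rightarrow> state) \<Rightarrow> state \<Rightarrow> real \<Rightarrow> real filter \<Rightarrow> bool" where
  "H_has_derivative L U W t F \<longleftrightarrow>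
     W \<in> H_space L \<and>
     ((\<lambda>h. H_norm L (H_diff (H_scale (1 / h) (H_diff (U (t + h)) (U t))) W)) \<longlongrightarrow> 0) F"

definition H_absolutely_continuous_on :: "real \<Rightarrow> real \<Rightarrow> (real \<Rightarrow> state) \<Rightarrow> bool" where
  "H_absolutely_continuous_on L T U \<longleftrightarrow>
     (\<forall>\<epsilon>>0. \<exists>\<delta>>0. \<forall>D S. D division_of S \<and> S \<subseteq> {0..T} \<and> (\<Sum>K\<in>D. Sup K - Inf K) < \<delta> \<longrightarrow>
        (\<Sum>K\<in>D. H_norm L (H_diff (U (Sup K)) (U (Inf K)))) < \<epsilon>)"

text \<open>
  \<open>U\<close> belongs to \<open>W^{1,2}_{loc}([0,\<infinity>); H)\<close> with derivative \<open>W\<close>.  For the Hilbert space \<open>H\<close> the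
  (continuous representatives of) elements of \<open>W^{1,2}(0,T; H)\<close> are the absolutely continuous
  functions whose a.e. strong derivative is square integrable.
\<close>

definition W12_loc :: "real \<Rightarrow> (real \<Rightarrow> state) \<Rightarrow> (real \<Rightarrow> state) \<Rightarrow> bool" where
  "W12_loc L U W \<longleftrightarrow>
     (\<forall>t\<ge>0. U t \<in> H_space L) \<and>
     (\<forall>T>0. H_absolutely_continuous_on L T U) \<and>
     (AE t in lebesgue_on {0<..}. H_has_derivative L U (W t) t (at 0)) \<and>
     (\<forall>T>0. integrable (lebesgue_on {0<..<T}) (\<lambda>t. (H_norm L (W t))\<^sup>2))"

definition gradient_flow :: "real \<Rightarrow> state \<Rightarrow> (real \<Rightarrow> state) \<Rightarrow> bool" where
  "gradient_flow L U0 U \<longleftrightarrow>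
     (\<exists>W. W12_loc L U W \<and>
          (AE t in lebesgue_on {0<..}. H_scale (-1) (W t) \<in> subdifferential L (U t))) \<and>
     H_eq L (U 0) U0"


subsection \<open>Facets, calibrability and coherence\<close>

definition is_facet :: "real \<Rightarrow> (real \<Rightarrow> real) \<Rightarrow> real \<Rightarrow> real \<Rightarrow> bool" where
  "is_facet L f p q \<longleftrightarrow>
     p < q \<and> {p..q} \<subseteq> {0..L} \<and> f constant_on {p..q} \<and>
     (\<forall>p' q'. {p..q} \<subseteq> {p'..q'} \<and> {p'..q'} \<subseteq> {0..L} \<and> f constant_on {p'..q'} \<longrightarrow> p' = p \<and> q' = q)"

definition outer_normal :: "real \<Rightarrow> real" where
  "outer_normal i = (if i = 0 then -1 else 1)"

text \<open>
  \<open>z\<close> is the continuous representative of an element of \<open>W^{1,2}(p,q)\<close> with weak derivative \<open>z'\<close>.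
\<close>

definition W12_interval :: "real \<Rightarrow> real \<Rightarrow> (real \<Rightarrow> real) \<Rightarrow> (real \<Rightarrow> real) \<Rightarrow> bool" where
  "W12_interval p q z z' \<longleftrightarrow>
     continuous_on {p..q} z \<and> z' \<in> L2 {p..q} \<and>
     (\<forall>\<phi> \<in> C1_compact p q.
        (\<integral>x. z x * deriv \<phi> x \<partial>lebesgue_on {p..q}) = - (\<integral>x. z' x * \<phi> x \<partial>lebesgue_on {p..q}))"

text \<open>
  For a facet \<open>F = {p..q}\<close> touching the boundary, the value \<open>chi\<close> is prescribed at the endpoint
  in the interior of \<open>\<Omega>\<close>, i.e. at \<open>b\<close> for \<open>F = {b..L}\<close> and at \<open>a\<close> for \<open>F = {0..a}\<close>.
\<close>

definition cahn_hoffman ::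
  "real \<Rightarrow> real \<Rightarrow> real \<Rightarrow> real \<Rightarrow> (real \<Rightarrow> real) \<Rightarrow> (real \<Rightarrow> real) \<Rightarrow> bool" where
  "cahn_hoffman L p q chi z z' \<longleftrightarrow>
     W12_interval p q z z' \<and> (\<forall>x\<in>{p..q}. \<bar>z x\<bar> \<le> 1) \<and> (\<forall>x\<in>{p, q} - {0, L}. z x = chi)"

definition I1 :: "real \<Rightarrow> real \<Rightarrow> real \<Rightarrow> (real \<Rightarrow> real) \<Rightarrow> (real \<Rightarrow> real) \<Rightarrow> real" where
  "I1 L p q z z' =
     (\<integral>x. \<bar>z' x\<bar>\<^sup>2 \<partial>lebesgue_on {p..q}) + (\<Sum>i\<in>{p..q} \<inter> {0, L}. \<bar>z i * outer_normal i\<bar>\<^sup>2)"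

definition I1_minimizer ::
  "real \<Rightarrow> real \<Rightarrow> real \<Rightarrow> real \<Rightarrow> (real \<Rightarrow> real) \<Rightarrow> (real \<Rightarrow> real) \<Rightarrow> bool" where
  "I1_minimizer L p q chi z z' \<longleftrightarrow>
     cahn_hoffman L p q chi z z' \<and>
     (\<forall>y y'. cahn_hoffman L p q chi y y' \<longrightarrow> I1 L p q z z' \<le> I1 L p q y y')"

definition calibrable :: "real \<Rightarrow> real \<Rightarrow> real \<Rightarrow> real \<Rightarrow> bool" where
  "calibrable L p q chi \<longleftrightarrow>
     (\<exists>z z'. I1_minimizer L p q chi z z' \<and> (\<exists>c. AE x in lebesgue_on {p..q}. z' x = c))"

definition coherent :: "real \<Rightarrow> real \<Rightarrow> real \<Rightarrow> real \<Rightarrow> bool" where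
  "coherent L p q chi \<longleftrightarrow>
     (\<exists>z z'. I1_minimizer L p q chi z z' \<and>
        (\<forall>i\<in>{p..q} \<inter> {0, L}.
           1 / (q - p) * (\<integral>x. z' x \<partial>lebesgue_on {p..q}) + z i * outer_normal i = 0))"

end

theory Submission
  imports Defs
begin

text \<open>
  The subdifferential of the convex energy is monotone, so the squared distance of two gradient
  flows is an absolutely continuous function of time with nonpositive derivative; this gives
  uniqueness, and it remains to check that the explicit evolution is a gradient flow.

  With \<open>w\<^sub>0 = \<chi> u\<^sub>0\<close> increasing, the law \<open>dh\<^sub>l/dt = \<chi> / (1 + a)\<close> with \<open>h\<^sub>l = u\<^sub>0(a)\<close> says that the left facet
  reaches \<open>x\<close> at time \<open>A(x) = \<integral>\<^sub>0\<^sup>x (1 + s) dw\<^sub>0(s)\<close>, and similarly on the right, so \<open>a\<close> and \<open>b\<close> are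
  inverses of explicit strictly monotone functions and no differentiability of \<open>u\<^sub>0\<close> is needed.

  The velocity belongs to the subdifferential because it is the derivative of a Cahn--Hoffman field
  \<open>z\<close> with \<open>|z| \<le> 1\<close> on the whole interval: integrating \<open>z\<close> against \<open>Dy\<close> bounds the energy of every
  competitor \<open>y\<close> from below, with equality at the monotone solution itself.  For \<open>y\<close> in \<open>BV\<close> this
  is done with piecewise affine test functions, whose pairing with \<open>y\<close> only involves averages of
  \<open>y\<close> over intervals; the same test functions show that the traces exist.
\<close>

subsection \<open>The Hilbert space and uniqueness\<close>

text \<open>The weight \<open>1 + a\<close> comes from the dynamic boundary condition. On the left
  facet the velocity is the slope of the field \<open>z\<close>, while the boundary point at 0 moves
  with the value \<open>z 0\<close>. Bulk and boundary move together, so both are one number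
  \<open>c\<close>, and \<open>z\<close> must reach \<open>chi\<close> at \<open>a\<close>:
  \<open>c + c * a = chi\<close>. With the opposite outer normal the same computation at
  \<open>L\<close> gives \<open>- chi / (1 + L - b)\<close>.

  Two obstacles shape the rest. The facet ends need not be differentiable in time, but the heights
  are: an increment of the arrival time lies between the two endpoint weights times the increment of
  \<open>w0\<close>, and this squeeze, with continuity of \<open>a\<close> and \<open>b\<close>,
  already determines the derivative of the heights. Moreover, a gradient flow is known only modulo
  null sets and for almost every time, so the fine statements are proved for the explicit evolution
  and carried over to an arbitrary solution by uniqueness. At the critical time the profile has
  become constant, with zero energy and 0 as a subgradient, so the evolution stops there.\<close>

lemma sum_content_division_le:
  fixes \<D> :: "real set set"
  assumes "\<D> division_of S" "S \<subseteq> T" "T \<in> lmeasurable"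
  shows "(\<Sum>K\<in>\<D>. Sup K - Inf K) \<le> measure lebesgue T"
proof -
  \<comment> \<open>The total length and the measure of the union are both the integral of 1 over
    \<open>S\<close>; shared endpoints do not count.\<close>
  have "((\<lambda>x. 1::real) has_integral (\<Sum>K\<in>\<D>. Sup K - Inf K)) S"
  proof (rule has_integral_combine_division[OF assms(1)])
    fix K assume "K \<in> \<D>"
    then obtain a b where "K = cbox a b" "K \<noteq> {}"
      using assms(1) by (metis cbox_division_memE)
    then have "K = {a..b}" "a \<le> b" by auto
    then show "((\<lambda>x. 1::real) has_integral Sup K - Inf K) K"
      using has_integral_const_real[of "1::real" a b] by simp
  qed
  moreover have S: "S \<in> lmeasurable"
    using assms(1) by (metis compact_cbox compact_Union division_ofD(1,4,6) lmeasurable_compact)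
  ultimately have "(\<Sum>K\<in>\<D>. Sup K - Inf K) = measure lebesgue S"
    using lmeasure_integral[OF S] by (metis integral_unique)
  also have "\<dots> \<le> measure lebesgue T"
    using assms(2,3) S by (meson fmeasurableD measure_mono_fmeasurable)
  finally show ?thesis .
qed

lemma negligible_outer_open:
  fixes N :: "real set"
  assumes "negligible N" "e > 0"
  obtains T where "open T" "N \<subseteq> T" "T \<in> lmeasurable" "measure lebesgue T < e"
proof -
  have N: "N \<in> null_sets lebesgue" using assms(1) by (simp add: negligible_iff_null_sets)
  then obtain T where T: "open T" "N \<subseteq> T" "(T - N) \<in> lmeasurable" "emeasure lebesgue (T - N) < ennreal e"
    using sets_lebesgue_outer_open[of N e] assms(2) by blast
  \<comment> \<open>Since \<open>N\<close> is null, a small excess \<open>T - N\<close> means that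
    \<open>T\<close> itself is small.\<close>
  have em: "emeasure lebesgue (T - N) = emeasure lebesgue T"
    using N T(1) by (intro emeasure_Diff_null_set) auto
  have "emeasure lebesgue T < \<infinity>" using T(3,4) em by (metis fmeasurableD2 infinity_ennreal_def top.not_eq_extremum)
  then have m: "T \<in> lmeasurable" using T(1) by (intro fmeasurableI) auto
  then have "ennreal (measure lebesgue T) < ennreal e"
    using em T(4) by (metis emeasure_eq_measure2)
  then have "measure lebesgue T < e" using assms(2) by (simp add: ennreal_less_iff)
  with T m that show ?thesis by blast
qed

text \<open>Cousin's argument with a fine tagged division: off the exceptional null set the
  straddle inequality bounds the increments, and the intervals tagged in the null set are
  handled by absolute continuity.\<close>

lemma absolutely_continuous_nonincreasing:
  fixes f :: "real \<Rightarrow> real"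
  assumes T: "0 \<le> T"
    and ac: "\<And>\<epsilon>. \<epsilon> > 0 \<Longrightarrow> \<exists>\<delta>>0. \<forall>D S. D division_of S \<and> S \<subseteq> {0..T} \<and> (\<Sum>K\<in>D. Sup K - Inf K) < \<delta> \<longrightarrow>
        (\<Sum>K\<in>D. \<bar>f (Sup K) - f (Inf K)\<bar>) < \<epsilon>"
    and N: "negligible N"
    and der: "\<And>t. t \<in> {0..T} - N \<Longrightarrow> \<exists>d\<le>0. (f has_real_derivative d) (at t)"
  shows "f T \<le> f 0"
proof (rule field_le_epsilon)
  fix e :: real assume "0 < e"
  \<comment> \<open>The straddle inequality costs \<open>e2 * T\<close> and the tags in the null set
    cost \<open>e2\<close>, together \<open>e\<close>.\<close>
  define e2 where "e2 = e / (T + 1)"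
  have e2: "e2 > 0" using \<open>0 < e\<close> T by (simp add: e2_def)
  obtain \<delta> where \<delta>: "\<delta> > 0" and ac': "\<And>D S. D division_of S \<Longrightarrow> S \<subseteq> {0..T} \<Longrightarrow> (\<Sum>K\<in>D. Sup K - Inf K) < \<delta> \<Longrightarrow>
        (\<Sum>K\<in>D. \<bar>f (Sup K) - f (Inf K)\<bar>) < e2"
    using ac[OF e2] by blast
  obtain G where G: "open G" "N \<subseteq> G" "G \<in> lmeasurable" "measure lebesgue G < \<delta>"
    using negligible_outer_open[OF N \<delta>] by blast
  have "\<exists>r>0. (\<forall>y z. dist t y < r \<and> dist t z < r \<and> y \<le> t \<and> t \<le> z \<longrightarrow> f z - f y \<le> e2 * (z - y))"
    if t: "t \<in> {0..T} - N" for t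
  proof -
    obtain d where d: "d \<le> 0" "(f has_real_derivative d) (at t)" using der[OF t] by blast
    then have "(f has_derivative (\<lambda>x. d * x)) (at t within UNIV)"
      by (simp add: has_field_derivative_def)
    then obtain r where r: "r > 0" "\<And>y. norm (y - t) < r \<Longrightarrow> norm (f y - f t - d * (y - t)) \<le> e2 * norm (y - t)"
      unfolding has_derivative_within_alt using e2 by (metis UNIV_I)
    show ?thesis
    proof (intro exI conjI allI impI)
      show "r > 0" by fact
      fix y z assume yz: "dist t y < r \<and> dist t z < r \<and> y \<le> t \<and> t \<le> z"
      have 1: "\<bar>f y - f t - d * (y - t)\<bar> \<le> e2 * (t - y)"
      proof -
        have e: "norm (y - t) = t - y" using yz by simp
        have "dist t y < r" using yz by simp
        then have "norm (y - t) < r" by (simp add: dist_norm norm_minus_commute)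
        then show ?thesis using r(2)[of y] e by simp
      qed
      have 2: "\<bar>f z - f t - d * (z - t)\<bar> \<le> e2 * (z - t)"
      proof -
        have e: "norm (z - t) = z - t" using yz by simp
        have "dist t z < r" using yz by simp
        then have "norm (z - t) < r" by (simp add: dist_norm norm_minus_commute)
        then show ?thesis using r(2)[of z] e by simp
      qed
      have "d * (z - y) \<le> 0" using d yz by (simp add: mult_nonpos_nonneg)
      then show "f z - f y \<le> e2 * (z - y)" using 1 2 by (auto simp: algebra_simps abs_le_iff)
    qed
  qed
  then obtain r where r: "\<And>t. t \<in> {0..T} - N \<Longrightarrow> r t > 0"
    "\<And>t y z. t \<in> {0..T} - N \<Longrightarrow> dist t y < r t \<Longrightarrow> dist t z < r t \<Longrightarrow> y \<le> t \<Longrightarrow> t \<le> z \<Longrightarrow> f z - f y \<le> e2 * (z - y)"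
    by metis
  \<comment> \<open>A tag in \<open>N\<close> forces its interval into the small open set
    \<open>G\<close>. The unit balls outside \<open>{0..T}\<close> only make \<open>\<gamma>\<close>
    a gauge on the whole line.\<close>
  define \<gamma> where "\<gamma> t = (if t \<in> N then G else if t \<in> {0..T} then ball t (r t) else ball t 1)" for t
  have "gauge \<gamma>"
    unfolding gauge_def \<gamma>_def using G(1,2) r(1) by auto
  then obtain p where p: "p tagged_division_of {0..T}" "\<gamma> fine p"
    using fine_division_exists_real by blast
  define q where "q = {xK \<in> p. fst xK \<in> N}"
  have fin: "finite p" using tagged_division_ofD(1)[OF p(1)] .
  have K: "\<exists>a b. K = {a..b} \<and> a \<le> b \<and> Sup K = b \<and> Inf K = a \<and> a \<le> x \<and> x \<le> b \<and> 0 \<le> a \<and> b \<le> T \<and> K \<subseteq> \<gamma> x"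
    if xK: "(x, K) \<in> p" for x K
  proof -
    obtain a b where "K = cbox a b" using tagged_division_ofD(4)[OF p(1) xK] by blast
    moreover have "x \<in> K" "K \<subseteq> {0..T}" using tagged_division_ofD(2,3)[OF p(1) xK] by simp_all
    moreover have "K \<subseteq> \<gamma> x" using p(2) that by (simp add: fineD)
    ultimately show ?thesis by (intro exI[of _ a] exI[of _ b]) auto
  qed
  have good: "f (Sup K) - f (Inf K) \<le> e2 * (Sup K - Inf K)" if xK: "(x, K) \<in> p - q" for x K
  proof -
    obtain a b where ab: "K = {a..b}" "a \<le> b" "Sup K = b" "Inf K = a" "a \<le> x" "x \<le> b" "0 \<le> a" "b \<le> T" "K \<subseteq> \<gamma> x"
      using K[of x K] xK by blast
    have "x \<notin> N" "x \<in> {0..T}" using xK ab by (auto simp: q_def)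
    with ab have "{a..b} \<subseteq> ball x (r x)" by (simp add: \<gamma>_def)
    then have "dist x a < r x" "dist x b < r x" using ab(2) by (simp_all add: subset_iff)
    then show ?thesis using r(2)[of x a b] ab \<open>x \<notin> N\<close> by auto
  qed
  have qp: "q tagged_partial_division_of {0..T}"
    using p(1) by (metis (no_types, lifting) mem_Collect_eq q_def subsetI tagged_division_of_def tagged_partial_division_subset)
  have qt: "q tagged_division_of \<Union>(snd ` q)"
    using qp tagged_partial_division_of_Union_self by blast
  have qd: "snd ` q division_of \<Union>(snd ` q)"
    using qp partial_division_of_tagged_division by blast
  have qG: "\<Union>(snd ` q) \<subseteq> G"
  proof -
    have "K \<subseteq> G" if "(x,K) \<in> q" for x K
      using K[of x K] that by (auto simp: q_def \<gamma>_def split: if_splits)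
    then show ?thesis by fastforce
  qed
  have q01: "\<Union>(snd ` q) \<subseteq> {0..T}"
  proof -
    have "K \<subseteq> {0..T}" if "(x,K) \<in> q" for x K
      using tagged_division_ofD(3)[OF p(1), of x K] that by (simp add: q_def)
    then show ?thesis by fastforce
  qed
  have "(\<Sum>K\<in>snd ` q. Sup K - Inf K) \<le> measure lebesgue G"
    by (rule sum_content_division_le[OF qd qG G(3)])
  then have small: "(\<Sum>K\<in>snd ` q. \<bar>f (Sup K) - f (Inf K)\<bar>) < e2"
    using ac'[OF qd q01] G(4) by linarith
  \<comment> \<open>Passing from tagged pairs to bare intervals requires the value 0 on degenerate
    boxes; the empty box gets it by fiat, because \<open>Sup\<close> and \<open>Inf\<close> carry no
    information there.\<close>
  define d where "d K = (if K = {} then 0 else \<bar>f (Sup K) - f (Inf K)\<bar>)" for K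
  have "(\<Sum>(x,K)\<in>q. d K) = (\<Sum>K\<in>snd ` q. d K)"
  proof (rule sum.over_tagged_division_lemma[OF qt])
    fix u v :: real assume "box u v = {}"
    then have "v \<le> u" by simp
    then show "d (cbox u v) = 0" by (cases "v = u") (auto simp: d_def)
  qed
  also have "\<dots> \<le> (\<Sum>K\<in>snd ` q. \<bar>f (Sup K) - f (Inf K)\<bar>)"
    by (intro sum_mono) (auto simp: d_def)
  finally have bad: "(\<Sum>(x,K)\<in>q. d K) < e2" using small by linarith
  have "f T - f 0 = (\<Sum>(x,K)\<in>p. f (Sup K) - f (Inf K))"
    using additive_tagged_division_1[OF T p(1), of f] by simp
  also have "\<dots> \<le> (\<Sum>(x,K)\<in>p. e2 * (Sup K - Inf K) + (if (x,K) \<in> q then d K else 0))"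
  proof (intro sum_mono, clarify)
    fix x K assume xK: "(x,K) \<in> p"
    show "f (Sup K) - f (Inf K) \<le> e2 * (Sup K - Inf K) + (if (x, K) \<in> q then d K else 0)"
    proof (cases "(x,K) \<in> q")
      case True
      have "K \<noteq> {}" "0 \<le> e2 * (Sup K - Inf K)" using K[OF xK] e2 by auto
      then show ?thesis using True by (auto simp: d_def)
    next
      case False
      then show ?thesis using good xK by auto
    qed
  qed
  also have "\<dots> = e2 * (\<Sum>(x,K)\<in>p. Sup K - Inf K) + (\<Sum>(x,K)\<in>p. if (x,K) \<in> q then d K else 0)"
    by (simp add: case_prod_unfold sum.distrib sum_distrib_left)
  also have "(\<Sum>(x,K)\<in>p. Sup K - Inf K) = T"
    using additive_tagged_division_1[OF T p(1), of "\<lambda>x. x"] by simp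
  also have "(\<Sum>(x,K)\<in>p. if (x,K) \<in> q then d K else 0) = (\<Sum>(x,K)\<in>q. d K)"
  proof -
    have q: "{xK \<in> p. xK \<in> q} = q" by (auto simp: q_def)
    have "(\<Sum>xK\<in>{xK \<in> p. xK \<in> q}. d (snd xK)) = (\<Sum>xK\<in>p. if xK \<in> q then d (snd xK) else 0)"
      using fin by (rule sum.inter_filter)
    then show ?thesis by (simp add: q case_prod_unfold)
  qed
  finally have "f T - f 0 \<le> e2 * T + e2" using bad by linarith
  also have "\<dots> = e2 * (T + 1)" by (simp add: algebra_simps)
  also have "\<dots> = e" using T by (simp add: e2_def)
  finally show "f T \<le> f 0 + e" by simp
qed

section \<open>The inner product and the norm on \<open>H\<close>\<close>

lemma L2_mult_integrable:
  assumes "f \<in> L2 S" "g \<in> L2 S"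
  shows "integrable (lebesgue_on S) (\<lambda>x. f x * g x)"
proof (rule Bochner_Integration.integrable_bound)
  show "integrable (lebesgue_on S) (\<lambda>x. (f x)\<^sup>2 + (g x)\<^sup>2)"
    using assms by (simp add: L2_def)
  show "(\<lambda>x. f x * g x) \<in> borel_measurable (lebesgue_on S)"
    using assms by (auto simp: L2_def intro: borel_measurable_times)
  have "\<bar>f x * g x\<bar> \<le> (f x)\<^sup>2 + (g x)\<^sup>2" for x
  proof -
    have "2 * (\<bar>f x\<bar> * \<bar>g x\<bar>) \<le> (f x)\<^sup>2 + (g x)\<^sup>2"
      using sum_squares_bound[of "\<bar>f x\<bar>" "\<bar>g x\<bar>"] by simp
    moreover have "0 \<le> \<bar>f x\<bar> * \<bar>g x\<bar>" by simp
    ultimately show ?thesis unfolding abs_mult by linarith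
  qed
  then show "AE x in lebesgue_on S. norm (f x * g x) \<le> norm ((f x)\<^sup>2 + (g x)\<^sup>2)" by simp
qed

lemma L2_diff:
  assumes "f \<in> L2 S" "g \<in> L2 S"
  shows "(\<lambda>x. f x - g x) \<in> L2 S"
  using assms L2_mult_integrable[OF assms]
  by (auto simp: L2_def power2_diff mult.assoc)

lemma L2_scale: "f \<in> L2 S \<Longrightarrow> (\<lambda>x. c * f x) \<in> L2 S"
  by (auto simp: L2_def power_mult_distrib)

lemma H_space_diff: "U \<in> H_space L \<Longrightarrow> V \<in> H_space L \<Longrightarrow> H_diff U V \<in> H_space L"
  by (simp add: H_space_def H_diff_def L2_diff)

lemma H_space_scale: "U \<in> H_space L \<Longrightarrow> H_scale c U \<in> H_space L"
  by (simp add: H_space_def H_scale_def L2_scale)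

lemma H_inner_commute: "H_inner L U V = H_inner L V U"
  by (simp add: H_inner_def mult.commute)

lemma H_inner_diff_left:
  assumes "U \<in> H_space L" "V \<in> H_space L" "W \<in> H_space L"
  shows "H_inner L (H_diff U V) W = H_inner L U W - H_inner L V W"
proof -
  have "integrable (lebesgue_on {0<..<L}) (\<lambda>x. fst U x * fst W x)"
       "integrable (lebesgue_on {0<..<L}) (\<lambda>x. fst V x * fst W x)"
    using assms by (auto simp: H_space_def intro: L2_mult_integrable)
  then show ?thesis
    by (simp add: H_inner_def H_diff_def left_diff_distrib sum_subtractf)
qed

lemma H_inner_diff_right:
  assumes "U \<in> H_space L" "V \<in> H_space L" "W \<in> H_space L"
  shows "H_inner L W (H_diff U V) = H_inner L W U - H_inner L W V"
  using H_inner_diff_left[OF assms] by (simp add: H_inner_commute)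

lemma H_inner_scale_left: "H_inner L (H_scale c U) W = c * H_inner L U W"
  by (simp add: H_inner_def H_scale_def mult.assoc sum_distrib_left distrib_left)

lemma H_inner_scale_right: "H_inner L W (H_scale c U) = c * H_inner L W U"
  using H_inner_scale_left by (metis H_inner_commute)

lemma H_inner_self_nonneg: "H_inner L U U \<ge> 0"
  unfolding H_inner_def by (intro add_nonneg_nonneg sum_nonneg integral_nonneg_AE) auto

lemma H_norm_nonneg: "H_norm L U \<ge> 0"
  by (simp add: H_norm_def H_inner_self_nonneg)

lemma H_norm_square: "(H_norm L U)\<^sup>2 = H_inner L U U"
  by (simp add: H_norm_def H_inner_self_nonneg)

text \<open>The type \<open>state\<close> carries no inner product structure, so the discriminant
  argument is run by hand: the squared norm of \<open>U - s V\<close> is a nonnegative quadratic in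
  \<open>s\<close>. The form is only semidefinite on representatives, hence the separate case
  \<open>A = 0\<close>.\<close>

lemma H_Cauchy_Schwarz:
  assumes U: "U \<in> H_space L" and V: "V \<in> H_space L"
  shows "\<bar>H_inner L U V\<bar> \<le> H_norm L U * H_norm L V"
proof -
  define A B C where "A = H_inner L V V" and "B = H_inner L U V" and "C = H_inner L U U"
  have pos: "0 \<le> C - 2 * s * B + s\<^sup>2 * A" for s
  proof -
    have "0 \<le> H_inner L (H_diff U (H_scale s V)) (H_diff U (H_scale s V))"
      by (rule H_inner_self_nonneg)
    also have "\<dots> = C - 2 * s * B + s\<^sup>2 * A"
      using U V by (simp add: H_inner_diff_left H_inner_diff_right H_space_scale H_space_diff
          H_inner_scale_left H_inner_scale_right A_def B_def C_def H_inner_commute[of L V U] power2_eq_square algebra_simps)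
    finally show ?thesis .
  qed
  have A: "A \<ge> 0" and C: "C \<ge> 0" by (simp_all add: A_def C_def H_inner_self_nonneg)
  have "B\<^sup>2 \<le> C * A"
  proof (cases "A = 0")
    case True
    have "B = 0"
    proof (rule ccontr)
      assume "B \<noteq> 0"
      \<comment> \<open>For \<open>A = 0\<close> the quadratic is affine in \<open>s\<close>, and
        this choice makes it equal to -1.\<close>
      then show False using pos[of "(C + 1) / (2 * B)"] True by (simp add: field_simps)
    qed
    then show ?thesis using True by simp
  next
    case False
    then have "A > 0" using A by simp
    then show ?thesis using pos[of "B / A"] by (simp add: field_simps power2_eq_square)
  qed
  then have "\<bar>B\<bar> \<le> sqrt (C * A)" by (metis real_sqrt_abs real_sqrt_le_mono)
  then show ?thesis by (simp add: H_norm_def real_sqrt_mult A_def B_def C_def)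
qed

lemma H_norm_diff_triangle:
  assumes U: "U \<in> H_space L" and V: "V \<in> H_space L"
  shows "H_norm L (H_diff U V) \<le> H_norm L U + H_norm L V"
proof (rule power2_le_imp_le)
  have "(H_norm L (H_diff U V))\<^sup>2 = (H_norm L U)\<^sup>2 - 2 * H_inner L U V + (H_norm L V)\<^sup>2"
    using U V by (simp add: H_norm_square H_inner_diff_left H_inner_diff_right H_space_diff H_inner_commute[of L V U])
  also have "\<dots> \<le> (H_norm L U + H_norm L V)\<^sup>2"
    using H_Cauchy_Schwarz[OF U V] by (simp add: power2_sum abs_le_iff)
  finally show "(H_norm L (H_diff U V))\<^sup>2 \<le> (H_norm L U + H_norm L V)\<^sup>2" .
qed (simp add: H_norm_nonneg)

lemma H_norm_diff_commute: "H_norm L (H_diff U V) = H_norm L (H_diff V U)"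
  by (simp add: H_norm_def H_inner_def H_diff_def) (simp add: algebra_simps)

lemma H_norm_reverse_triangle:
  assumes U: "U \<in> H_space L" and V: "V \<in> H_space L"
  shows "\<bar>H_norm L U - H_norm L V\<bar> \<le> H_norm L (H_diff U V)"
proof -
  \<comment> \<open>The triangle inequality is available for differences only, so each state is
    rewritten as a difference.\<close>
  have 1: "H_diff U (H_diff U V) = V" and 2: "H_diff V (H_diff V U) = U" by (simp_all add: H_diff_def)
  have "H_norm L V \<le> H_norm L U + H_norm L (H_diff U V)"
    using H_norm_diff_triangle[OF U H_space_diff[OF U V]] 1 by simp
  moreover have "H_norm L U \<le> H_norm L V + H_norm L (H_diff U V)"
    using H_norm_diff_triangle[OF V H_space_diff[OF V U]] 2 by (simp add: H_norm_diff_commute)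
  ultimately show ?thesis by linarith
qed

lemma H_norm_zero_iff:
  assumes "L \<noteq> 0" "U \<in> H_space L" "V \<in> H_space L"
  shows "H_norm L (H_diff U V) = 0 \<longleftrightarrow> H_eq L U V"
proof -
  let ?D = "H_diff U V"
  have D: "fst ?D \<in> L2 {0<..<L}" using H_space_diff[OF assms(2,3)] by (simp add: H_space_def)
  then have int: "integrable (lebesgue_on {0<..<L}) (\<lambda>x. fst ?D x * fst ?D x)"
    by (simp add: L2_def power2_eq_square)
  have "H_norm L ?D = 0 \<longleftrightarrow> (\<integral>x. fst ?D x * fst ?D x \<partial>lebesgue_on {0<..<L}) + (\<Sum>i\<in>{0, L}. snd ?D i * snd ?D i) = 0"
    by (simp add: H_norm_def H_inner_def)
  also have "\<dots> \<longleftrightarrow> (\<integral>x. fst ?D x * fst ?D x \<partial>lebesgue_on {0<..<L}) = 0 \<and> (\<Sum>i\<in>{0, L}. snd ?D i * snd ?D i) = 0"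
  proof (rule add_nonneg_eq_0_iff)
    show "0 \<le> (\<integral>x. fst ?D x * fst ?D x \<partial>lebesgue_on {0<..<L})" by (rule Bochner_Integration.integral_nonneg) simp
    show "0 \<le> (\<Sum>i\<in>{0, L}. snd ?D i * snd ?D i)" by (rule sum_nonneg) simp
  qed
  finally have e: "H_norm L ?D = 0 \<longleftrightarrow> (\<integral>x. fst ?D x * fst ?D x \<partial>lebesgue_on {0<..<L}) = 0 \<and> (\<Sum>i\<in>{0, L}. snd ?D i * snd ?D i) = 0" .
  have e1: "(\<integral>x. fst ?D x * fst ?D x \<partial>lebesgue_on {0<..<L}) = 0 \<longleftrightarrow>
     (AE x in lebesgue_on {0<..<L}. fst ?D x * fst ?D x = 0)"
    using int by (rule integral_nonneg_eq_0_iff_AE) simp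
  have e2: "(\<Sum>i\<in>{0, L}. snd ?D i * snd ?D i) = 0 \<longleftrightarrow> (\<forall>i\<in>{0,L}. snd ?D i * snd ?D i = 0)"
    by (rule sum_nonneg_eq_0_iff) auto
  show ?thesis unfolding e e1 e2 by (simp add: H_eq_def H_diff_def)
qed

text \<open>With \<open>Q h\<close> the difference quotient of \<open>D\<close>, the quotient of the
  squared norms is exactly \<open>2 * H_inner L (D t) (Q h) + h * (H_norm L (Q h))\<^sup>2\<close>.
  The first term converges by Cauchy--Schwarz; the second vanishes because the norm of
  \<open>Q h\<close> stays bounded.\<close>

lemma has_derivative_H_norm_square:
  assumes D: "\<And>s. s \<ge> 0 \<Longrightarrow> D s \<in> H_space L" and t: "t > 0" and W: "W \<in> H_space L"
    and lim: "((\<lambda>h. H_norm L (H_diff (H_scale (1 / h) (H_diff (D (t + h)) (D t))) W)) \<longlongrightarrow> 0) (at 0)"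
  shows "((\<lambda>s. (H_norm L (D s))\<^sup>2) has_real_derivative 2 * H_inner L (D t) W) (at t)"
proof -
  define Q where "Q h = H_scale (1 / h) (H_diff (D (t + h)) (D t))" for h
  define r where "r h = H_norm L (H_diff (Q h) W)" for h
  have r: "(r \<longlongrightarrow> 0) (at 0)" using lim by (simp add: r_def[abs_def] Q_def[abs_def])
  have Dt: "D t \<in> H_space L" using D t by simp
  have ev: "\<forall>\<^sub>F h in at 0. h \<noteq> 0 \<and> t + h \<ge> 0"
    unfolding eventually_at using t by (intro exI[of _ t] conjI ballI) (simp_all add: dist_real_def abs_less_iff)
  have QH: "Q h \<in> H_space L" if "t + h \<ge> 0" for h
    using D[OF that] Dt by (simp add: Q_def H_space_scale H_space_diff)
  have e: "\<bar>((H_norm L (D (t + h)))\<^sup>2 - (H_norm L (D t))\<^sup>2) / h - 2 * H_inner L (D t) W\<bar>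
       \<le> 2 * H_norm L (D t) * r h + \<bar>h\<bar> * (H_norm L W + r h)\<^sup>2" if h: "h \<noteq> 0 \<and> t + h \<ge> 0" for h
  proof -
    have Dh: "D (t + h) \<in> H_space L" using D h by simp
    have nQ: "H_norm L (Q h) \<le> H_norm L W + r h"
      using H_norm_reverse_triangle[OF QH W, of h] h by (simp add: r_def abs_le_iff)
    have "((H_norm L (D (t + h)))\<^sup>2 - (H_norm L (D t))\<^sup>2) / h = 2 * H_inner L (D t) (Q h) + h * (H_norm L (Q h))\<^sup>2"
    proof -
      have "2 * H_inner L (D t) (Q h) = 2 * (H_inner L (D t) (D (t + h)) - H_inner L (D t) (D t)) / h"
        using Dt Dh by (simp add: Q_def H_inner_scale_right H_inner_diff_right)
      moreover have "h * (H_norm L (Q h))\<^sup>2 =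
          (H_inner L (D (t + h)) (D (t + h)) - 2 * H_inner L (D t) (D (t + h)) + H_inner L (D t) (D t)) / h"
        using Dt Dh h
        by (simp add: H_norm_square Q_def H_inner_scale_left H_inner_scale_right H_inner_diff_left
          H_inner_diff_right H_space_diff H_inner_commute[of L "D (t+h)" "D t"])
      ultimately show ?thesis using h by (simp add: H_norm_square field_simps)
    qed
    moreover have "\<bar>H_inner L (D t) (Q h) - H_inner L (D t) W\<bar> \<le> H_norm L (D t) * r h"
      using H_Cauchy_Schwarz[OF Dt H_space_diff[OF QH W]] h H_inner_diff_right[OF QH W Dt] by (simp add: r_def)
    moreover have "\<bar>h * (H_norm L (Q h))\<^sup>2\<bar> \<le> \<bar>h\<bar> * (H_norm L W + r h)\<^sup>2"
      using nQ by (simp add: abs_mult mult_left_mono power_mono H_norm_nonneg)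
    ultimately show ?thesis by linarith
  qed
  have "((\<lambda>h. ((H_norm L (D (t + h)))\<^sup>2 - (H_norm L (D t))\<^sup>2) / h - 2 * H_inner L (D t) W) \<longlongrightarrow> 0) (at 0)"
  proof (rule Lim_null_comparison)
    show "\<forall>\<^sub>F h in at 0. norm (((H_norm L (D (t + h)))\<^sup>2 - (H_norm L (D t))\<^sup>2) / h - 2 * H_inner L (D t) W)
       \<le> 2 * H_norm L (D t) * r h + \<bar>h\<bar> * (H_norm L W + r h)\<^sup>2"
      using ev by eventually_elim (use e in auto)
    have "((\<lambda>h. 2 * H_norm L (D t) * r h + \<bar>h\<bar> * (H_norm L W + r h)\<^sup>2) \<longlongrightarrow> 2 * H_norm L (D t) * 0 + \<bar>0\<bar> * (H_norm L W + 0)\<^sup>2) (at 0)"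
      by (intro tendsto_intros r)
    then show "((\<lambda>h. 2 * H_norm L (D t) * r h + \<bar>h\<bar> * (H_norm L W + r h)\<^sup>2) \<longlongrightarrow> 0) (at 0)" by simp
  qed
  then show ?thesis by (simp add: DERIV_def LIM_zero_iff)
qed

section \<open>Monotonicity of the subdifferential and uniqueness of the flow\<close>

lemma total_variation_nonneg: "0 \<le> total_variation L u"
proof -
  have "(\<lambda>x. 0) \<in> {\<phi> \<in> C1_compact 0 L. \<forall>x. \<bar>\<phi> x\<bar> \<le> 1}"
    by (simp add: C1_compact_def)
  then show ?thesis unfolding total_variation_def
    by (rule SUP_upper2) simp
qed

lemma energy_nonneg: "0 \<le> energy L U"
  by (auto simp: energy_def intro!: add_nonneg_nonneg total_variation_nonneg sum_nonneg)

text \<open>Adding the two subgradient inequalities cancels both energies. They are finite and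
  nonnegative, so the cancellation can take place in the reals instead of the extended
  reals.\<close>

lemma subdifferential_monotone:
  assumes UV: "U \<in> H_space L" "V \<in> H_space L"
    and W: "W \<in> subdifferential L U" "Z \<in> subdifferential L V"
  shows "0 \<le> H_inner L (H_diff W Z) (H_diff U V)"
proof -
  have H: "W \<in> H_space L" "Z \<in> H_space L" using W by (auto simp: subdifferential_def)
  have fin: "energy L U < \<infinity>" "energy L V < \<infinity>" using W by (auto simp: subdifferential_def)
  obtain eU where eU: "energy L U = ereal eU" using fin(1) energy_nonneg[of L U] by (cases "energy L U") auto
  obtain eV where eV: "energy L V = ereal eV" using fin(2) energy_nonneg[of L V] by (cases "energy L V") auto
  have "energy L U + ereal (H_inner L W (H_diff V U)) \<le> energy L V"
    using W UV by (auto simp: subdifferential_def)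
  then have 1: "eU + H_inner L W (H_diff V U) \<le> eV" by (simp add: eU eV)
  have "energy L V + ereal (H_inner L Z (H_diff U V)) \<le> energy L U"
    using W UV by (auto simp: subdifferential_def)
  then have 2: "eV + H_inner L Z (H_diff U V) \<le> eU" by (simp add: eU eV)
  show ?thesis using 1 2 UV H
    by (simp add: H_inner_diff_left H_inner_diff_right H_space_diff)
qed

lemma division_singleton_interval:
  fixes s t :: real
  assumes "s \<le> t"
  shows "{{s..t}} division_of {s..t}"
  using assms division_of_self[of s t] by simp

text \<open>Absolute continuity is tested on divisions with a single interval. The continuity
  obtained serves to bound the norm on \<open>{0..T}\<close>.\<close>

lemma H_absolutely_continuous_norm_continuous:
  assumes U: "\<And>t. t \<ge> 0 \<Longrightarrow> U t \<in> H_space L" and ac: "H_absolutely_continuous_on L T U"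
  shows "continuous_on {0..T} (\<lambda>t. H_norm L (U t))"
  unfolding continuous_on_iff
proof (intro ballI allI impI)
  fix x e :: real assume x: "x \<in> {0..T}" and "0 < e"
  then obtain d where d: "d > 0" and ac': "\<And>D S. D division_of S \<Longrightarrow> S \<subseteq> {0..T} \<Longrightarrow> (\<Sum>K\<in>D. Sup K - Inf K) < d \<Longrightarrow>
        (\<Sum>K\<in>D. H_norm L (H_diff (U (Sup K)) (U (Inf K)))) < e"
    using ac unfolding H_absolutely_continuous_on_def by meson
  have *: "\<bar>H_norm L (U t) - H_norm L (U s)\<bar> < e" if "s \<le> t" "0 \<le> s" "t \<le> T" "t - s < d" for s t
  proof -
    have "H_norm L (H_diff (U t) (U s)) < e"
      using ac'[OF division_singleton_interval[OF that(1)]] that by simp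
    moreover have "U t \<in> H_space L" "U s \<in> H_space L" using U that by auto
    ultimately show ?thesis using H_norm_reverse_triangle by fastforce
  qed
  show "\<exists>d>0. \<forall>x'\<in>{0..T}. dist x' x < d \<longrightarrow> dist (H_norm L (U x')) (H_norm L (U x)) < e"
  proof (intro exI conjI ballI impI)
    fix y assume y: "y \<in> {0..T}" "dist y x < d"
    show "dist (H_norm L (U y)) (H_norm L (U x)) < e"
      using *[of x y] *[of y x] x y by (cases "x \<le> y") (auto simp: dist_real_def)
  qed (use d in auto)
qed

lemma division_endpoints_in:
  fixes \<D> :: "real set set"
  assumes "\<D> division_of S" "S \<subseteq> {0..T}" "K \<in> \<D>"
  shows "0 \<le> Inf K" "Inf K \<le> T" "0 \<le> Sup K" "Sup K \<le> T"
proof -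
  have "K \<noteq> {}" "K \<subseteq> S" using assms(1,3) by auto
  moreover obtain a b where "K = cbox a b" using assms(1,3) by (metis cbox_division_memE)
  ultimately show "0 \<le> Inf K" "Inf K \<le> T" "0 \<le> Sup K" "Sup K \<le> T"
    using assms(2) by (auto simp: subset_iff)
qed

lemma H_absolutely_continuous_diff:
  assumes U: "\<And>t. t \<ge> 0 \<Longrightarrow> U t \<in> H_space L" and V: "\<And>t. t \<ge> 0 \<Longrightarrow> V t \<in> H_space L"
    and acU: "H_absolutely_continuous_on L T U" and acV: "H_absolutely_continuous_on L T V"
  shows "H_absolutely_continuous_on L T (\<lambda>t. H_diff (U t) (V t))"
  unfolding H_absolutely_continuous_on_def
proof (intro allI impI)
  fix e :: real assume "e > 0"
  then have "e / 2 > 0" by simp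
  obtain d1 where d1: "d1 > 0" "\<And>D S. D division_of S \<Longrightarrow> S \<subseteq> {0..T} \<Longrightarrow> (\<Sum>K\<in>D. Sup K - Inf K) < d1 \<Longrightarrow>
        (\<Sum>K\<in>D. H_norm L (H_diff (U (Sup K)) (U (Inf K)))) < e / 2"
    using acU \<open>e / 2 > 0\<close> unfolding H_absolutely_continuous_on_def by meson
  obtain d2 where d2: "d2 > 0" "\<And>D S. D division_of S \<Longrightarrow> S \<subseteq> {0..T} \<Longrightarrow> (\<Sum>K\<in>D. Sup K - Inf K) < d2 \<Longrightarrow>
        (\<Sum>K\<in>D. H_norm L (H_diff (V (Sup K)) (V (Inf K)))) < e / 2"
    using acV \<open>e / 2 > 0\<close> unfolding H_absolutely_continuous_on_def by meson
  show "\<exists>d>0. \<forall>D S. D division_of S \<and> S \<subseteq> {0..T} \<and> (\<Sum>K\<in>D. Sup K - Inf K) < d \<longrightarrow>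
     (\<Sum>K\<in>D. H_norm L (H_diff (H_diff (U (Sup K)) (V (Sup K))) (H_diff (U (Inf K)) (V (Inf K))))) < e"
  proof (intro exI[of _ "min d1 d2"] conjI allI impI)
    fix D S assume D: "D division_of S \<and> S \<subseteq> {0..T} \<and> (\<Sum>K\<in>D. Sup K - Inf K) < min d1 d2"
    have "(\<Sum>K\<in>D. H_norm L (H_diff (H_diff (U (Sup K)) (V (Sup K))) (H_diff (U (Inf K)) (V (Inf K)))))
      \<le> (\<Sum>K\<in>D. H_norm L (H_diff (U (Sup K)) (U (Inf K))) + H_norm L (H_diff (V (Sup K)) (V (Inf K))))"
    proof (intro sum_mono)
      fix K assume "K \<in> D"
      then have K: "0 \<le> Inf K" "0 \<le> Sup K" using D division_endpoints_in[of D S T K] by auto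
      have "H_diff (H_diff (U (Sup K)) (V (Sup K))) (H_diff (U (Inf K)) (V (Inf K)))
          = H_diff (H_diff (U (Sup K)) (U (Inf K))) (H_diff (V (Sup K)) (V (Inf K)))"
        by (auto simp: H_diff_def)
      then show "H_norm L (H_diff (H_diff (U (Sup K)) (V (Sup K))) (H_diff (U (Inf K)) (V (Inf K))))
        \<le> H_norm L (H_diff (U (Sup K)) (U (Inf K))) + H_norm L (H_diff (V (Sup K)) (V (Inf K)))"
        using U V K by (simp add: H_norm_diff_triangle H_space_diff)
    qed
    also have "\<dots> < e" using D d1(2)[of D S] d2(2)[of D S] by (simp add: sum.distrib)
    finally show "(\<Sum>K\<in>D. H_norm L (H_diff (H_diff (U (Sup K)) (V (Sup K))) (H_diff (U (Inf K)) (V (Inf K))))) < e" .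
  qed (use d1 d2 in auto)
qed

text \<open>The norm is bounded by some \<open>M\<close> on the compact interval, and factoring a
  difference of squares bounds each summand by \<open>2 * M\<close> times the increment of
  \<open>U\<close>.\<close>

lemma H_absolutely_continuous_norm_square:
  assumes U: "\<And>t. t \<ge> 0 \<Longrightarrow> U t \<in> H_space L" and ac: "H_absolutely_continuous_on L T U" and "\<epsilon> > 0"
  shows "\<exists>\<delta>>0. \<forall>D S. D division_of S \<and> S \<subseteq> {0..T} \<and> (\<Sum>K\<in>D. Sup K - Inf K) < \<delta> \<longrightarrow>
        (\<Sum>K\<in>D. \<bar>(H_norm L (U (Sup K)))\<^sup>2 - (H_norm L (U (Inf K)))\<^sup>2\<bar>) < \<epsilon>"
proof -
  have "compact ((\<lambda>t. H_norm L (U t)) ` {0..T})"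
    by (intro compact_continuous_image H_absolutely_continuous_norm_continuous U ac) auto
  then have "bounded ((\<lambda>t. H_norm L (U t)) ` {0..T})" by (rule compact_imp_bounded)
  then obtain M where M: "M > 0" "\<And>t. t \<in> {0..T} \<Longrightarrow> \<bar>H_norm L (U t)\<bar> \<le> M"
    unfolding bounded_pos by auto
  have "\<epsilon> / (2 * M) > 0" using M \<open>\<epsilon> > 0\<close> by simp
  then obtain d where d: "d > 0" "\<And>D S. D division_of S \<Longrightarrow> S \<subseteq> {0..T} \<Longrightarrow> (\<Sum>K\<in>D. Sup K - Inf K) < d \<Longrightarrow>
        (\<Sum>K\<in>D. H_norm L (H_diff (U (Sup K)) (U (Inf K)))) < \<epsilon> / (2 * M)"
    using ac unfolding H_absolutely_continuous_on_def by meson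
  show ?thesis
  proof (intro exI[of _ d] conjI allI impI)
    fix D S assume D: "D division_of S \<and> S \<subseteq> {0..T} \<and> (\<Sum>K\<in>D. Sup K - Inf K) < d"
    have "(\<Sum>K\<in>D. \<bar>(H_norm L (U (Sup K)))\<^sup>2 - (H_norm L (U (Inf K)))\<^sup>2\<bar>)
       \<le> (\<Sum>K\<in>D. 2 * M * H_norm L (H_diff (U (Sup K)) (U (Inf K))))"
    proof (intro sum_mono)
      fix K assume "K \<in> D"
      then have K: "0 \<le> Inf K" "Inf K \<le> T" "0 \<le> Sup K" "Sup K \<le> T"
        using D division_endpoints_in[of D S T K] by auto
      have "\<bar>(H_norm L (U (Sup K)))\<^sup>2 - (H_norm L (U (Inf K)))\<^sup>2\<bar>
          = \<bar>H_norm L (U (Sup K)) + H_norm L (U (Inf K))\<bar> * \<bar>H_norm L (U (Sup K)) - H_norm L (U (Inf K))\<bar>"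
        unfolding abs_mult[symmetric] by (simp add: power2_eq_square algebra_simps)
      also have "\<dots> \<le> (2 * M) * H_norm L (H_diff (U (Sup K)) (U (Inf K)))"
        using M(2)[of "Sup K"] M(2)[of "Inf K"] K U
        by (intro mult_mono H_norm_reverse_triangle) auto
      finally show "\<bar>(H_norm L (U (Sup K)))\<^sup>2 - (H_norm L (U (Inf K)))\<^sup>2\<bar>
         \<le> 2 * M * H_norm L (H_diff (U (Sup K)) (U (Inf K)))" .
    qed
    also have "\<dots> = 2 * M * (\<Sum>K\<in>D. H_norm L (H_diff (U (Sup K)) (U (Inf K))))"
      by (simp add: sum_distrib_left)
    also have "\<dots> < \<epsilon>" using d(2)[of D S] D M(1) by (simp add: field_simps)
    finally show "(\<Sum>K\<in>D. \<bar>(H_norm L (U (Sup K)))\<^sup>2 - (H_norm L (U (Inf K)))\<^sup>2\<bar>) < \<epsilon>" .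
  qed (use d in auto)
qed

lemma W12_locD:
  assumes "W12_loc L U W"
  shows "t \<ge> 0 \<Longrightarrow> U t \<in> H_space L" "T > 0 \<Longrightarrow> H_absolutely_continuous_on L T U"
    "AE t in lebesgue_on {0<..}. H_has_derivative L U (W t) t (at 0)"
  using assms by (simp_all add: W12_loc_def)

text \<open>The derivative is \<open>2 * H_inner L (U s - V s) (W - Z)\<close>, read with
  \<open>H_diff\<close>. The subgradients are the negatives of \<open>W\<close> and
  \<open>Z\<close>, so monotonicity makes this nonpositive.\<close>

lemma gradient_flow_difference_derivative:
  fixes U V :: "real \<Rightarrow> state"
  assumes HU: "\<And>t. t \<ge> 0 \<Longrightarrow> U t \<in> H_space L" and HV: "\<And>t. t \<ge> 0 \<Longrightarrow> V t \<in> H_space L"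
    and s: "0 < s"
    and UW: "H_has_derivative L U W s (at 0)" and VZ: "H_has_derivative L V Z s (at 0)"
    and sub: "H_scale (-1) W \<in> subdifferential L (U s)" "H_scale (-1) Z \<in> subdifferential L (V s)"
  shows "\<exists>d\<le>0. ((\<lambda>s. (H_norm L (H_diff (U s) (V s)))\<^sup>2) has_real_derivative d) (at s)"
proof -
  define D where "D t = H_diff (U t) (V t)" for t
  have HD: "\<And>t. t \<ge> 0 \<Longrightarrow> D t \<in> H_space L" using HU HV by (simp add: D_def H_space_diff)
  have HW: "W \<in> H_space L" and HZ: "Z \<in> H_space L" using UW VZ by (auto simp: H_has_derivative_def)
  have pos: "0 \<le> H_inner L (H_diff (H_scale (-1) W) (H_scale (-1) Z)) (H_diff (U s) (V s))"
    using subdifferential_monotone[OF _ _ sub] HU HV s by simp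
  have le: "2 * H_inner L (D s) (H_diff W Z) \<le> 0"
  proof -
    have "U s \<in> H_space L" "V s \<in> H_space L" using HU HV s by simp_all
    then have "H_inner L (H_diff (H_scale (-1) W) (H_scale (-1) Z)) (H_diff (U s) (V s))
       = - H_inner L (H_diff W Z) (H_diff (U s) (V s))"
      using HW HZ by (simp add: H_inner_diff_left H_space_diff H_space_scale H_inner_scale_left)
    with pos show ?thesis by (simp add: D_def H_inner_commute)
  qed
  have "((\<lambda>s. (H_norm L (D s))\<^sup>2) has_real_derivative 2 * H_inner L (D s) (H_diff W Z)) (at s)"
  proof (rule has_derivative_H_norm_square[OF HD s H_space_diff[OF HW HZ]])
    let ?p = "\<lambda>h::real. H_diff (H_scale (1 / h :: real) (H_diff (U (s + h)) (U s))) W"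
    let ?q = "\<lambda>h::real. H_diff (H_scale (1 / h :: real) (H_diff (V (s + h)) (V s))) Z"
    show "((\<lambda>h. H_norm L (H_diff (H_scale (1 / h) (H_diff (D (s + h)) (D s))) (H_diff W Z))) \<longlongrightarrow> 0) (at 0)"
    proof (rule Lim_null_comparison)
      show "\<forall>\<^sub>F h in at 0. norm (H_norm L (H_diff (H_scale (1 / h) (H_diff (D (s + h)) (D s))) (H_diff W Z)))
         \<le> H_norm L (?p h) + H_norm L (?q h)"
        unfolding eventually_at
      proof (intro exI[of _ s] conjI ballI impI)
        fix h :: real assume "h \<noteq> 0 \<and> dist h 0 < s"
        then have h: "s + h \<ge> 0" by (auto simp: dist_real_def)
        have eq: "H_diff (H_scale (1 / h) (H_diff (D (s + h)) (D s))) (H_diff W Z) = H_diff (?p h) (?q h)"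
          by (auto simp: D_def H_diff_def H_scale_def algebra_simps)
        show "norm (H_norm L (H_diff (H_scale (1 / h) (H_diff (D (s + h)) (D s))) (H_diff W Z)))
         \<le> H_norm L (?p h) + H_norm L (?q h)"
          unfolding eq using HU[of s] HV[of s] HU[OF h] HV[OF h] HW HZ s
          by (simp add: H_norm_nonneg H_norm_diff_triangle H_space_diff H_space_scale)
      qed (use s in auto)
      have "((\<lambda>h. H_norm L (?p h) + H_norm L (?q h)) \<longlongrightarrow> 0 + 0) (at 0)"
        using UW VZ unfolding H_has_derivative_def by (intro tendsto_add) auto
      then show "((\<lambda>h. H_norm L (?p h) + H_norm L (?q h)) \<longlongrightarrow> 0) (at 0)" by simp
    qed
  qed
  then show ?thesis
    using le unfolding D_def by blast
qed

lemma H_eq_trans_right: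
  assumes "H_eq L U W" "H_eq L V W"
  shows "H_eq L U V"
proof -
  have "AE x in lebesgue_on {0<..<L}. fst U x = fst W x" "AE x in lebesgue_on {0<..<L}. fst V x = fst W x"
    using assms by (simp_all add: H_eq_def)
  then have "AE x in lebesgue_on {0<..<L}. fst U x = fst V x" by eventually_elim simp
  then show ?thesis using assms by (simp add: H_eq_def)
qed

lemma gradient_flow_unique:
  assumes L: "L > 0" and U: "gradient_flow L U0 U" and V: "gradient_flow L U0 V" and t: "t \<ge> 0"
  shows "H_eq L (U t) (V t)"
proof -
  obtain W where W: "W12_loc L U W" "AE t in lebesgue_on {0<..}. H_scale (-1) (W t) \<in> subdifferential L (U t)"
    and U0: "H_eq L (U 0) U0" using U unfolding gradient_flow_def by (elim exE conjE, intro that)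
  obtain Z where Z: "W12_loc L V Z" "AE t in lebesgue_on {0<..}. H_scale (-1) (Z t) \<in> subdifferential L (V t)"
    and V0: "H_eq L (V 0) U0" using V unfolding gradient_flow_def by (elim exE conjE, intro that)
  have HU: "\<And>t. t \<ge> 0 \<Longrightarrow> U t \<in> H_space L" and HV: "\<And>t. t \<ge> 0 \<Longrightarrow> V t \<in> H_space L"
    using W12_locD(1)[OF W(1)] W12_locD(1)[OF Z(1)] by blast+
  define D where "D t = H_diff (U t) (V t)" for t
  have HD: "\<And>t. t \<ge> 0 \<Longrightarrow> D t \<in> H_space L" using HU HV by (simp add: D_def H_space_diff)
  show ?thesis
  proof (cases "t = 0")
    case True
    then show ?thesis using H_eq_trans_right[OF U0 V0] by simp
  next
    case False
    then have t: "t > 0" using t by simp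
    have acD: "H_absolutely_continuous_on L t D"
      unfolding D_def[abs_def] using W12_locD(2)[OF W(1) t] W12_locD(2)[OF Z(1) t] HU HV
      by (intro H_absolutely_continuous_diff) blast+
    have "AE s in lebesgue_on {0<..}. \<exists>d\<le>0. ((\<lambda>s. (H_norm L (D s))\<^sup>2) has_real_derivative d) (at s)"
    proof -
      have "AE s in lebesgue_on {0<..}. H_has_derivative L U (W s) s (at 0)"
           "AE s in lebesgue_on {0<..}. H_has_derivative L V (Z s) s (at 0)"
        using W12_locD(3)[OF W(1)] W12_locD(3)[OF Z(1)] by blast+
      moreover have "AE s in lebesgue_on {0<..}. s \<in> {0<..}"
        by (intro AE_I2) simp
      ultimately show ?thesis using W(2) Z(2)
      proof eventually_elim
        case (elim s)
        then show ?case
          unfolding D_def using gradient_flow_difference_derivative[of U L V s "W s" "Z s"] HU HV by simp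
      qed
    qed
    then have "AE s in lebesgue. s \<in> {0<..} \<longrightarrow> (\<exists>d\<le>0. ((\<lambda>s. (H_norm L (D s))\<^sup>2) has_real_derivative d) (at s))"
      by (subst (asm) AE_restrict_space_iff) auto
    then obtain N where N: "N \<in> null_sets lebesgue"
      "{s. \<not> (s \<in> {0<..} \<longrightarrow> (\<exists>d\<le>0. ((\<lambda>s. (H_norm L (D s))\<^sup>2) has_real_derivative d) (at s)))} \<subseteq> N"
      by (auto simp: eventually_ae_filter)
    have "(H_norm L (D t))\<^sup>2 \<le> (H_norm L (D 0))\<^sup>2"
    \<comment> \<open>The point 0 joins the exceptional set because the flow is controlled only at
      almost every positive time.\<close>
    proof (rule absolutely_continuous_nonincreasing[where N = "insert 0 N"])
      show "negligible (insert 0 N)" using N(1) by (simp add: negligible_iff_null_sets[symmetric])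
      show "\<exists>d\<le>0. ((\<lambda>s. (H_norm L (D s))\<^sup>2) has_real_derivative d) (at s)" if "s \<in> {0..t} - insert 0 N" for s
      proof -
        have "s \<notin> {s. \<not> (s \<in> {0<..} \<longrightarrow> (\<exists>d\<le>0. ((\<lambda>s. (H_norm L (D s))\<^sup>2) has_real_derivative d) (at s)))}"
          using N(2) that by blast
        then show ?thesis using that by simp
      qed
    qed (use t H_absolutely_continuous_norm_square[OF HD acD] in auto)
    also have "H_norm L (D 0) = 0"
    proof -
      have "H_eq L (U 0) (V 0)" using U0 V0 by (rule H_eq_trans_right)
      then show ?thesis using H_norm_zero_iff[OF _ HU HV] L by (simp add: D_def)
    qed
    finally have "H_norm L (D t) = 0" by simp
    then show ?thesis using H_norm_zero_iff[OF _ HU HV] L t by (simp add: D_def)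
  qed
qed

subsection \<open>Total variation and traces\<close>

lemma AE_lebesgue_on_except_finite:
  fixes S :: "real set"
  assumes "finite N" "S \<in> sets lebesgue" "\<And>x. x \<in> S \<Longrightarrow> x \<notin> N \<Longrightarrow> P x"
  shows "AE x in lebesgue_on S. P x"
proof -
  have "N \<in> null_sets lebesgue" using assms(1) negligible_finite negligible_iff_null_sets by blast
  then have "AE x in lebesgue. x \<notin> N" by (rule AE_not_in)
  then have "AE x in lebesgue. x \<in> S \<longrightarrow> P x" by eventually_elim (use assms(3) in blast)
  then show ?thesis using assms(2) by (subst AE_restrict_space_iff) auto
qed

lemma C1_compactD:
  assumes "\<phi> \<in> C1_compact p q"
  shows "(\<phi> has_real_derivative deriv \<phi> x) (at x)" "continuous_on UNIV (deriv \<phi>)"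
    "x \<notin> {p<..<q} \<Longrightarrow> \<phi> x = 0" "closure {x. \<phi> x \<noteq> 0} \<subseteq> {p<..<q}"
proof -
  obtain D where D: "\<And>x. (\<phi> has_vector_derivative D x) (at x)" "continuous_on UNIV D"
    using assms unfolding C1_compact_def C1_differentiable_on_def by auto
  have "deriv \<phi> = D"
    using D(1) by (intro ext DERIV_imp_deriv) (simp add: has_real_derivative_iff_has_vector_derivative)
  with D show "(\<phi> has_real_derivative deriv \<phi> x) (at x)" "continuous_on UNIV (deriv \<phi>)"
    by (simp_all add: has_real_derivative_iff_has_vector_derivative)
  show cl: "closure {x. \<phi> x \<noteq> 0} \<subseteq> {p<..<q}" using assms by (simp add: C1_compact_def)
  show "x \<notin> {p<..<q} \<Longrightarrow> \<phi> x = 0" using cl closure_subset[of "{x. \<phi> x \<noteq> 0}"] by blast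
qed

lemma C1_compact_mono:
  assumes "\<phi> \<in> C1_compact p q" "p' \<le> p" "q \<le> q'"
  shows "\<phi> \<in> C1_compact p' q'"
proof -
  have "{p<..<q} \<subseteq> {p'<..<q'}" using assms(2,3) by auto
  then show ?thesis using assms(1) unfolding C1_compact_def by blast
qed

lemma C1_compactI:
  assumes der: "\<And>x. (\<phi> has_real_derivative D x) (at x)" and D: "continuous_on UNIV D"
    and supp: "\<And>x. x \<notin> {p'..q'} \<Longrightarrow> \<phi> x = 0" and "p < p'" "q' < q"
  shows "\<phi> \<in> C1_compact p q"
proof -
  have "{x. \<phi> x \<noteq> 0} \<subseteq> {p'..q'}" using supp by blast
  then have "closure {x. \<phi> x \<noteq> 0} \<subseteq> {p'..q'}" by (intro closure_minimal) auto
  also have "\<dots> \<subseteq> {p<..<q}" using assms(4,5) by auto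
  finally show ?thesis
    using der D unfolding C1_compact_def C1_differentiable_on_def
    by (auto simp: has_real_derivative_iff_has_vector_derivative)
qed

text \<open>Steklov averages: \<open>\<phi>\<^sub>n(x)\<close> is the mean of \<open>\<psi>\<close> over \<open>[x, x + e\<^sub>n]\<close>.\<close>

lemma C1_compact_approximation:
  fixes \<psi> :: "real \<Rightarrow> real"
  assumes lip: "\<And>x y. \<bar>\<psi> x - \<psi> y\<bar> \<le> K * \<bar>x - y\<bar>"
    and M: "\<And>x. \<bar>\<psi> x\<bar> \<le> M"
    and supp: "\<forall>x. x \<notin> {\<alpha>..\<beta>} \<longrightarrow> \<psi> x = 0"
    and pq: "p < \<alpha>" "\<beta> < q"
  shows "\<exists>\<phi>. (\<forall>n. \<phi> n \<in> C1_compact p q) \<and> (\<forall>n x. \<bar>\<phi> n x\<bar> \<le> M) \<and> (\<forall>n x. \<bar>deriv (\<phi> n) x\<bar> \<le> K) \<and>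
    (\<forall>x. (\<lambda>n. \<phi> n x) \<longlonglongrightarrow> \<psi> x) \<and>
    (\<forall>x c. (\<psi> has_real_derivative c) (at x) \<longrightarrow> (\<lambda>n. deriv (\<phi> n) x) \<longlonglongrightarrow> c)"
proof -
  have cont: "isCont \<psi> x" for x
  proof -
    have "((\<lambda>y. \<psi> y - \<psi> x) \<longlongrightarrow> 0) (at x)"
    proof (rule Lim_null_comparison)
      show "\<forall>\<^sub>F y in at x. norm (\<psi> y - \<psi> x) \<le> K * \<bar>y - x\<bar>" using lip by simp
      have "((\<lambda>y. K * \<bar>y - x\<bar>) \<longlongrightarrow> K * \<bar>x - x\<bar>) (at x)" by (intro tendsto_intros)
      then show "((\<lambda>y. K * \<bar>y - x\<bar>) \<longlongrightarrow> 0) (at x)" by simp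
    qed
    then show ?thesis by (simp add: isCont_def LIM_zero_iff)
  qed
  then obtain \<Psi> where "\<And>x. (\<Psi> has_vector_derivative \<psi> x) (at x)"
    using einterval_antiderivative[of "-\<infinity>" "\<infinity>" \<psi>] by auto
  then have \<Psi>: "\<And>x. (\<Psi> has_real_derivative \<psi> x) (at x)"
    by (simp add: has_real_derivative_iff_has_vector_derivative)
  \<comment> \<open>The mean looks to the right, so the support spreads only to the left, down to
    \<open>\<alpha> - e n\<close>; half of the gap \<open>\<alpha> - p\<close> keeps it away from
    \<open>p\<close>.\<close>
  define e where "e n = (\<alpha> - p) / 2 / real (Suc n)" for n
  have e: "e n > 0" "e n \<le> (\<alpha> - p) / 2" for n
    using pq(1) divide_left_mono[of 1 "real (Suc n)" "(\<alpha> - p) / 2"] by (simp_all add: e_def)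
  have e0: "e \<longlonglongrightarrow> 0"
    unfolding e_def[abs_def] by (rule LIMSEQ_Suc, rule lim_const_over_n)
  define \<phi> where "\<phi> n x = (\<Psi> (x + e n) - \<Psi> x) / e n" for n x
  define d where "d n x = (\<psi> (x + e n) - \<psi> x) / e n" for n x
  have der: "(\<phi> n has_real_derivative d n x) (at x)" for n x
  proof -
    have "((\<lambda>x. \<Psi> (x + e n)) has_real_derivative \<psi> (x + e n)) (at x)"
      using \<Psi>[of "x + e n"] by (simp add: DERIV_shift)
    then show ?thesis
      unfolding \<phi>_def[abs_def] d_def by (intro DERIV_cdivide DERIV_diff \<Psi>)
  qed
  have deriv: "deriv (\<phi> n) x = d n x" for n x using der by (rule DERIV_imp_deriv)
  \<comment> \<open>A mean of \<open>\<psi>\<close> is a value of \<open>\<psi>\<close> at some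
    point of the window; the bound, the support and the pointwise convergence all follow from
    this.\<close>
  have mvt: "\<exists>\<xi>>x. \<xi> < x + e n \<and> \<phi> n x = \<psi> \<xi>" for n x
    using MVT2[of x "x + e n" \<Psi> \<psi>] \<Psi> e(1)[of n] by (force simp: \<phi>_def)
  show ?thesis
  proof (intro exI[of _ \<phi>] conjI allI impI)
    fix n x
    show "\<phi> n \<in> C1_compact p q"
    proof (rule C1_compactI[OF der])
      have "continuous_on UNIV \<psi>" using cont by (simp add: continuous_at_imp_continuous_on)
      moreover from this have "continuous_on UNIV (\<lambda>x. \<psi> (x + e n))"
        by (rule continuous_on_compose2) (auto intro!: continuous_intros)
      ultimately show "continuous_on UNIV (d n)"
        unfolding d_def[abs_def] using e(1)[of n] by (intro continuous_on_divide continuous_on_diff) auto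
      show "p < \<alpha> - e n" using e(2)[of n] pq(1) by (simp add: field_simps)
      show "\<beta> < q" by fact
      fix x assume "x \<notin> {\<alpha> - e n..\<beta>}"
      then show "\<phi> n x = 0" using mvt[of x n] supp by fastforce
    qed
    show "\<bar>\<phi> n x\<bar> \<le> M" using mvt[of x n] M by metis
    show "\<bar>deriv (\<phi> n) x\<bar> \<le> K"
      using lip[of "x + e n" x] e(1)[of n] by (simp add: deriv d_def abs_divide pos_divide_le_eq)
    show "(\<lambda>n. \<phi> n x) \<longlonglongrightarrow> \<psi> x"
    proof -
      have "(\<lambda>n. \<phi> n x - \<psi> x) \<longlonglongrightarrow> 0"
      proof (rule Lim_null_comparison)
        show "\<forall>\<^sub>F n in sequentially. norm (\<phi> n x - \<psi> x) \<le> K * e n"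
        proof (intro always_eventually allI)
          fix n
          obtain \<xi> where \<xi>: "\<xi> > x" "\<xi> < x + e n" "\<phi> n x = \<psi> \<xi>" using mvt by blast
          have "0 \<le> K" using lip[of 1 0] by simp
          have "\<bar>\<psi> \<xi> - \<psi> x\<bar> \<le> K * \<bar>\<xi> - x\<bar>" by (rule lip)
          also have "\<dots> \<le> K * e n" using \<xi> \<open>0 \<le> K\<close> by (intro mult_left_mono) auto
          finally show "norm (\<phi> n x - \<psi> x) \<le> K * e n" using \<xi> by simp
        qed
        show "(\<lambda>n. K * e n) \<longlonglongrightarrow> 0" using tendsto_mult_left[OF e0, of K] by simp
      qed
      then show ?thesis by (simp add: LIM_zero_iff)
    qed
    fix c assume "(\<psi> has_real_derivative c) (at x)"
    \<comment> \<open>The derivative of the mean is a difference quotient of \<open>\<psi>\<close>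
      itself, taken along the null sequence \<open>e n\<close>.\<close>
    then have "((\<lambda>h. (\<psi> (x + h) - \<psi> x) / h) \<longlongrightarrow> c) (at 0)" by (simp add: DERIV_def)
    moreover have "e n \<noteq> 0" for n using e(1)[of n] by simp
    then have "filterlim e (at 0) sequentially" using e0 by (simp add: filterlim_at)
    ultimately show "(\<lambda>n. deriv (\<phi> n) x) \<longlonglongrightarrow> c"
      unfolding deriv d_def by (rule filterlim_compose)
  qed
qed

text \<open>Dominated convergence with majorant \<open>\<bar>u x\<bar> * K\<close>: the derivatives
  of the Steklov averages are bounded by the Lipschitz constant and converge wherever
  \<open>\<psi>\<close> is differentiable.\<close>

lemma lipschitz_test_function_limit:
  fixes \<psi> u g :: "real \<Rightarrow> real"
  assumes lip: "\<And>x y. \<bar>\<psi> x - \<psi> y\<bar> \<le> K * \<bar>x - y\<bar>"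
    and M: "\<And>x. \<bar>\<psi> x\<bar> \<le> M"
    and supp: "\<forall>x. x \<notin> {\<alpha>..\<beta>} \<longrightarrow> \<psi> x = 0"
    and pq: "p < \<alpha>" "\<beta> < q"
    and S: "S \<in> sets lebesgue" and u: "integrable (lebesgue_on S) u"
    and g: "g \<in> borel_measurable (lebesgue_on S)"
    and der: "AE x in lebesgue_on S. (\<psi> has_real_derivative g x) (at x)"
  shows "\<exists>\<phi>. (\<forall>n. \<phi> n \<in> C1_compact p q) \<and> (\<forall>n x. \<bar>\<phi> n x\<bar> \<le> M) \<and>
    (\<forall>x. (\<lambda>n. \<phi> n x) \<longlonglongrightarrow> \<psi> x) \<and>
    (\<lambda>n. \<integral>x. u x * deriv (\<phi> n) x \<partial>lebesgue_on S) \<longlonglongrightarrow> (\<integral>x. u x * g x \<partial>lebesgue_on S)"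
proof -
  obtain \<phi> where \<phi>0: "\<forall>n. \<phi> n \<in> C1_compact p q" "\<forall>n x. \<bar>\<phi> n x\<bar> \<le> M"
    "\<forall>n x. \<bar>deriv (\<phi> n) x\<bar> \<le> K"
    "\<forall>x. (\<lambda>n. \<phi> n x) \<longlonglongrightarrow> \<psi> x"
    "\<forall>x c. (\<psi> has_real_derivative c) (at x) \<longrightarrow> (\<lambda>n. deriv (\<phi> n) x) \<longlonglongrightarrow> c"
    using C1_compact_approximation[OF lip M supp pq] by (elim exE conjE) (rule that)
  note \<phi> = \<phi>0(1)[rule_format] \<phi>0(2)[rule_format] \<phi>0(3)[rule_format] \<phi>0(4)[rule_format] \<phi>0(5)[rule_format]
  have "(\<lambda>n. \<integral>x. u x * deriv (\<phi> n) x \<partial>lebesgue_on S) \<longlonglongrightarrow> (\<integral>x. u x * g x \<partial>lebesgue_on S)"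
  proof (rule integral_dominated_convergence[where w = "\<lambda>x. \<bar>u x\<bar> * K"])
    have um: "u \<in> borel_measurable (lebesgue_on S)" using u by (rule borel_measurable_integrable)
    show "(\<lambda>x. u x * g x) \<in> borel_measurable (lebesgue_on S)"
      using um g by (rule borel_measurable_times)
    show "(\<lambda>x. u x * deriv (\<phi> n) x) \<in> borel_measurable (lebesgue_on S)" for n
    proof (rule borel_measurable_times[OF um])
      show "deriv (\<phi> n) \<in> borel_measurable (lebesgue_on S)"
        using C1_compactD(2)[OF \<phi>(1)] S
        by (intro continuous_imp_measurable_on_sets_lebesgue) (auto intro: continuous_on_subset)
    qed
    show "integrable (lebesgue_on S) (\<lambda>x. \<bar>u x\<bar> * K)" using u by simp
    show "AE x in lebesgue_on S. (\<lambda>n. u x * deriv (\<phi> n) x) \<longlonglongrightarrow> u x * g x"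
      using der by eventually_elim (intro tendsto_mult_left \<phi>(5))
    show "AE x in lebesgue_on S. norm (u x * deriv (\<phi> n) x) \<le> \<bar>u x\<bar> * K" for n
      using \<phi>(3) by (intro always_eventually allI) (simp add: abs_mult mult_left_mono)
  qed
  with \<phi>(1,2,4) show ?thesis by (intro exI[of _ \<phi>]) simp
qed

lemma total_variation_ge:
  assumes "\<phi> \<in> C1_compact 0 L" "\<And>x. \<bar>\<phi> x\<bar> \<le> 1"
  shows "ereal (\<integral>x. u x * deriv \<phi> x \<partial>lebesgue_on {0<..<L}) \<le> total_variation L u"
  unfolding total_variation_def using assms by (intro SUP_upper) auto

section \<open>Piecewise affine test functions\<close>

definition ramp :: "real \<Rightarrow> real \<Rightarrow> real \<Rightarrow> real" where
  "ramp p q x = max 0 (min 1 ((x - p) / (q - p)))"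

text \<open>A triple \<open>(c, p, q)\<close> stands for \<open>c\<close> times the ramp from 0 at \<open>p\<close> to 1 at \<open>q\<close>.\<close>

definition ramps :: "(real \<times> real \<times> real) list \<Rightarrow> real \<Rightarrow> real" where
  "ramps xs x = (\<Sum>(c, p, q)\<leftarrow>xs. c * ramp p q x)"

definition ramps_deriv :: "(real \<times> real \<times> real) list \<Rightarrow> real \<Rightarrow> real" where
  "ramps_deriv xs x = (\<Sum>(c, p, q)\<leftarrow>xs. c / (q - p) * indicator {p<..<q} x)"

text \<open>The pairing of \<open>u\<close> with the derivative of \<open>ramps xs\<close>: every
  ramp has constant slope on its interval, so only averages of \<open>u\<close> remain.\<close>

definition ramps_integral :: "(real \<times> real \<times> real) list \<Rightarrow> (real \<Rightarrow> real) \<Rightarrow> real" where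
  "ramps_integral xs u = (\<Sum>(c, p, q)\<leftarrow>xs. c * integral {p..q} u / (q - p))"

lemma ramp_bounds: "0 \<le> ramp p q x" "ramp p q x \<le> 1"
  by (auto simp: ramp_def)

lemma ramp_eq_0: "p < q \<Longrightarrow> x \<le> p \<Longrightarrow> ramp p q x = 0"
  using divide_nonpos_pos[of "x - p" "q - p"] by (simp add: ramp_def)

lemma ramp_eq_1: "p < q \<Longrightarrow> q \<le> x \<Longrightarrow> ramp p q x = 1"
  by (auto simp: ramp_def max_def min_def field_simps)

lemma ramp_lipschitz: "p < q \<Longrightarrow> \<bar>ramp p q x - ramp p q y\<bar> \<le> 1 / (q - p) * \<bar>x - y\<bar>"
proof -
  assume pq: "p < q"
  have "\<bar>max 0 (min 1 s) - max 0 (min 1 t)\<bar> \<le> \<bar>s - t\<bar>" for s t :: real by (auto simp: max_def min_def)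
  then have "\<bar>ramp p q x - ramp p q y\<bar> \<le> \<bar>(x - p) / (q - p) - (y - p) / (q - p)\<bar>"
    unfolding ramp_def .
  also have "\<dots> = 1 / (q - p) * \<bar>x - y\<bar>" using pq by (simp add: diff_divide_distrib[symmetric])
  finally show ?thesis .
qed

lemma ramp_derivative:
  assumes "p < q" "x \<noteq> p" "x \<noteq> q"
  shows "(ramp p q has_real_derivative 1 / (q - p) * indicator {p<..<q} x) (at x)"
proof -
  consider "x < p" | "p < x" "x < q" | "q < x" using assms by linarith
  then show ?thesis
  proof cases
    case 1
    have "((\<lambda>x. 0) has_real_derivative 0) (at x)" by simp
    then have "(ramp p q has_real_derivative 0) (at x)"
      by (rule has_field_derivative_transform_within_open[of _ _ _ "{..<p}"])
         (use 1 assms in \<open>auto simp: ramp_eq_0\<close>)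
    then show ?thesis using 1 by simp
  next
    case 2
    have "((\<lambda>x. (x - p) / (q - p)) has_real_derivative 1 / (q - p)) (at x)"
      using assms(1) by (auto intro!: derivative_eq_intros)
    then have "(ramp p q has_real_derivative 1 / (q - p)) (at x)"
      by (rule has_field_derivative_transform_within_open[of _ _ _ "{p<..<q}"])
         (use 2 in \<open>auto simp: ramp_def\<close>)
    then show ?thesis using 2 by simp
  next
    case 3
    have "((\<lambda>x. 1) has_real_derivative 0) (at x)" by simp
    then have "(ramp p q has_real_derivative 0) (at x)"
      by (rule has_field_derivative_transform_within_open[of _ _ _ "{q<..}"])
         (use 3 assms in \<open>auto simp: ramp_eq_1\<close>)
    then show ?thesis using 3 by simp
  qed
qed

lemma ramps_lipschitz:
  assumes "\<forall>(c, p, q)\<in>set xs. p < q"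
  obtains K where "\<And>x y. \<bar>ramps xs x - ramps xs y\<bar> \<le> K * \<bar>x - y\<bar>"
proof -
  have "\<bar>ramps xs x - ramps xs y\<bar> \<le> (\<Sum>(c, p, q)\<leftarrow>xs. \<bar>c\<bar> * (1 / (q - p))) * \<bar>x - y\<bar>" for x y
    using assms
  proof (induction xs)
    case (Cons t xs)
    obtain c p q where t: "t = (c, p, q)" by (cases t) auto
    have "\<bar>c * ramp p q x - c * ramp p q y\<bar> \<le> \<bar>c\<bar> * (1 / (q - p) * \<bar>x - y\<bar>)"
      unfolding right_diff_distrib[symmetric] abs_mult
      using Cons.prems t by (intro mult_left_mono ramp_lipschitz) auto
    moreover have "\<bar>ramps xs x - ramps xs y\<bar> \<le> (\<Sum>(c, p, q)\<leftarrow>xs. \<bar>c\<bar> * (1 / (q - p))) * \<bar>x - y\<bar>"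
      using Cons by simp
    moreover have "ramps (t # xs) z = c * ramp p q z + ramps xs z" for z by (simp add: ramps_def t)
    ultimately show ?case by (simp add: t distrib_right abs_le_iff)
  qed (simp add: ramps_def)
  then show thesis using that by blast
qed

lemma ramps_derivative:
  assumes "\<forall>(c, p, q)\<in>set xs. p < q \<and> x \<noteq> p \<and> x \<noteq> q"
  shows "(ramps xs has_real_derivative ramps_deriv xs x) (at x)"
  using assms
proof (induction xs)
  case Nil
  have "ramps [] = (\<lambda>x. 0)" by (simp add: ramps_def[abs_def])
  then show ?case by (simp add: ramps_deriv_def)
next
  case (Cons t xs)
  obtain c p q where t: "t = (c, p, q)" by (cases t) auto
  have "ramps (t # xs) = (\<lambda>z. c * ramp p q z + ramps xs z)" by (simp add: ramps_def[abs_def] t)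
  moreover have "ramps_deriv (t # xs) x = c * (1 / (q - p) * indicator {p<..<q} x) + ramps_deriv xs x"
    by (simp add: ramps_deriv_def t)
  moreover have "((\<lambda>z. c * ramp p q z + ramps xs z) has_real_derivative
      c * (1 / (q - p) * indicator {p<..<q} x) + ramps_deriv xs x) (at x)"
    using Cons t by (intro DERIV_add DERIV_cmult ramp_derivative) auto
  ultimately show ?case by simp
qed

lemma AE_ramps_derivative:
  assumes "\<forall>(c, p, q)\<in>set xs. p < q" "S \<in> sets lebesgue"
  shows "AE x in lebesgue_on S. (ramps xs has_real_derivative ramps_deriv xs x) (at x)"
proof (rule AE_lebesgue_on_except_finite)
  show "finite ((\<lambda>(c, p, q). p) ` set xs \<union> (\<lambda>(c, p, q). q) ` set xs)" by simp
  fix x assume "x \<notin> (\<lambda>(c, p, q). p) ` set xs \<union> (\<lambda>(c, p, q). q) ` set xs"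
  then have "\<forall>(c, p, q)\<in>set xs. p < q \<and> x \<noteq> p \<and> x \<noteq> q" using assms(1) by force
  then show "(ramps xs has_real_derivative ramps_deriv xs x) (at x)" by (rule ramps_derivative)
qed (rule assms(2))

lemma ramps_measurable: "ramps xs \<in> borel_measurable (lebesgue_on S)"
proof -
  have "ramps xs \<in> borel_measurable borel"
  proof (induction xs)
    case Nil
    then show ?case by (simp add: ramps_def[abs_def])
  next
    case (Cons t xs)
    obtain c p q where t: "t = (c, p, q)" by (cases t) auto
    have "ramps (t # xs) = (\<lambda>x. c * max 0 (min 1 ((x - p) / (q - p))) + ramps xs x)"
      by (simp add: ramps_def[abs_def] ramp_def t)
    then show ?case using Cons by simp
  qed
  then show ?thesis by (intro measurable_restrict_space1 measurable_completion) simp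
qed

lemma ramps_deriv_measurable:
  "S \<in> sets lebesgue \<Longrightarrow> ramps_deriv xs \<in> borel_measurable (lebesgue_on S)"
proof (induction xs)
  case Nil
  then show ?case by (simp add: ramps_deriv_def[abs_def])
next
  case (Cons t xs)
  obtain c p q where t: "t = (c, p, q)" by (cases t) auto
  have "ramps_deriv (t # xs) = (\<lambda>x. c / (q - p) * indicator {p<..<q} x + ramps_deriv xs x)"
    by (simp add: ramps_deriv_def[abs_def] t)
  moreover have "(indicator {p<..<q} :: real \<Rightarrow> real) \<in> borel_measurable (lebesgue_on S)"
    by (intro measurable_restrict_space1 measurable_completion) simp
  ultimately show ?case using Cons by simp
qed

lemma integral_lebesgue_on_interval:
  fixes u :: "real \<Rightarrow> real"
  assumes "integrable (lebesgue_on {p<..<q}) u"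
  shows "(\<integral>x. u x \<partial>lebesgue_on {p<..<q}) = integral {p..q} u"
proof -
  have "(\<integral>x. u x \<partial>lebesgue_on {p<..<q}) = integral {p<..<q} u"
    by (rule lebesgue_integral_eq_integral[OF assms]) simp
  also have "\<dots> = integral {p..q} u"
    using integral_open_interval[of p q u] by simp
  finally show ?thesis .
qed

lemma integrable_lebesgue_on_subset:
  fixes u :: "real \<Rightarrow> real"
  assumes "integrable (lebesgue_on S) u" "T \<subseteq> S" "S \<in> sets lebesgue" "T \<in> sets lebesgue"
  shows "integrable (lebesgue_on T) u"
proof -
  have "set_integrable lebesgue S u"
    using assms(1,3) by (simp add: set_integrable_def integrable_restrict_space)
  then have "set_integrable lebesgue T u" using assms(4,2) by (rule set_integrable_subset)
  then show ?thesis using assms(4) by (simp add: set_integrable_def integrable_restrict_space)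
qed

lemma integrable_on_subinterval_lebesgue:
  fixes u :: "real \<Rightarrow> real"
  assumes "integrable (lebesgue_on {A<..<B}) u" "A \<le> p" "q \<le> B"
  shows "integrable (lebesgue_on {p<..<q}) u" "u integrable_on {p..q}"
proof -
  show 1: "integrable (lebesgue_on {p<..<q}) u"
    using assms by (intro integrable_lebesgue_on_subset[OF assms(1)]) auto
  then have "u integrable_on {p<..<q}" by (intro integrable_on_lebesgue_on) auto
  then show "u integrable_on {p..q}" by (simp add: integrable_on_open_interval_real)
qed

lemma has_ramps_integral:
  fixes u :: "real \<Rightarrow> real"
  assumes u: "integrable (lebesgue_on {A<..<B}) u" and xs: "\<forall>(c, p, q)\<in>set xs. A \<le> p \<and> q \<le> B"
  shows "integrable (lebesgue_on {A<..<B}) (\<lambda>x. u x * ramps_deriv xs x)"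
    "(\<integral>x. u x * ramps_deriv xs x \<partial>lebesgue_on {A<..<B}) = ramps_integral xs u"
proof -
  have "integrable (lebesgue_on {A<..<B}) (\<lambda>x. u x * ramps_deriv xs x) \<and>
     (\<integral>x. u x * ramps_deriv xs x \<partial>lebesgue_on {A<..<B}) = ramps_integral xs u"
    using xs
  proof (induction xs)
    case Nil
    then show ?case by (simp add: ramps_deriv_def ramps_integral_def)
  next
    case (Cons t xs)
    obtain c p q where t: "t = (c, p, q)" by (cases t) auto
    have pq: "A \<le> p" "q \<le> B" using Cons.prems t by auto
    have eq: "u x * ramps_deriv (t # xs) x = c / (q - p) * (if x \<in> {p<..<q} then u x else 0) + u x * ramps_deriv xs x" for x
      by (simp add: ramps_deriv_def t algebra_simps indicator_def)
    have sub: "{p<..<q} \<inter> {A<..<B} = {p<..<q}" using pq by auto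
    have "integrable (lebesgue_on {A<..<B}) (\<lambda>x. if x \<in> {p<..<q} then u x else 0)"
    proof -
      have "integrable (lebesgue_on {A<..<B}) (\<lambda>x. u x * indicator {p<..<q} x)"
      proof (rule Bochner_Integration.integrable_bound[OF u])
        have "(indicator {p<..<q} :: real \<Rightarrow> real) \<in> borel_measurable (lebesgue_on {A<..<B})"
          by (intro measurable_restrict_space1 measurable_completion) simp
        then show "(\<lambda>x. u x * indicator {p<..<q} x) \<in> borel_measurable (lebesgue_on {A<..<B})"
          by (rule borel_measurable_times[OF borel_measurable_integrable[OF u]])
      qed (auto simp: indicator_def)
      then show ?thesis by (rule back_subst[of "integrable _"]) (auto simp: indicator_def)
    qed
    moreover have "(\<integral>x. (if x \<in> {p<..<q} then u x else 0) \<partial>lebesgue_on {A<..<B}) = integral {p..q} u"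
      using integral_lebesgue_on_interval[OF integrable_on_subinterval_lebesgue(1)[OF u pq]]
      by (subst Lebesgue_Measure.integral_restrict_Int) (simp_all add: sub del: greaterThanLessThan_iff Int_greaterThanLessThan)
    ultimately show ?case
      using Cons by (simp add: eq) (simp add: ramps_integral_def t)
  qed
  then show "integrable (lebesgue_on {A<..<B}) (\<lambda>x. u x * ramps_deriv xs x)"
    "(\<integral>x. u x * ramps_deriv xs x \<partial>lebesgue_on {A<..<B}) = ramps_integral xs u" by simp_all
qed

text \<open>The window \<open>{p<..<q}\<close> that confines the test functions is kept apart from
  the domain \<open>{A<..<B}\<close> of \<open>u\<close>, because the trace estimates need test
  functions supported in a thin strip at the boundary.\<close>

lemma ramps_integral_limit:
  fixes u :: "real \<Rightarrow> real"
  assumes u: "integrable (lebesgue_on {A<..<B}) u" and xs: "\<forall>(c, p, q)\<in>set xs. A \<le> p \<and> p < q \<and> q \<le> B"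
    and M: "\<And>x. \<bar>ramps xs x\<bar> \<le> M" and supp: "\<forall>x. x \<notin> {\<alpha>..\<beta>} \<longrightarrow> ramps xs x = 0"
    and pq: "p < \<alpha>" "\<beta> < q"
  shows "\<exists>\<phi>. (\<forall>n. \<phi> n \<in> C1_compact p q) \<and> (\<forall>n x. \<bar>\<phi> n x\<bar> \<le> M) \<and>
    (\<forall>x. (\<lambda>n. \<phi> n x) \<longlonglongrightarrow> ramps xs x) \<and>
    (\<lambda>n. \<integral>x. u x * deriv (\<phi> n) x \<partial>lebesgue_on {A<..<B}) \<longlonglongrightarrow> ramps_integral xs u"
proof -
  have xs1: "\<forall>(c, p, q)\<in>set xs. p < q" and xs2: "\<forall>(c, p, q)\<in>set xs. A \<le> p \<and> q \<le> B" using xs by auto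
  obtain K where K: "\<And>x y. \<bar>ramps xs x - ramps xs y\<bar> \<le> K * \<bar>x - y\<bar>"
    using ramps_lipschitz[OF xs1] by blast
  have S: "{A<..<B} \<in> sets lebesgue" by simp
  show ?thesis
    using lipschitz_test_function_limit[OF K M supp pq S u ramps_deriv_measurable[OF S] AE_ramps_derivative[OF xs1 S]]
    unfolding has_ramps_integral(2)[OF u xs2] .
qed

lemma total_variation_ge_ramps_integral:
  fixes u :: "real \<Rightarrow> real"
  assumes u: "integrable (lebesgue_on {0<..<L}) u" and xs: "\<forall>(c, p, q)\<in>set xs. 0 \<le> p \<and> p < q \<and> q \<le> L"
    and M: "\<And>x. \<bar>ramps xs x\<bar> \<le> 1" and supp: "\<forall>x. x \<notin> {\<alpha>..\<beta>} \<longrightarrow> ramps xs x = 0"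
    and pq: "0 < \<alpha>" "\<beta> < L"
  shows "ereal (ramps_integral xs u) \<le> total_variation L u"
proof -
  obtain \<phi> where \<phi>0: "\<forall>n. \<phi> n \<in> C1_compact 0 L" "\<forall>n x. \<bar>\<phi> n x\<bar> \<le> 1"
    "\<forall>x. (\<lambda>n. \<phi> n x) \<longlonglongrightarrow> ramps xs x"
    "(\<lambda>n. \<integral>x. u x * deriv (\<phi> n) x \<partial>lebesgue_on {0<..<L}) \<longlonglongrightarrow> ramps_integral xs u"
    using ramps_integral_limit[OF u xs M supp pq] by (elim exE conjE) (rule that)
  note \<phi> = \<phi>0(1)[rule_format] \<phi>0(2)[rule_format] \<phi>0(3)[rule_format] \<phi>0(4)
  have "(\<lambda>n. ereal (\<integral>x. u x * deriv (\<phi> n) x \<partial>lebesgue_on {0<..<L})) \<longlonglongrightarrow> ereal (ramps_integral xs u)"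
    using \<phi>(4) by simp
  then show ?thesis
    by (rule LIMSEQ_le_const2) (use total_variation_ge[OF \<phi>(1,2)] in blast)
qed

section \<open>Existence of traces, and bounds on the total variation\<close>

lemma bounded_mult_integrable:
  fixes u g :: "real \<Rightarrow> real"
  assumes u: "integrable (lebesgue_on {0<..<L}) u" and g: "continuous_on UNIV g"
  shows "integrable (lebesgue_on {0<..<L}) (\<lambda>x. u x * g x)"
proof -
  have "compact (g ` {0..L})" using g by (intro compact_continuous_image) (auto intro: continuous_on_subset)
  then have "bounded (g ` {0..L})" by (rule compact_imp_bounded)
  then obtain B where "\<forall>y\<in>g ` {0..L}. norm y \<le> B" unfolding bounded_iff by blast
  then have B: "\<And>x. x \<in> {0..L} \<Longrightarrow> \<bar>g x\<bar> \<le> B" by simp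
  have gm: "g \<in> borel_measurable (lebesgue_on {0<..<L})"
    using g by (intro continuous_imp_measurable_on_sets_lebesgue) (auto intro: continuous_on_subset)
  have "integrable (lebesgue_on {0<..<L}) (\<lambda>x. B * u x)" using u by simp
  then show ?thesis
  proof (rule Bochner_Integration.integrable_bound)
    show "(\<lambda>x. u x * g x) \<in> borel_measurable (lebesgue_on {0<..<L})"
      using borel_measurable_integrable[OF u] gm by (rule borel_measurable_times)
    show "AE x in lebesgue_on {0<..<L}. norm (u x * g x) \<le> norm (B * u x)"
    proof (rule AE_I2)
      fix x assume "x \<in> space (lebesgue_on {0<..<L})"
      then have "x \<in> {0..L}" by auto
      then have "\<bar>u x\<bar> * \<bar>g x\<bar> \<le> \<bar>u x\<bar> * \<bar>B\<bar>" using B[of x] by (intro mult_left_mono) auto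
      then show "norm (u x * g x) \<le> norm (B * u x)" by (simp add: abs_mult mult.commute)
    qed
  qed
qed

text \<open>A test function that nearly realises the variation vanishes near the boundary, so adding
  to it any test function supported near an endpoint gains at most \<open>e\<close>.\<close>

lemma BV_small_near_boundary:
  assumes u: "u \<in> BV L" and e: "e > 0" and L: "L > 0"
  obtains \<delta> where "\<delta> > 0" "\<delta> \<le> L"
    "\<And>\<phi>. \<phi> \<in> C1_compact 0 \<delta> \<union> C1_compact (L - \<delta>) L \<Longrightarrow> (\<And>x. \<bar>\<phi> x\<bar> \<le> 1) \<Longrightarrow>
       (\<integral>x. u x * deriv \<phi> x \<partial>lebesgue_on {0<..<L}) \<le> e"
proof -
  have int: "integrable (lebesgue_on {0<..<L}) u" and fin: "total_variation L u < \<infinity>" using u by (auto simp: BV_def)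
  obtain \<phi>0 where \<phi>0: "\<phi>0 \<in> C1_compact 0 L" "\<And>x. \<bar>\<phi>0 x\<bar> \<le> 1"
    "total_variation L u < ereal (\<integral>x. u x * deriv \<phi>0 x \<partial>lebesgue_on {0<..<L}) + ereal e"
  proof -
    have "0 \<le> total_variation L u" by (rule total_variation_nonneg)
    then obtain V where V: "total_variation L u = ereal V" using fin by (cases "total_variation L u") auto
    have "ereal (V - e) < total_variation L u" using V e by simp
    then obtain \<phi> where "\<phi> \<in> {\<phi> \<in> C1_compact 0 L. \<forall>x. \<bar>\<phi> x\<bar> \<le> 1}"
      "ereal (V - e) < ereal (\<integral>x. u x * deriv \<phi> x \<partial>lebesgue_on {0<..<L})"
      unfolding total_variation_def less_SUP_iff by blast
    then show thesis using that[of \<phi>] V by (simp add: algebra_simps)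
  qed
  define C where "C = closure {x. \<phi>0 x \<noteq> 0}"
  have C: "closed C" "C \<subseteq> {0<..<L}" using C1_compactD(4)[OF \<phi>0(1)] by (auto simp: C_def)
  have "0 \<notin> C" "L \<notin> C" using C(2) by auto
  obtain \<delta>1 where \<delta>1: "\<delta>1 > 0" "\<And>y. y \<in> C \<Longrightarrow> \<delta>1 \<le> dist 0 y"
    using separate_point_closed[OF C(1) \<open>0 \<notin> C\<close>] by blast
  obtain \<delta>2 where \<delta>2: "\<delta>2 > 0" "\<And>y. y \<in> C \<Longrightarrow> \<delta>2 \<le> dist L y"
    using separate_point_closed[OF C(1) \<open>L \<notin> C\<close>] by blast
  \<comment> \<open>Both distances from the endpoints to the closed support \<open>C\<close> are
    positive, so \<open>\<phi>0\<close> vanishes on two boundary strips of this width.\<close>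
  define \<delta> where "\<delta> = min L (min \<delta>1 \<delta>2)"
  have \<delta>: "\<delta> > 0" "\<delta> \<le> L" using \<delta>1 \<delta>2 L by (auto simp: \<delta>_def)
  have zero: "\<phi>0 x = 0" if "x \<in> {0<..<\<delta>} \<union> {L-\<delta><..<L}" for x
  proof (rule ccontr)
    assume "\<phi>0 x \<noteq> 0"
    then have "x \<in> C" unfolding C_def using closure_subset[of "{x. \<phi>0 x \<noteq> 0}"] by blast
    then show False using \<delta>1(2)[of x] \<delta>2(2)[of x] that \<delta> by (auto simp: \<delta>_def dist_real_def)
  qed
  show thesis
  proof (rule that[OF \<delta>])
    fix \<phi> assume \<phi>: "\<phi> \<in> C1_compact 0 \<delta> \<union> C1_compact (L - \<delta>) L" "\<And>x. \<bar>\<phi> x\<bar> \<le> 1"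
    have supp: "\<phi> x = 0" if "x \<notin> {0<..<\<delta>} \<union> {L-\<delta><..<L}" for x
      using \<phi>(1) that C1_compactD(3)[of \<phi>] by blast
    have mem: "\<phi> \<in> C1_compact 0 L"
      using \<phi>(1) \<delta> C1_compact_mono[of \<phi> 0 \<delta> 0 L] C1_compact_mono[of \<phi> "L - \<delta>" L 0 L] by auto
    note d = C1_compactD(1)[OF mem] C1_compactD(1)[OF \<phi>0(1)]
    have sum: "(\<lambda>x. \<phi>0 x + \<phi> x) \<in> C1_compact 0 L"
    proof -
      have "closure {x. \<phi>0 x + \<phi> x \<noteq> 0} \<subseteq> closure ({x. \<phi>0 x \<noteq> 0} \<union> {x. \<phi> x \<noteq> 0})"
        by (intro closure_mono) auto
      also have "\<dots> \<subseteq> {0<..<L}"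
        using C1_compactD(4)[OF mem] C1_compactD(4)[OF \<phi>0(1)] by (simp add: closure_Un)
      finally show ?thesis using mem \<phi>0(1) by (simp add: C1_compact_def)
    qed
    \<comment> \<open>At each point at most one of the two functions is nonzero, so the sum is still
      admissible.\<close>
    have "\<bar>\<phi>0 x + \<phi> x\<bar> \<le> 1" for x
      using zero[of x] supp[of x] \<phi>(2)[of x] \<phi>0(2)[of x] by (cases "x \<in> {0<..<\<delta>} \<union> {L-\<delta><..<L}") auto
    from total_variation_ge[OF sum this, of u]
    have "ereal (\<integral>x. u x * deriv (\<lambda>x. \<phi>0 x + \<phi> x) x \<partial>lebesgue_on {0<..<L})
        < ereal (\<integral>x. u x * deriv \<phi>0 x \<partial>lebesgue_on {0<..<L}) + ereal e"
      using \<phi>0(3) by (rule le_less_trans)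
    moreover have "deriv (\<lambda>x. \<phi>0 x + \<phi> x) x = deriv \<phi>0 x + deriv \<phi> x" for x
      by (intro DERIV_imp_deriv DERIV_add d)
    moreover have "(\<integral>x. u x * (deriv \<phi>0 x + deriv \<phi> x) \<partial>lebesgue_on {0<..<L})
        = (\<integral>x. u x * deriv \<phi>0 x \<partial>lebesgue_on {0<..<L}) + (\<integral>x. u x * deriv \<phi> x \<partial>lebesgue_on {0<..<L})"
      unfolding distrib_left
      by (intro Bochner_Integration.integral_add bounded_mult_integrable[OF int] C1_compactD(2)[OF mem] C1_compactD(2)[OF \<phi>0(1)])
    ultimately show "(\<integral>x. u x * deriv \<phi> x \<partial>lebesgue_on {0<..<L}) \<le> e" by simp
  qed
qed

text \<open>A difference of averages is the pairing of \<open>u\<close> with the derivative of a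
  difference of two ramps. Both ramps end at 1, so the difference is supported in the strip and has
  values between -1 and 1; after approximation \<open>BV_small_near_boundary\<close>
  applies.\<close>

lemma BV_average_difference:
  assumes u: "u \<in> BV L" and e: "e > 0" and L: "L > 0"
  obtains \<delta> where "\<delta> > 0" "\<delta> \<le> L"
    "\<And>p q p' q'. 0 < p \<Longrightarrow> p < q \<Longrightarrow> q < \<delta> \<Longrightarrow> 0 < p' \<Longrightarrow> p' < q' \<Longrightarrow> q' < \<delta> \<Longrightarrow>
       integral {p..q} u / (q - p) - integral {p'..q'} u / (q' - p') \<le> e"
    "\<And>p q p' q'. L - \<delta> < p \<Longrightarrow> p < q \<Longrightarrow> q < L \<Longrightarrow> L - \<delta> < p' \<Longrightarrow> p' < q' \<Longrightarrow> q' < L \<Longrightarrow>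
       integral {p..q} u / (q - p) - integral {p'..q'} u / (q' - p') \<le> e"
proof -
  have int: "integrable (lebesgue_on {0<..<L}) u" using u by (auto simp: BV_def)
  obtain \<delta> where \<delta>: "\<delta> > 0" "\<delta> \<le> L"
    "\<And>\<phi>. \<phi> \<in> C1_compact 0 \<delta> \<union> C1_compact (L - \<delta>) L \<Longrightarrow> (\<And>x. \<bar>\<phi> x\<bar> \<le> 1) \<Longrightarrow>
       (\<integral>x. u x * deriv \<phi> x \<partial>lebesgue_on {0<..<L}) \<le> e"
    using BV_small_near_boundary[OF u e L] by metis
  have main: "integral {p..q} u / (q - p) - integral {p'..q'} u / (q' - p') \<le> e"
    if P: "0 \<le> P" "Q \<le> L" and win: "C1_compact P Q \<subseteq> C1_compact 0 \<delta> \<union> C1_compact (L - \<delta>) L"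
      and pq: "P < p" "p < q" "q < Q" "P < p'" "p' < q'" "q' < Q" for P Q p q p' q'
  proof -
    define xs :: "(real \<times> real \<times> real) list" where "xs = [(1, p, q), (-1, p', q')]"
    have xs: "\<forall>(c, p, q)\<in>set xs. 0 \<le> p \<and> p < q \<and> q \<le> L" using P pq by (auto simp: xs_def)
    have val: "ramps xs x = ramp p q x - ramp p' q' x" for x by (simp add: ramps_def xs_def)
    have M: "\<bar>ramps xs x\<bar> \<le> 1" for x
      unfolding val using ramp_bounds[of p q x] ramp_bounds[of p' q' x] by linarith
    have supp: "\<forall>x. x \<notin> {min p p'..max q q'} \<longrightarrow> ramps xs x = 0"
      using pq by (auto simp: val not_le ramp_eq_0 ramp_eq_1)
    have "P < min p p'" "max q q' < Q" using pq by auto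
    from ramps_integral_limit[OF int xs M supp this] obtain \<phi> where \<phi>:
      "\<forall>n. \<phi> n \<in> C1_compact P Q" "\<forall>n x. \<bar>\<phi> n x\<bar> \<le> 1"
      "\<forall>x. (\<lambda>n. \<phi> n x) \<longlonglongrightarrow> ramps xs x"
      "(\<lambda>n. \<integral>x. u x * deriv (\<phi> n) x \<partial>lebesgue_on {0<..<L}) \<longlonglongrightarrow> ramps_integral xs u"
      by (elim exE conjE) (rule that)
    have "(\<integral>x. u x * deriv (\<phi> n) x \<partial>lebesgue_on {0<..<L}) \<le> e" for n
    proof (rule \<delta>(3))
      show "\<phi> n \<in> C1_compact 0 \<delta> \<union> C1_compact (L - \<delta>) L" using \<phi>(1) win by blast
    qed (use \<phi>(2) in simp)
    then have "ramps_integral xs u \<le> e" by (intro LIMSEQ_le_const2[OF \<phi>(4)]) blast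
    then show ?thesis by (simp add: ramps_integral_def xs_def)
  qed
  show thesis
  proof (rule that[OF \<delta>(1,2)])
    fix p q p' q' :: real
    show "0 < p \<Longrightarrow> p < q \<Longrightarrow> q < \<delta> \<Longrightarrow> 0 < p' \<Longrightarrow> p' < q' \<Longrightarrow> q' < \<delta> \<Longrightarrow>
       integral {p..q} u / (q - p) - integral {p'..q'} u / (q' - p') \<le> e"
      using main[of 0 \<delta> p q p' q'] \<delta>(2) by blast
    show "L - \<delta> < p \<Longrightarrow> p < q \<Longrightarrow> q < L \<Longrightarrow> L - \<delta> < p' \<Longrightarrow> p' < q' \<Longrightarrow> q' < L \<Longrightarrow>
       integral {p..q} u / (q - p) - integral {p'..q'} u / (q' - p') \<le> e"
      using main[of "L - \<delta>" L p q p' q'] \<delta>(2) by simp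
  qed
qed

text \<open>A one-sided inequality is a full Cauchy condition here, since \<open>r\<close> and
  \<open>s\<close> may be exchanged.\<close>

lemma Cauchy_at_right_imp_convergent:
  fixes F :: "real \<Rightarrow> real"
  assumes "\<And>e. e > 0 \<Longrightarrow> \<exists>\<delta>>0. \<forall>r s. 0 < r \<and> r < \<delta> \<and> 0 < s \<and> s < \<delta> \<longrightarrow> F r - F s \<le> e"
  obtains c where "(F \<longlongrightarrow> c) (at_right 0)"
proof -
  have *: "\<exists>\<delta>>0. \<forall>r s. 0 < r \<and> r < \<delta> \<and> 0 < s \<and> s < \<delta> \<longrightarrow> \<bar>F r - F s\<bar> < e" if "e > 0" for e :: real
  proof -
    obtain \<delta> where "\<delta> > 0" and \<delta>: "\<And>r s. 0 < r \<Longrightarrow> r < \<delta> \<Longrightarrow> 0 < s \<Longrightarrow> s < \<delta> \<Longrightarrow> F r - F s \<le> e / 2"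
    proof -
      have "e / 2 > 0" using \<open>e > 0\<close> by simp
      from assms[OF this] show thesis using that by blast
    qed
    have "\<bar>F r - F s\<bar> < e" if "0 < r \<and> r < \<delta> \<and> 0 < s \<and> s < \<delta>" for r s
      using \<delta>[of r s] \<delta>[of s r] that \<open>e > 0\<close> by (auto simp: abs_less_iff)
    with \<open>\<delta> > 0\<close> show ?thesis by blast
  qed
  define X where "X n = F (1 / real (Suc n))" for n
  have small: "\<exists>N. \<forall>n\<ge>N. 1 / real (Suc n) < \<delta>" if "\<delta> > 0" for \<delta> :: real
  proof -
    have "(\<lambda>n. 1 / real (Suc n)) \<longlonglongrightarrow> 0" by (rule LIMSEQ_Suc, rule lim_const_over_n)
    from order_tendstoD(2)[OF this that] show ?thesis by (simp add: eventually_sequentially)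
  qed
  have "Cauchy X"
  proof (rule CauchyI)
    fix e :: real assume "0 < e"
    from *[OF this] obtain \<delta> where \<delta>: "\<delta> > 0" "\<And>r s. 0 < r \<and> r < \<delta> \<and> 0 < s \<and> s < \<delta> \<Longrightarrow> \<bar>F r - F s\<bar> < e" by blast
    from small[OF \<delta>(1)] obtain N where "\<forall>n\<ge>N. 1 / real (Suc n) < \<delta>" by blast
    then show "\<exists>M. \<forall>m\<ge>M. \<forall>n\<ge>M. norm (X m - X n) < e"
      using \<delta>(2) by (intro exI[of _ N]) (simp add: X_def)
  qed
  then obtain c where c: "X \<longlonglongrightarrow> c" using Cauchy_convergent convergent_def by blast
  have "(F \<longlongrightarrow> c) (at_right 0)"
  proof (rule tendstoI)
    fix e :: real assume "0 < e"
    then have "e / 2 > 0" by simp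
    from *[OF this] obtain \<delta> where \<delta>: "\<delta> > 0" "\<And>r s. 0 < r \<and> r < \<delta> \<and> 0 < s \<and> s < \<delta> \<Longrightarrow> \<bar>F r - F s\<bar> < e / 2" by blast
    from small[OF \<delta>(1)] obtain N where N: "\<forall>n\<ge>N. 1 / real (Suc n) < \<delta>" by blast
    have "dist (F r) c < e" if r: "0 < r" "r < \<delta>" for r
    proof -
      have "(\<lambda>n. \<bar>F r - X n\<bar>) \<longlonglongrightarrow> \<bar>F r - c\<bar>" by (intro tendsto_intros c)
      moreover have "\<forall>n\<ge>N. \<bar>F r - X n\<bar> \<le> e / 2" using \<delta>(2)[of r] N r by (force simp: X_def intro: less_imp_le)
      ultimately have "\<bar>F r - c\<bar> \<le> e / 2" using LIMSEQ_le_const2 by blast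
      then show ?thesis using \<open>0 < e\<close> by (simp add: dist_real_def)
    qed
    then show "\<forall>\<^sub>F r in at_right 0. dist (F r) c < e"
      unfolding eventually_at_right_field using \<delta>(1) by blast
  qed
  then show thesis by (rule that)
qed

lemma has_trace_left_iff:
  assumes u: "integrable (lebesgue_on {0<..<L}) u" and L: "L > 0"
  shows "has_trace L u 0 c \<longleftrightarrow> ((\<lambda>r. integral {0..r} u / r) \<longlongrightarrow> c) (at_right 0)"
  unfolding has_trace_def
proof (rule tendsto_cong)
  show "\<forall>\<^sub>F r in at_right 0. (\<integral>x. u x \<partial>lebesgue_on ({0<..<L} \<inter> ball 0 r)) /
      measure lebesgue ({0<..<L} \<inter> ball 0 r) = integral {0..r} u / r"
    unfolding eventually_at_right_field
  proof (intro exI[of _ L] conjI allI impI)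
    fix r :: real assume r: "0 < r" "r < L"
    then have eq: "{0<..<L} \<inter> ball 0 r = {0<..<r}" by (auto simp: ball_def)
    show "(\<integral>x. u x \<partial>lebesgue_on ({0<..<L} \<inter> ball 0 r)) /
      measure lebesgue ({0<..<L} \<inter> ball 0 r) = integral {0..r} u / r"
      unfolding eq using r integral_lebesgue_on_interval[OF integrable_on_subinterval_lebesgue(1)[OF u, of 0 r]]
      by simp
  qed (use L in auto)
qed

lemma has_trace_right_iff:
  assumes u: "integrable (lebesgue_on {0<..<L}) u" and L: "L > 0"
  shows "has_trace L u L c \<longleftrightarrow> ((\<lambda>r. integral {L - r..L} u / r) \<longlongrightarrow> c) (at_right 0)"
  unfolding has_trace_def
proof (rule tendsto_cong)
  show "\<forall>\<^sub>F r in at_right 0. (\<integral>x. u x \<partial>lebesgue_on ({0<..<L} \<inter> ball L r)) /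
      measure lebesgue ({0<..<L} \<inter> ball L r) = integral {L - r..L} u / r"
    unfolding eventually_at_right_field
  proof (intro exI[of _ L] conjI allI impI)
    fix r :: real assume r: "0 < r" "r < L"
    then have eq: "{0<..<L} \<inter> ball L r = {L - r<..<L}" by (auto simp: ball_def dist_real_def)
    show "(\<integral>x. u x \<partial>lebesgue_on ({0<..<L} \<inter> ball L r)) /
      measure lebesgue ({0<..<L} \<inter> ball L r) = integral {L - r..L} u / r"
      unfolding eq using r integral_lebesgue_on_interval[OF integrable_on_subinterval_lebesgue(1)[OF u, of "L - r" L]]
      by simp
  qed (use L in auto)
qed

lemma has_trace_unique: "has_trace L u i c \<Longrightarrow> has_trace L u i d \<Longrightarrow> c = d"
  unfolding has_trace_def by (rule tendsto_unique[OF trivial_limit_at_right_real])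

lemma trace_atI: "has_trace L u i c \<Longrightarrow> trace_at L u i = c"
  unfolding trace_at_def by (rule the_equality) (auto dest: has_trace_unique)

lemma integral_left_endpoint_limit:
  fixes u :: "real \<Rightarrow> real"
  assumes "u integrable_on {a..b}" "a < b"
  shows "((\<lambda>p. integral {p..b} u) \<longlongrightarrow> integral {a..b} u) (at_right a)"
proof -
  have "continuous_on {a..b} (\<lambda>x. integral {x..b} u)" using assms(1) by (rule indefinite_integral_continuous_1')
  then have "((\<lambda>p. integral {p..b} u) \<longlongrightarrow> integral {a..b} u) (at a within {a..b})"
    using assms(2) by (simp add: continuous_on_def)
  then show ?thesis using assms(2) by (simp add: at_within_Icc_at_right)
qed

lemma integral_right_endpoint_limit:
  fixes u :: "real \<Rightarrow> real"
  assumes "u integrable_on {a..b}" "a < b"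
  shows "((\<lambda>q. integral {a..q} u) \<longlongrightarrow> integral {a..b} u) (at_left b)"
proof -
  have "continuous_on {a..b} (\<lambda>x. integral {a..x} u)" using assms(1) by (rule indefinite_integral_continuous_1)
  then have "((\<lambda>q. integral {a..q} u) \<longlongrightarrow> integral {a..b} u) (at b within {a..b})"
    using assms(2) by (simp add: continuous_on_def)
  then show ?thesis using assms(2) by (simp add: at_within_Icc_at_left)
qed

text \<open>The estimate on averages needs windows that stay off the endpoint. Moving the near end
  of the window to the boundary, by continuity of the integral, extends it to the averages that
  define the trace, which are therefore Cauchy.\<close>

lemma BV_has_trace:
  assumes u: "u \<in> BV L" and L: "L > 0"
  obtains c0 cL where "has_trace L u 0 c0" "has_trace L u L cL"
proof -
  have int: "integrable (lebesgue_on {0<..<L}) u" using u by (auto simp: BV_def)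
  note ion = integrable_on_subinterval_lebesgue(2)[OF int]
  obtain c0 where c0: "((\<lambda>r. integral {0..r} u / r) \<longlongrightarrow> c0) (at_right 0)"
  proof (rule Cauchy_at_right_imp_convergent)
    fix e :: real assume "e > 0"
    obtain \<delta> where \<delta>: "\<delta> > 0" "\<delta> \<le> L"
      "\<And>p q p' q'. 0 < p \<Longrightarrow> p < q \<Longrightarrow> q < \<delta> \<Longrightarrow> 0 < p' \<Longrightarrow> p' < q' \<Longrightarrow> q' < \<delta> \<Longrightarrow>
       integral {p..q} u / (q - p) - integral {p'..q'} u / (q' - p') \<le> e"
      using BV_average_difference[OF u \<open>e > 0\<close> L] by metis
    show "\<exists>\<delta>>0. \<forall>r s. 0 < r \<and> r < \<delta> \<and> 0 < s \<and> s < \<delta> \<longrightarrow> integral {0..r} u / r - integral {0..s} u / s \<le> e"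
    proof (intro exI[of _ \<delta>] conjI allI impI \<delta>(1))
      fix r s assume rs: "0 < r \<and> r < \<delta> \<and> 0 < s \<and> s < \<delta>"
      have "((\<lambda>p. integral {p..r} u / (r - p) - integral {p..s} u / (s - p)) \<longlongrightarrow>
          integral {0..r} u / (r - 0) - integral {0..s} u / (s - 0)) (at_right 0)"
        using rs \<delta>(2) by (intro tendsto_intros integral_left_endpoint_limit ion) auto
      moreover have "\<forall>\<^sub>F p in at_right 0. integral {p..r} u / (r - p) - integral {p..s} u / (s - p) \<le> e"
        unfolding eventually_at_right_field using rs \<delta>(3)
        by (intro exI[of _ "min r s"]) auto
      ultimately have "integral {0..r} u / (r - 0) - integral {0..s} u / (s - 0) \<le> e"
        by (rule tendsto_upperbound) simp
      then show "integral {0..r} u / r - integral {0..s} u / s \<le> e" by simp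
    qed
  qed
  obtain cL where cL: "((\<lambda>r. integral {L - r..L} u / r) \<longlongrightarrow> cL) (at_right 0)"
  proof (rule Cauchy_at_right_imp_convergent)
    fix e :: real assume "e > 0"
    obtain \<delta> where \<delta>: "\<delta> > 0" "\<delta> \<le> L"
      "\<And>p q p' q'. L - \<delta> < p \<Longrightarrow> p < q \<Longrightarrow> q < L \<Longrightarrow> L - \<delta> < p' \<Longrightarrow> p' < q' \<Longrightarrow> q' < L \<Longrightarrow>
       integral {p..q} u / (q - p) - integral {p'..q'} u / (q' - p') \<le> e"
      using BV_average_difference[OF u \<open>e > 0\<close> L] by metis
    show "\<exists>\<delta>>0. \<forall>r s. 0 < r \<and> r < \<delta> \<and> 0 < s \<and> s < \<delta> \<longrightarrow> integral {L - r..L} u / r - integral {L - s..L} u / s \<le> e"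
    proof (intro exI[of _ \<delta>] conjI allI impI \<delta>(1))
      fix r s assume rs: "0 < r \<and> r < \<delta> \<and> 0 < s \<and> s < \<delta>"
      have "((\<lambda>q. integral {L - r..q} u / (q - (L - r)) - integral {L - s..q} u / (q - (L - s))) \<longlongrightarrow>
          integral {L - r..L} u / (L - (L - r)) - integral {L - s..L} u / (L - (L - s))) (at_left L)"
        using rs \<delta>(2) by (intro tendsto_intros integral_right_endpoint_limit ion) auto
      moreover have "\<forall>\<^sub>F q in at_left L. integral {L - r..q} u / (q - (L - r)) - integral {L - s..q} u / (q - (L - s)) \<le> e"
        unfolding eventually_at_left_field using rs \<delta>(3)
        by (intro exI[of _ "max (L - r) (L - s)"]) auto
      ultimately have "integral {L - r..L} u / (L - (L - r)) - integral {L - s..L} u / (L - (L - s)) \<le> e"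
        by (rule tendsto_upperbound) simp
      then show "integral {L - r..L} u / r - integral {L - s..L} u / s \<le> e" by simp
    qed
  qed
  show thesis
    using that c0 cL has_trace_left_iff[OF int L] has_trace_right_iff[OF int L] by blast
qed

text \<open>The expression in brackets is \<open>- \<integral> z d(Du)\<close> integrated by parts, for the field \<open>z\<close> that is
  linear from \<open>\<kappa>\<^sub>0\<close> to 1 on \<open>[0, a]\<close>, equal to 1 on \<open>[a, b]\<close> and linear from 1 to \<open>\<kappa>\<^sub>1\<close> on \<open>[b, L]\<close>.\<close>

lemma total_variation_ge_calibration:
  assumes u: "u \<in> BV L" and ab: "0 < a" "a \<le> b" "b < L"
    and \<kappa>: "0 \<le> \<kappa>0" "\<kappa>0 \<le> 1" "0 \<le> \<kappa>1" "\<kappa>1 \<le> 1" and s: "\<bar>s\<bar> \<le> 1"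
    and tr: "has_trace L u 0 c0" "has_trace L u L cL"
  shows "ereal (s * (\<kappa>0 * c0 + (1 - \<kappa>0) * integral {0..a} u / a
      - (1 - \<kappa>1) * integral {b..L} u / (L - b) - \<kappa>1 * cL)) \<le> total_variation L u"
proof -
  have int: "integrable (lebesgue_on {0<..<L}) u" using u by (auto simp: BV_def)
  have L: "L > 0" using ab by simp
  note ion = integrable_on_subinterval_lebesgue(2)[OF int]
  \<comment> \<open>The jumps from 0 to \<open>\<kappa>0\<close> and from \<open>\<kappa>1\<close>
    to 0 are spread over layers of width \<open>r\<close> that stay at distance \<open>r\<close>
    from the boundary, so the support is compact; the two middle ramps carry the affine parts of the
    field.\<close>
  define xs where "xs r = [(s * \<kappa>0, r, 2 * r), (s * (1 - \<kappa>0), 2 * r, a),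
      (- s * (1 - \<kappa>1), b, L - 2 * r), (- s * \<kappa>1, L - 2 * r, L - r)]" for r
  define d where "d = min (a / 2) ((L - b) / 2)"
  have d: "d > 0" using ab by (simp add: d_def)
  have bound: "ereal (ramps_integral (xs r) u) \<le> total_variation L u" if r: "0 < r" "r < d" for r
  proof (rule total_variation_ge_ramps_integral[OF int])
    have r': "2 * r < a" "b < L - 2 * r" using r ab by (auto simp: d_def)
    show "\<forall>(c, p, q)\<in>set (xs r). 0 \<le> p \<and> p < q \<and> q \<le> L" using r r' ab by (auto simp: xs_def)
    show "0 < r" "L - r < L" using r by auto
    have val: "ramps (xs r) x = s * (\<kappa>0 * ramp r (2*r) x + (1 - \<kappa>0) * ramp (2*r) a x
        - (1 - \<kappa>1) * ramp b (L - 2*r) x - \<kappa>1 * ramp (L - 2*r) (L - r) x)" for x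
      by (simp add: ramps_def xs_def algebra_simps)
    show "\<forall>x. x \<notin> {r..L - r} \<longrightarrow> ramps (xs r) x = 0"
      using r r' ab by (auto simp: val not_le ramp_eq_0 ramp_eq_1)
    show "\<bar>ramps (xs r) x\<bar> \<le> 1" for x
    proof -
      define R where "R = \<kappa>0 * ramp r (2*r) x + (1 - \<kappa>0) * ramp (2*r) a x
        - (1 - \<kappa>1) * ramp b (L - 2*r) x - \<kappa>1 * ramp (L - 2*r) (L - r) x"
      have mb: "0 \<le> c * ramp p q x \<and> c * ramp p q x \<le> c" if "0 \<le> c" for c p q
        using that ramp_bounds[of p q x] by (simp add: mult_left_le)
      \<comment> \<open>On each of these ranges only one of the four ramps varies; the others are 0
        or 1.\<close>
      consider "x \<le> 2 * r" | "2 * r \<le> x" "x \<le> b" | "b \<le> x" "x \<le> L - 2 * r" | "L - 2 * r \<le> x" by linarith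
      then have "0 \<le> R \<and> R \<le> 1"
      proof cases
        case 1
        then have "R = \<kappa>0 * ramp r (2*r) x" using r r' ab by (simp add: R_def ramp_eq_0)
        then show ?thesis using mb[of \<kappa>0 r "2*r"] \<kappa> by simp
      next
        case 2
        then have "R = \<kappa>0 + (1 - \<kappa>0) * ramp (2*r) a x" using r r' ab by (simp add: R_def ramp_eq_0 ramp_eq_1)
        then show ?thesis using mb[of "1 - \<kappa>0" "2*r" a] \<kappa> by simp
      next
        case 3
        then have "R = 1 - (1 - \<kappa>1) * ramp b (L - 2*r) x" using r r' ab by (simp add: R_def ramp_eq_0 ramp_eq_1)
        then show ?thesis using mb[of "1 - \<kappa>1" b "L - 2*r"] \<kappa> by simp
      next
        case 4
        then have "R = \<kappa>1 - \<kappa>1 * ramp (L - 2*r) (L - r) x" using r r' ab by (simp add: R_def ramp_eq_1)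
        then show ?thesis using mb[of \<kappa>1 "L - 2*r" "L - r"] \<kappa> by simp
      qed
      then have "\<bar>s\<bar> * \<bar>R\<bar> \<le> 1 * 1" using s by (intro mult_mono) auto
      then show ?thesis unfolding val R_def[symmetric] by (simp add: abs_mult)
    qed
  qed
  have ev: "\<forall>\<^sub>F r in at_right 0. 0 < r \<and> r < d"
    unfolding eventually_at_right_field using d by blast
  have t0: "((\<lambda>r. integral {0..r} u / r) \<longlongrightarrow> c0) (at_right 0)" using tr(1) has_trace_left_iff[OF int L] by simp
  have tL: "((\<lambda>r. integral {L - r..L} u / r) \<longlongrightarrow> cL) (at_right 0)" using tr(2) has_trace_right_iff[OF int L] by simp
  have dbl: "filterlim (\<lambda>r::real. 2 * r) (at_right 0) (at_right 0)"
    unfolding filterlim_at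
  proof
    have "((\<lambda>r::real. 2 * r) \<longlongrightarrow> 2 * 0) (at_right 0)" by (intro tendsto_intros)
    then show "((\<lambda>r::real. 2 * r) \<longlongrightarrow> 0) (at_right 0)" by simp
    show "\<forall>\<^sub>F r::real in at_right 0. 2 * r \<in> {0<..} \<and> 2 * r \<noteq> 0"
      unfolding eventually_at_right_field by (intro exI[of _ 1]) auto
  qed
  have l1: "((\<lambda>r. integral {r..2*r} u / r) \<longlongrightarrow> c0) (at_right 0)"
  proof -
    \<comment> \<open>The mean over \<open>[r, 2r]\<close> is twice the mean over
      \<open>[0, 2r]\<close> minus the mean over \<open>[0, r]\<close>, and both of these converge
      to the trace.\<close>
    have "((\<lambda>r. 2 * (integral {0..2*r} u / (2*r)) - integral {0..r} u / r) \<longlongrightarrow> 2 * c0 - c0) (at_right 0)"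
      by (intro tendsto_intros t0 filterlim_compose[OF t0 dbl])
    moreover have "\<forall>\<^sub>F r in at_right 0. 2 * (integral {0..2*r} u / (2*r)) - integral {0..r} u / r = integral {r..2*r} u / r"
      using ev
    proof eventually_elim
      case (elim r)
      then have "integral {0..r} u + integral {r..2*r} u = integral {0..2*r} u"
        using ab by (intro Henstock_Kurzweil_Integration.integral_combine ion) (auto simp: d_def)
      then show ?case using elim by (simp add: field_simps)
    qed
    ultimately show ?thesis by (simp add: tendsto_cong)
  qed
  have l4: "((\<lambda>r. integral {L - 2*r..L - r} u / r) \<longlongrightarrow> cL) (at_right 0)"
  proof -
    have "((\<lambda>r. 2 * (integral {L - 2*r..L} u / (2*r)) - integral {L - r..L} u / r) \<longlongrightarrow> 2 * cL - cL) (at_right 0)"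
      by (intro tendsto_intros tL filterlim_compose[OF tL dbl])
    moreover have "\<forall>\<^sub>F r in at_right 0. 2 * (integral {L - 2*r..L} u / (2*r)) - integral {L - r..L} u / r = integral {L - 2*r..L - r} u / r"
      using ev
    proof eventually_elim
      case (elim r)
      then have "integral {L - 2*r..L - r} u + integral {L - r..L} u = integral {L - 2*r..L} u"
        using ab by (intro Henstock_Kurzweil_Integration.integral_combine ion) (auto simp: d_def)
      then show ?case using elim by (simp add: field_simps)
    qed
    ultimately show ?thesis by (simp add: tendsto_cong)
  qed
  have dl: "filterlim (\<lambda>r::real. L - 2 * r) (at_left L) (at_right 0)"
    unfolding filterlim_at
  proof
    have "((\<lambda>r::real. L - 2 * r) \<longlongrightarrow> L - 2 * 0) (at_right 0)" by (intro tendsto_intros)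
    then show "((\<lambda>r::real. L - 2 * r) \<longlongrightarrow> L) (at_right 0)" by simp
    show "\<forall>\<^sub>F r::real in at_right 0. L - 2 * r \<in> {..<L} \<and> L - 2 * r \<noteq> L"
      unfolding eventually_at_right_field by (intro exI[of _ 1]) auto
  qed
  have l2: "((\<lambda>r. integral {2*r..a} u / (a - 2*r)) \<longlongrightarrow> integral {0..a} u / (a - 2 * 0)) (at_right 0)"
    using ab by (intro tendsto_intros filterlim_compose[OF integral_left_endpoint_limit dbl] ion) auto
  have l3: "((\<lambda>r. integral {b..L - 2*r} u / (L - 2*r - b)) \<longlongrightarrow> integral {b..L} u / (L - 2*0 - b)) (at_right 0)"
    using ab by (intro tendsto_intros filterlim_compose[OF integral_right_endpoint_limit dl] ion) auto
  have "((\<lambda>r. s * \<kappa>0 * (integral {r..2*r} u / r) + s * (1 - \<kappa>0) * (integral {2*r..a} u / (a - 2*r))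
      - s * (1 - \<kappa>1) * (integral {b..L - 2*r} u / (L - 2*r - b)) - s * \<kappa>1 * (integral {L - 2*r..L - r} u / r))
    \<longlongrightarrow> s * \<kappa>0 * c0 + s * (1 - \<kappa>0) * (integral {0..a} u / (a - 2 * 0))
      - s * (1 - \<kappa>1) * (integral {b..L} u / (L - 2 * 0 - b)) - s * \<kappa>1 * cL) (at_right 0)"
    by (intro tendsto_add tendsto_diff tendsto_mult_left l1 l2 l3 l4)
  moreover have "(\<lambda>r. ramps_integral (xs r) u) = (\<lambda>r. s * \<kappa>0 * (integral {r..2*r} u / r) + s * (1 - \<kappa>0) * (integral {2*r..a} u / (a - 2*r))
      - s * (1 - \<kappa>1) * (integral {b..L - 2*r} u / (L - 2*r - b)) - s * \<kappa>1 * (integral {L - 2*r..L - r} u / r))"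
    by (simp add: ramps_integral_def xs_def fun_eq_iff)
  moreover have "s * \<kappa>0 * c0 + s * (1 - \<kappa>0) * (integral {0..a} u / (a - 2 * 0))
      - s * (1 - \<kappa>1) * (integral {b..L} u / (L - 2 * 0 - b)) - s * \<kappa>1 * cL
    = s * (\<kappa>0 * c0 + (1 - \<kappa>0) * integral {0..a} u / a - (1 - \<kappa>1) * integral {b..L} u / (L - b) - \<kappa>1 * cL)"
    by (simp add: algebra_simps diff_divide_distrib)
  ultimately have "((\<lambda>r. ramps_integral (xs r) u) \<longlongrightarrow> s * (\<kappa>0 * c0 + (1 - \<kappa>0) * integral {0..a} u / a
      - (1 - \<kappa>1) * integral {b..L} u / (L - b) - \<kappa>1 * cL)) (at_right 0)"
    by simp
  then have "((\<lambda>r. ereal (ramps_integral (xs r) u)) \<longlongrightarrow> ereal (s * (\<kappa>0 * c0 + (1 - \<kappa>0) * integral {0..a} u / a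
      - (1 - \<kappa>1) * integral {b..L} u / (L - b) - \<kappa>1 * cL))) (at_right 0)" by simp
  then show ?thesis
  proof (rule tendsto_upperbound)
    show "\<forall>\<^sub>F r in at_right 0. ereal (ramps_integral (xs r) u) \<le> total_variation L u"
      using ev by eventually_elim (use bound in blast)
  qed simp
qed

text \<open>The second mean value theorem replaces Stieltjes integration by parts: since
  \<open>\<phi>\<close> vanishes at both ends, pairing \<open>w\<close> with
  \<open>deriv \<phi>\<close> gives \<open>- \<phi> \<xi> * (w L - w 0)\<close> for some
  \<open>\<xi>\<close>. The factor \<open>c\<close> leaves room for the sign
  \<open>chi\<close>.\<close>

lemma total_variation_monotone_le:
  fixes w :: "real \<Rightarrow> real"
  assumes L: "L > 0" and w: "mono_on {0..L} w" and int: "integrable (lebesgue_on {0<..<L}) w" and c: "\<bar>c\<bar> \<le> 1"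
  shows "total_variation L (\<lambda>x. c * w x) \<le> ereal (w L - w 0)"
  unfolding total_variation_def
proof (rule SUP_least)
  fix \<phi> assume "\<phi> \<in> {\<phi> \<in> C1_compact 0 L. \<forall>x. \<bar>\<phi> x\<bar> \<le> 1}"
  then have \<phi>: "\<phi> \<in> C1_compact 0 L" "\<And>x. \<bar>\<phi> x\<bar> \<le> 1" by auto
  note d = C1_compactD[OF \<phi>(1)]
  have ftc: "(deriv \<phi> has_integral (\<phi> q - \<phi> p)) {p..q}" if "p \<le> q" for p q
    using d(1) that by (intro fundamental_theorem_of_calculus)
      (auto simp: has_real_derivative_iff_has_vector_derivative[symmetric] intro: has_field_derivative_at_within)
  have wle: "w 0 \<le> w L" using w L by (auto simp: mono_on_def)
  obtain \<xi> where \<xi>: "\<xi> \<in> {0..L}"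
    "integral {0..L} (\<lambda>x. w x * deriv \<phi> x) = w 0 * integral {0..\<xi>} (deriv \<phi>) + w L * integral {\<xi>..L} (deriv \<phi>)"
  proof (rule second_mean_value_theorem[of "deriv \<phi>" 0 L w])
    show "deriv \<phi> integrable_on {0..L}" using ftc[of 0 L] L by (meson has_integral_integrable less_imp_le)
    show "w x \<le> w y" if "0 \<le> x" "x \<le> y" "y \<le> L" for x y using w that by (auto simp: mono_on_def)
  qed (use L in auto)
  have "integral {0..\<xi>} (deriv \<phi>) = \<phi> \<xi> - \<phi> 0" "integral {\<xi>..L} (deriv \<phi>) = \<phi> L - \<phi> \<xi>"
    using \<xi>(1) by (auto intro!: integral_unique ftc)
  moreover have "\<phi> 0 = 0" "\<phi> L = 0" using d(3)[of 0] d(3)[of L] by auto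
  ultimately have I: "integral {0..L} (\<lambda>x. w x * deriv \<phi> x) = - \<phi> \<xi> * (w L - w 0)"
    using \<xi>(2) by (simp add: algebra_simps)
  have "(\<integral>x. c * w x * deriv \<phi> x \<partial>lebesgue_on {0<..<L}) = c * (\<integral>x. w x * deriv \<phi> x \<partial>lebesgue_on {0<..<L})"
    by (simp add: mult.assoc)
  also have "\<dots> = (- c * \<phi> \<xi>) * (w L - w 0)"
    using integral_lebesgue_on_interval[OF bounded_mult_integrable[OF int d(2)]] I by simp
  also have "\<dots> \<le> 1 * (w L - w 0)"
  proof (rule mult_right_mono)
    have "\<bar>c\<bar> * \<bar>\<phi> \<xi>\<bar> \<le> 1 * 1" using c \<phi>(2) by (intro mult_mono) auto
    then show "- c * \<phi> \<xi> \<le> 1" by (simp add: abs_mult[symmetric] abs_le_iff)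
  qed (use wle in simp)
  finally show "ereal (\<integral>x. c * w x * deriv \<phi> x \<partial>lebesgue_on {0<..<L}) \<le> ereal (w L - w 0)" by simp
qed

subsection \<open>Calibrable and coherent facets\<close>

text \<open>The window shrinks towards \<open>c\<close> without having to contain it, which admits
  layers such as \<open>[p + r, p + 2r]\<close> near \<open>p\<close>.\<close>

lemma average_tendsto:
  fixes f P Q :: "real \<Rightarrow> real"
  assumes f: "continuous_on {a..b} f" and c: "c \<in> {a..b}"
    and PQ: "\<forall>\<^sub>F r in F. a \<le> P r \<and> P r < Q r \<and> Q r \<le> b"
    and P: "(P \<longlongrightarrow> c) F" and Q: "(Q \<longlongrightarrow> c) F"
  shows "((\<lambda>r. integral {P r..Q r} f / (Q r - P r)) \<longlongrightarrow> f c) F"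
proof (rule tendstoI)
  fix e :: real assume "e > 0"
  then have e: "e / 2 > 0" by simp
  then obtain d where d: "d > 0" "\<And>x. x \<in> {a..b} \<Longrightarrow> dist x c < d \<Longrightarrow> dist (f x) (f c) < e / 2"
    using f c unfolding continuous_on_iff by blast
  have "\<forall>\<^sub>F r in F. dist (P r) c < d" "\<forall>\<^sub>F r in F. dist (Q r) c < d"
    using tendstoD[OF P d(1)] tendstoD[OF Q d(1)] by simp_all
  with PQ show "\<forall>\<^sub>F r in F. dist (integral {P r..Q r} f / (Q r - P r)) (f c) < e"
  proof eventually_elim
    case (elim r)
    then have le: "P r \<le> Q r" "0 < Q r - P r" and sub: "{P r..Q r} \<subseteq> {a..b}" by auto
    have cf: "continuous_on {P r..Q r} f" using f sub by (rule continuous_on_subset)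
    have "norm (integral {P r..Q r} (\<lambda>x. f x - f c)) \<le> e / 2 * (Q r - P r)"
    proof (rule integral_bound[OF le(1)])
      show "continuous_on {P r..Q r} (\<lambda>x. f x - f c)" using cf by (intro continuous_intros)
      fix t assume t: "t \<in> {P r..Q r}"
      then have "dist t c < d" using elim by (auto simp: dist_real_def)
      then show "norm (f t - f c) \<le> e / 2" using d(2)[of t] t sub by (simp add: dist_norm subset_iff less_imp_le)
    qed
    also have "integral {P r..Q r} (\<lambda>x. f x - f c) = integral {P r..Q r} f - (Q r - P r) * f c"
      using cf le(1) by (subst Henstock_Kurzweil_Integration.integral_diff) (auto intro: integrable_continuous_interval)
    finally have "\<bar>integral {P r..Q r} f - (Q r - P r) * f c\<bar> / (Q r - P r) \<le> e / 2"
      using le(2) by (simp add: divide_le_eq)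
    moreover have "integral {P r..Q r} f / (Q r - P r) - f c = (integral {P r..Q r} f - (Q r - P r) * f c) / (Q r - P r)"
      using le(2) by (simp add: diff_divide_distrib)
    ultimately have "\<bar>integral {P r..Q r} f / (Q r - P r) - f c\<bar> \<le> e / 2"
      using le(2) by (simp add: abs_divide)
    then show ?case using \<open>e > 0\<close> by (simp add: dist_real_def)
  qed
qed

lemma lebesgue_integral_const_Icc:
  fixes c :: real
  assumes "p \<le> q"
  shows "(\<integral>x. c \<partial>lebesgue_on {p..q}) = c * (q - p)"
proof -
  have "integrable (lebesgue_on {p..q}) (\<lambda>x. c)" by (intro continuous_imp_integrable_real) simp
  from lebesgue_integral_eq_integral[OF this] show ?thesis using assms by simp
qed

lemma L2_Icc_integrable:
  assumes "f \<in> L2 {p..q}"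
  shows "integrable (lebesgue_on {p..q}) f"
proof (rule Bochner_Integration.integrable_bound)
  have "integrable (lebesgue_on {p..q}) (\<lambda>x. 1::real)" by (intro continuous_imp_integrable_real) simp
  then show "integrable (lebesgue_on {p..q}) (\<lambda>x. 1 + (f x)\<^sup>2)" using assms by (simp add: L2_def)
  show "f \<in> borel_measurable (lebesgue_on {p..q})" using assms by (simp add: L2_def)
  have "\<bar>f x\<bar> \<le> 1 + (f x)\<^sup>2" for x
  proof -
    have "0 \<le> (\<bar>f x\<bar> - 1)\<^sup>2" "0 \<le> \<bar>f x\<bar>" by simp_all
    then show ?thesis unfolding power2_diff power2_abs by simp
  qed
  then show "AE x in lebesgue_on {p..q}. norm (f x) \<le> norm (1 + (f x)\<^sup>2)" by simp
qed

lemma integral_Icc_eq_Ioo: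
  fixes f :: "real \<Rightarrow> real"
  assumes "integrable (lebesgue_on {p..q}) f"
  shows "integrable (lebesgue_on {p<..<q}) f"
    "(\<integral>x. f x \<partial>lebesgue_on {p..q}) = (\<integral>x. f x \<partial>lebesgue_on {p<..<q})"
proof -
  show 1: "integrable (lebesgue_on {p<..<q}) f"
    using assms by (rule integrable_lebesgue_on_subset) auto
  show "(\<integral>x. f x \<partial>lebesgue_on {p..q}) = (\<integral>x. f x \<partial>lebesgue_on {p<..<q})"
    using lebesgue_integral_eq_integral[OF assms] integral_lebesgue_on_interval[OF 1] by simp
qed

text \<open>Test with trapezoids equal to 1 on \<open>[p + 2r, q - 2r]\<close> and let \<open>r\<close> tend to 0.\<close>

lemma W12_interval_integral_derivative:
  assumes W: "W12_interval p q z z'" and pq: "p < q"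
  shows "(\<integral>x. z' x \<partial>lebesgue_on {p..q}) = z q - z p"
proof -
  have z: "continuous_on {p..q} z" and z': "z' \<in> L2 {p..q}"
    and weak: "\<And>\<phi>. \<phi> \<in> C1_compact p q \<Longrightarrow>
        (\<integral>x. z x * deriv \<phi> x \<partial>lebesgue_on {p..q}) = - (\<integral>x. z' x * \<phi> x \<partial>lebesgue_on {p..q})"
    using W by (simp_all add: W12_interval_def)
  have iz': "integrable (lebesgue_on {p..q}) z'" using z' by (rule L2_Icc_integrable)
  have iz: "integrable (lebesgue_on {p<..<q}) z"
    using z by (intro integral_Icc_eq_Ioo continuous_imp_integrable_real)
  define xs :: "real \<Rightarrow> (real \<times> real \<times> real) list" where
    "xs r = [(1, p + r, p + 2 * r), (-1, q - 2 * r, q - r)]" for r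
  have val: "ramps (xs r) x = ramp (p + r) (p + 2 * r) x - ramp (q - 2 * r) (q - r) x" for r x
    by (simp add: ramps_def xs_def)
  have M: "\<bar>ramps (xs r) x\<bar> \<le> 1" for r x
    unfolding val using ramp_bounds[of "p + r" "p + 2 * r" x] ramp_bounds[of "q - 2 * r" "q - r" x] by linarith
  \<comment> \<open>The weak identity is given for continuously differentiable test functions only;
    for fixed \<open>r\<close> it passes to the trapezoid by approximation.\<close>
  have eq: "ramps_integral (xs r) z = - (\<integral>x. z' x * ramps (xs r) x \<partial>lebesgue_on {p..q})"
    if r: "0 < r" "r < (q - p) / 4" for r
  proof -
    have 1: "\<forall>(c, p', q')\<in>set (xs r). p \<le> p' \<and> p' < q' \<and> q' \<le> q" using r by (auto simp: xs_def)
    have 2: "\<forall>x. x \<notin> {p + r..q - r} \<longrightarrow> ramps (xs r) x = 0"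
      using r by (auto simp: val not_le ramp_eq_0 ramp_eq_1)
    have 3: "p < p + r" "q - r < q" using r by auto
    from ramps_integral_limit[OF iz 1 M 2 3] obtain \<phi> where \<phi>:
      "\<forall>n. \<phi> n \<in> C1_compact p q" "\<forall>n x. \<bar>\<phi> n x\<bar> \<le> 1" "\<forall>x. (\<lambda>n. \<phi> n x) \<longlonglongrightarrow> ramps (xs r) x"
      "(\<lambda>n. \<integral>x. z x * deriv (\<phi> n) x \<partial>lebesgue_on {p<..<q}) \<longlonglongrightarrow> ramps_integral (xs r) z"
      by (elim exE conjE) (rule that)
    have "(\<integral>x. z x * deriv (\<phi> n) x \<partial>lebesgue_on {p<..<q}) = - (\<integral>x. z' x * \<phi> n x \<partial>lebesgue_on {p..q})" for n
    proof -
      have "continuous_on {p..q} (\<lambda>x. z x * deriv (\<phi> n) x)"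
        using z C1_compactD(2)[of "\<phi> n"] \<phi>(1) by (intro continuous_on_mult) (auto intro: continuous_on_subset)
      then have "integrable (lebesgue_on {p..q}) (\<lambda>x. z x * deriv (\<phi> n) x)" by (rule continuous_imp_integrable_real)
      from integral_Icc_eq_Ioo(2)[OF this] show ?thesis using weak \<phi>(1) by simp
    qed
    then have l1: "(\<lambda>n. - (\<integral>x. z' x * \<phi> n x \<partial>lebesgue_on {p..q})) \<longlonglongrightarrow> ramps_integral (xs r) z"
      using \<phi>(4) by simp
    have "(\<lambda>n. \<integral>x. z' x * \<phi> n x \<partial>lebesgue_on {p..q}) \<longlonglongrightarrow> (\<integral>x. z' x * ramps (xs r) x \<partial>lebesgue_on {p..q})"
    proof (rule integral_dominated_convergence[where w = "\<lambda>x. \<bar>z' x\<bar>"])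
      have zm: "z' \<in> borel_measurable (lebesgue_on {p..q})" using iz' by (rule borel_measurable_integrable)
      have "\<phi> n \<in> borel_measurable (lebesgue_on {p..q})" for n
      proof -
        have "continuous_on UNIV (\<phi> n)" using C1_compactD(1)[of "\<phi> n"] \<phi>(1)
          by (meson DERIV_isCont continuous_at_imp_continuous_on)
        then show ?thesis by (intro continuous_imp_measurable_on_sets_lebesgue) (auto intro: continuous_on_subset)
      qed
      then show "(\<lambda>x. z' x * \<phi> n x) \<in> borel_measurable (lebesgue_on {p..q})" for n
        using zm by (intro borel_measurable_times)
      show "(\<lambda>x. z' x * ramps (xs r) x) \<in> borel_measurable (lebesgue_on {p..q})"
        using zm ramps_measurable by (rule borel_measurable_times)
      show "AE x in lebesgue_on {p..q}. (\<lambda>n. z' x * \<phi> n x) \<longlonglongrightarrow> z' x * ramps (xs r) x"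
        using \<phi>(3) by (intro always_eventually allI tendsto_mult_left) simp
      show "AE x in lebesgue_on {p..q}. norm (z' x * \<phi> n x) \<le> \<bar>z' x\<bar>" for n
        using \<phi>(2) by (intro always_eventually allI) (simp add: abs_mult mult_left_le)
    qed (use iz' in simp)
    then have "(\<lambda>n. - (\<integral>x. z' x * \<phi> n x \<partial>lebesgue_on {p..q})) \<longlonglongrightarrow> - (\<integral>x. z' x * ramps (xs r) x \<partial>lebesgue_on {p..q})"
      by (rule tendsto_minus)
    with l1 show ?thesis using LIMSEQ_unique by blast
  qed
  \<comment> \<open>Dominated convergence runs along sequences. The factor 1/8 puts even the first
    term strictly below \<open>(q - p) / 4\<close>, so the two ramps never meet.\<close>
  define \<rho> where "\<rho> n = (q - p) / 8 / real (Suc n)" for n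
  have \<rho>: "0 < \<rho> n" "\<rho> n < (q - p) / 4" for n
  proof -
    show "0 < \<rho> n" using pq by (simp add: \<rho>_def)
    have "\<rho> n \<le> (q - p) / 8 / 1" unfolding \<rho>_def using pq by (intro divide_left_mono) auto
    then show "\<rho> n < (q - p) / 4" using pq by simp
  qed
  have \<rho>0: "\<rho> \<longlonglongrightarrow> 0" unfolding \<rho>_def[abs_def] by (rule LIMSEQ_Suc, rule lim_const_over_n)
  have F: "filterlim \<rho> (at_right 0) sequentially" using \<rho>(1) \<rho>0
    by (simp add: filterlim_at less_imp_neq[symmetric])
  have evr: "\<forall>\<^sub>F r in at_right 0. 0 < r \<and> r < (q - p) / 4"
    unfolding eventually_at_right_field using pq by (intro exI[of _ "(q - p) / 4"]) auto
  have i1: "((\<lambda>r::real. p + r) \<longlongrightarrow> p + 0) (at_right 0)" "((\<lambda>r::real. p + 2 * r) \<longlongrightarrow> p + 2 * 0) (at_right 0)"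
     "((\<lambda>r::real. q - 2 * r) \<longlongrightarrow> q - 2 * 0) (at_right 0)" "((\<lambda>r::real. q - r) \<longlongrightarrow> q - 0) (at_right 0)"
    by (intro tendsto_intros)+
  have a1: "((\<lambda>r. integral {p + r..p + 2 * r} z / (p + 2 * r - (p + r))) \<longlongrightarrow> z p) (at_right 0)"
    using pq i1 evr by (intro average_tendsto[OF z]) (auto elim!: eventually_mono)
  have a2: "((\<lambda>r. integral {q - 2 * r..q - r} z / (q - r - (q - 2 * r))) \<longlongrightarrow> z q) (at_right 0)"
    using pq i1 evr by (intro average_tendsto[OF z]) (auto elim!: eventually_mono)
  have "((\<lambda>r. ramps_integral (xs r) z) \<longlongrightarrow> z p - z q) (at_right 0)"
    using tendsto_diff[OF a1 a2] by (simp add: ramps_integral_def xs_def)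
  from filterlim_compose[OF this F] have "(\<lambda>n. ramps_integral (xs (\<rho> n)) z) \<longlonglongrightarrow> z p - z q" .
  then have A: "(\<lambda>n. - (\<integral>x. z' x * ramps (xs (\<rho> n)) x \<partial>lebesgue_on {p..q})) \<longlonglongrightarrow> z p - z q"
    using eq \<rho> by simp
  have "(\<lambda>n. \<integral>x. z' x * ramps (xs (\<rho> n)) x \<partial>lebesgue_on {p..q}) \<longlonglongrightarrow> (\<integral>x. z' x \<partial>lebesgue_on {p..q})"
  proof (rule integral_dominated_convergence[where w = "\<lambda>x. \<bar>z' x\<bar>"])
    show zm: "z' \<in> borel_measurable (lebesgue_on {p..q})" using iz' by (rule borel_measurable_integrable)
    show "(\<lambda>x. z' x * ramps (xs (\<rho> n)) x) \<in> borel_measurable (lebesgue_on {p..q})" for n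
      using zm ramps_measurable by (rule borel_measurable_times)
    show "AE x in lebesgue_on {p..q}. norm (z' x * ramps (xs (\<rho> n)) x) \<le> \<bar>z' x\<bar>" for n
      using M by (intro always_eventually allI) (simp add: abs_mult mult_left_le)
    show "AE x in lebesgue_on {p..q}. (\<lambda>n. z' x * ramps (xs (\<rho> n)) x) \<longlonglongrightarrow> z' x"
    proof (rule AE_lebesgue_on_except_finite[of "{p, q}"])
      fix x assume "x \<in> {p..q}" "x \<notin> {p, q}"
      then have x: "p < x" "x < q" by auto
      define d where "d = min ((x - p) / 2) ((q - x) / 2)"
      have "d > 0" using x by (simp add: d_def)
      then have "\<forall>\<^sub>F n in sequentially. \<rho> n < d" using order_tendstoD(2)[OF \<rho>0] by blast
      then have "\<forall>\<^sub>F n in sequentially. z' x * ramps (xs (\<rho> n)) x = z' x"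
      proof eventually_elim
        case (elim n)
        then have "p + 2 * \<rho> n \<le> x" "x \<le> q - 2 * \<rho> n" by (auto simp: d_def)
        then show ?case using \<rho>(1)[of n] by (simp add: val ramp_eq_0 ramp_eq_1)
      qed
      then show "(\<lambda>n. z' x * ramps (xs (\<rho> n)) x) \<longlonglongrightarrow> z' x" by (rule tendsto_eventually)
    qed simp_all
  qed (use iz' in simp)
  from tendsto_minus[OF this] have "z p - z q = - (\<integral>x. z' x \<partial>lebesgue_on {p..q})"
    using A LIMSEQ_unique by blast
  then show ?thesis by simp
qed

text \<open>The product of the affine function and \<open>\<phi>\<close> vanishes at both ends, so
  the fundamental theorem gives the weak identity.\<close>

lemma W12_interval_affine:
  assumes "p < q"
  shows "W12_interval p q (\<lambda>x. \<alpha> + c * x) (\<lambda>x. c)"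
  unfolding W12_interval_def
proof (intro conjI ballI)
  show "continuous_on {p..q} (\<lambda>x. \<alpha> + c * x)" by (intro continuous_intros)
  have "integrable (lebesgue_on {p..q}) (\<lambda>x. c\<^sup>2)" by (intro continuous_imp_integrable_real) simp
  then show "(\<lambda>x. c) \<in> L2 {p..q}" by (simp add: L2_def)
  fix \<phi> assume \<phi>: "\<phi> \<in> C1_compact p q"
  note d = C1_compactD[OF \<phi>]
  have "continuous_on UNIV \<phi>" using d(1) by (meson DERIV_isCont continuous_at_imp_continuous_on)
  then have cp: "continuous_on {p..q} \<phi>" by (rule continuous_on_subset) simp
  have cd: "continuous_on {p..q} (deriv \<phi>)" using d(2) by (rule continuous_on_subset) simp
  have i1: "integrable (lebesgue_on {p..q}) (\<lambda>x. (\<alpha> + c * x) * deriv \<phi> x)"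
    by (intro continuous_imp_integrable_real continuous_intros cd)
  have i2: "integrable (lebesgue_on {p..q}) (\<lambda>x. c * \<phi> x)"
    by (intro continuous_imp_integrable_real continuous_intros cp)
  have "((\<lambda>x. (\<alpha> + c * x) * deriv \<phi> x + c * \<phi> x) has_integral ((\<alpha> + c * q) * \<phi> q - (\<alpha> + c * p) * \<phi> p)) {p..q}"
  proof (rule fundamental_theorem_of_calculus)
    show "((\<lambda>x. (\<alpha> + c * x) * \<phi> x) has_vector_derivative (\<alpha> + c * x) * deriv \<phi> x + c * \<phi> x) (at x within {p..q})" for x
      unfolding has_real_derivative_iff_has_vector_derivative[symmetric]
      by (rule has_field_derivative_at_within) (auto intro!: derivative_eq_intros d(1))
  qed (use assms in simp)
  moreover have "\<phi> p = 0" "\<phi> q = 0" using d(3) by auto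
  ultimately have "integral {p..q} (\<lambda>x. (\<alpha> + c * x) * deriv \<phi> x + c * \<phi> x) = 0"
    by (simp add: integral_unique)
  moreover have "(\<integral>x. (\<alpha> + c * x) * deriv \<phi> x + c * \<phi> x \<partial>lebesgue_on {p..q})
      = integral {p..q} (\<lambda>x. (\<alpha> + c * x) * deriv \<phi> x + c * \<phi> x)"
    using i1 i2 by (intro lebesgue_integral_eq_integral) auto
  ultimately show "(\<integral>x. (\<alpha> + c * x) * deriv \<phi> x \<partial>lebesgue_on {p..q}) = - (\<integral>x. c * \<phi> x \<partial>lebesgue_on {p..q})"
    using i1 i2 by simp
qed

text \<open>Expanding the nonnegative integral of \<open>(y' - c)\<^sup>2\<close> gives the tangent
  bound of the convex functional at the constant slope \<open>c\<close>. Only boundary values of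
  \<open>y\<close> survive on the left, so any competitor can be compared with an affine
  field.\<close>

lemma integral_square_ge:
  assumes W: "W12_interval p q y y'" and pq: "p < q"
  shows "2 * c * (y q - y p) - c\<^sup>2 * (q - p) \<le> (\<integral>x. \<bar>y' x\<bar>\<^sup>2 \<partial>lebesgue_on {p..q})"
proof -
  have y': "y' \<in> L2 {p..q}" using W by (simp add: W12_interval_def)
  have i: "integrable (lebesgue_on {p..q}) y'" "integrable (lebesgue_on {p..q}) (\<lambda>x. (y' x)\<^sup>2)"
    using L2_Icc_integrable[OF y'] y' by (simp_all add: L2_def)
  have ic: "integrable (lebesgue_on {p..q}) (\<lambda>x. c\<^sup>2)" by (intro continuous_imp_integrable_real) simp
  have "0 \<le> (\<integral>x. (y' x - c)\<^sup>2 \<partial>lebesgue_on {p..q})" by (rule Bochner_Integration.integral_nonneg) simp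
  also have "\<dots> = (\<integral>x. (y' x)\<^sup>2 - 2 * c * y' x + c\<^sup>2 \<partial>lebesgue_on {p..q})"
    by (rule Bochner_Integration.integral_cong) (auto simp: power2_diff)
  also have "\<dots> = (\<integral>x. (y' x)\<^sup>2 \<partial>lebesgue_on {p..q}) - 2 * c * (\<integral>x. y' x \<partial>lebesgue_on {p..q}) + c\<^sup>2 * (q - p)"
    using i ic pq lebesgue_integral_const_Icc[of p q "c\<^sup>2"] by simp
  also have "(\<integral>x. y' x \<partial>lebesgue_on {p..q}) = y q - y p" by (rule W12_interval_integral_derivative[OF W pq])
  finally show ?thesis by simp
qed

text \<open>Among affine fields with \<open>z b = chi\<close>, coherence asks for
  \<open>z L = - c\<close> with \<open>c\<close> the slope; \<open>chi + c * m = - c\<close> then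
  fixes \<open>c\<close>. The same field minimises \<open>I1\<close>, so one witness serves both
  claims.\<close>

lemma right_facet_calibrable_coherent:
  assumes b: "0 < b" "b < L" and chi: "\<bar>chi\<bar> = 1"
  shows "calibrable L b L chi" "coherent L b L chi"
proof -
  define m where "m = L - b"
  define c where "c = - chi / (1 + m)"
  define z where "z x = (chi - c * b) + c * x" for x
  have m: "m > 0" using b by (simp add: m_def)
  have cm: "chi = - c * (1 + m)" using m by (simp add: c_def)
  have zL: "z L = - c" using cm by (simp add: z_def m_def algebra_simps)
  have zb: "z b = chi" by (simp add: z_def)
  have W: "W12_interval b L z (\<lambda>x. c)" unfolding z_def[abs_def] using b by (intro W12_interval_affine)
  have sets: "{b, L} - {0, L} = {b}" "{b..L} \<inter> {0, L} = {L}" using b by auto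
  have on: "outer_normal L = 1" using b by (simp add: outer_normal_def)
  have le1: "\<bar>z x\<bar> \<le> 1" if "x \<in> {b..L}" for x
  proof -
    have eq: "z x = chi * (1 - (x - b) / (1 + m))" by (simp add: z_def c_def algebra_simps diff_divide_distrib)
    have "0 \<le> (x - b) / (1 + m)" "(x - b) / (1 + m) \<le> 1" using that m by (auto simp: m_def)
    then have "\<bar>1 - (x - b) / (1 + m)\<bar> \<le> 1" by linarith
    then show ?thesis unfolding eq abs_mult chi mult_1 .
  qed
  have ch: "cahn_hoffman L b L chi z (\<lambda>x. c)"
    unfolding cahn_hoffman_def sets using W le1 zb by auto
  have int: "(\<integral>x. c \<partial>lebesgue_on {b..L}) = c * m" "(\<integral>x. \<bar>c\<bar>\<^sup>2 \<partial>lebesgue_on {b..L}) = c\<^sup>2 * m"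
    using b lebesgue_integral_const_Icc[of b L c] lebesgue_integral_const_Icc[of b L "\<bar>c\<bar>\<^sup>2"] by (simp_all add: m_def)
  have min: "I1_minimizer L b L chi z (\<lambda>x. c)"
    unfolding I1_minimizer_def
  proof (intro conjI allI impI ch)
    fix y y' assume "cahn_hoffman L b L chi y y'"
    then have Wy: "W12_interval b L y y'" and yb: "y b = chi" by (auto simp: cahn_hoffman_def sets)
    have "2 * c * (y L - y b) - c\<^sup>2 * m \<le> (\<integral>x. \<bar>y' x\<bar>\<^sup>2 \<partial>lebesgue_on {b..L})"
      unfolding m_def using b by (intro integral_square_ge[OF Wy])
    moreover have "0 \<le> (y L + c)\<^sup>2" by simp
    \<comment> \<open>The value of \<open>I1\<close> at \<open>z\<close> is
      \<open>c\<^sup>2 * m + c\<^sup>2\<close>; what the tangent bound leaves over for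
      \<open>y\<close> is a perfect square.\<close>
    moreover have "2 * c * (y L - y b) - c\<^sup>2 * m + (y L)\<^sup>2 - (c\<^sup>2 * m + c\<^sup>2) = (y L + c)\<^sup>2"
      unfolding yb cm by (simp add: power2_eq_square algebra_simps)
    ultimately have "c\<^sup>2 * m + c\<^sup>2 \<le> (\<integral>x. \<bar>y' x\<bar>\<^sup>2 \<partial>lebesgue_on {b..L}) + (y L)\<^sup>2" by linarith
    then show "I1 L b L z (\<lambda>x. c) \<le> I1 L b L y y'"
      unfolding I1_def sets int by (simp add: on zL)
  qed
  show "calibrable L b L chi" unfolding calibrable_def using min by blast
  show "coherent L b L chi"
    unfolding coherent_def
  proof (rule exI[of _ z], rule exI[of _ "\<lambda>x. c"], intro conjI min ballI)
    fix i assume "i \<in> {b..L} \<inter> {0, L}"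
    then have "i = L" unfolding sets by simp
    then show "1 / (L - b) * (\<integral>x. c \<partial>lebesgue_on {b..L}) + z i * outer_normal i = 0"
      using m unfolding int on m_def[symmetric] by (simp add: on zL)
  qed
qed

text \<open>Mirror image of the right facet: the outer normal at 0 is -1, so coherence asks for
  \<open>z 0 = c\<close>, and \<open>c + c * a = chi\<close> fixes the slope.\<close>

lemma left_facet_calibrable_coherent:
  assumes a: "0 < a" "a < L" and chi: "\<bar>chi\<bar> = 1"
  shows "calibrable L 0 a chi" "coherent L 0 a chi"
proof -
  define c where "c = chi / (1 + a)"
  define z where "z x = c + c * x" for x
  have cm: "chi = c * (1 + a)" using a by (simp add: c_def)
  have z0: "z 0 = c" by (simp add: z_def)
  have za: "z a = chi" using cm by (simp add: z_def algebra_simps)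
  have W: "W12_interval 0 a z (\<lambda>x. c)" unfolding z_def[abs_def] using a by (intro W12_interval_affine)
  have sets: "{0, a} - {0, L} = {a}" "{0..a} \<inter> {0, L} = {0}" using a by auto
  have on: "outer_normal 0 = -1" by (simp add: outer_normal_def)
  have le1: "\<bar>z x\<bar> \<le> 1" if "x \<in> {0..a}" for x
  proof -
    have eq: "z x = chi * ((1 + x) / (1 + a))" by (simp add: z_def c_def distrib_left add_divide_distrib)
    have "0 \<le> (1 + x) / (1 + a)" "(1 + x) / (1 + a) \<le> 1" using that a by auto
    then have "\<bar>(1 + x) / (1 + a)\<bar> \<le> 1" by linarith
    then show ?thesis unfolding eq abs_mult chi mult_1 .
  qed
  have ch: "cahn_hoffman L 0 a chi z (\<lambda>x. c)"
    unfolding cahn_hoffman_def sets using W le1 za by auto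
  have int: "(\<integral>x. c \<partial>lebesgue_on {0..a}) = c * a" "(\<integral>x. \<bar>c\<bar>\<^sup>2 \<partial>lebesgue_on {0..a}) = c\<^sup>2 * a"
    using a lebesgue_integral_const_Icc[of 0 a c] lebesgue_integral_const_Icc[of 0 a "\<bar>c\<bar>\<^sup>2"] by simp_all
  have min: "I1_minimizer L 0 a chi z (\<lambda>x. c)"
    unfolding I1_minimizer_def
  proof (intro conjI allI impI ch)
    fix y y' assume "cahn_hoffman L 0 a chi y y'"
    then have Wy: "W12_interval 0 a y y'" and ya: "y a = chi" by (auto simp: cahn_hoffman_def sets)
    have "2 * c * (y a - y 0) - c\<^sup>2 * (a - 0) \<le> (\<integral>x. \<bar>y' x\<bar>\<^sup>2 \<partial>lebesgue_on {0..a})"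
      using a by (intro integral_square_ge[OF Wy])
    moreover have "0 \<le> (y 0 - c)\<^sup>2" by simp
    moreover have "2 * c * (y a - y 0) - c\<^sup>2 * (a - 0) + (y 0)\<^sup>2 - (c\<^sup>2 * a + c\<^sup>2) = (y 0 - c)\<^sup>2"
      unfolding ya cm by (simp add: power2_eq_square algebra_simps)
    ultimately have "c\<^sup>2 * a + c\<^sup>2 \<le> (\<integral>x. \<bar>y' x\<bar>\<^sup>2 \<partial>lebesgue_on {0..a}) + (y 0)\<^sup>2"
      unfolding diff_0_right by linarith
    then show "I1 L 0 a z (\<lambda>x. c) \<le> I1 L 0 a y y'"
      unfolding I1_def sets int by (simp add: on z0)
  qed
  show "calibrable L 0 a chi" unfolding calibrable_def using min by blast
  show "coherent L 0 a chi"
    unfolding coherent_def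
  proof (rule exI[of _ z], rule exI[of _ "\<lambda>x. c"], intro conjI min ballI)
    fix i assume "i \<in> {0..a} \<inter> {0, L}"
    then have "i = 0" unfolding sets by simp
    then show "1 / (a - 0) * (\<integral>x. c \<partial>lebesgue_on {0..a}) + z i * outer_normal i = 0"
      using a unfolding int by (simp add: on z0)
  qed
qed

subsection \<open>The explicit evolution\<close>

text \<open>Here \<open>\<rho>\<close> is the reciprocal speed of \<open>k\<close>. The hypothesis
  says that \<open>s - t\<close> equals \<open>\<rho> t\<close> times the increment of
  \<open>k\<close> up to the oscillation of \<open>\<rho>\<close>, so continuity of
  \<open>\<rho>\<close> alone makes \<open>k\<close> differentiable.\<close>

lemma has_derivative_from_rate:
  fixes k \<rho> :: "real \<Rightarrow> real"
  assumes t: "t \<in> S" and \<rho>: "continuous (at t within S) \<rho>" "\<rho> t \<noteq> 0"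
    and rate: "\<And>s. s \<in> S \<Longrightarrow> \<bar>(s - t) - \<rho> t * (k s - k t)\<bar> \<le> \<bar>\<rho> s - \<rho> t\<bar> * \<bar>k s - k t\<bar>"
  shows "(k has_real_derivative 1 / \<rho> t) (at t within S)"
proof -
  define q where "q s = (k s - k t) / (s - t)" for s
  have lim: "((\<lambda>s. \<rho> s - \<rho> t) \<longlongrightarrow> 0) (at t within S)"
    using \<rho>(1) by (simp add: continuous_within LIM_zero_iff)
  have "((\<lambda>s. q s - 1 / \<rho> t) \<longlongrightarrow> 0) (at t within S)"
  proof (rule Lim_null_comparison)
    have "((\<lambda>s. \<bar>\<rho> s - \<rho> t\<bar> * (2 / \<bar>\<rho> t\<bar>) / \<bar>\<rho> t\<bar>) \<longlongrightarrow> \<bar>0\<bar> * (2 / \<bar>\<rho> t\<bar>) / \<bar>\<rho> t\<bar>) (at t within S)"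
      using \<rho>(2) by (intro tendsto_intros lim) auto
    then show "((\<lambda>s. \<bar>\<rho> s - \<rho> t\<bar> * (2 / \<bar>\<rho> t\<bar>) / \<bar>\<rho> t\<bar>) \<longlongrightarrow> 0) (at t within S)" by simp
    \<comment> \<open>So close to \<open>t\<close> the error is at most half of
      \<open>\<bar>\<rho> t\<bar> * \<bar>q s\<bar>\<close> and can be absorbed; this bounds
      \<open>q s\<close> before its limit is known.\<close>
    have "\<forall>\<^sub>F s in at t within S. dist (\<rho> s - \<rho> t) 0 < \<bar>\<rho> t\<bar> / 2"
      using \<rho>(2) by (intro tendstoD[OF lim]) simp
    moreover have "\<forall>\<^sub>F s in at t within S. s \<in> S \<and> s \<noteq> t" by (simp add: eventually_at_filter)
    ultimately show "\<forall>\<^sub>F s in at t within S. norm (q s - 1 / \<rho> t) \<le> \<bar>\<rho> s - \<rho> t\<bar> * (2 / \<bar>\<rho> t\<bar>) / \<bar>\<rho> t\<bar>"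
    proof eventually_elim
      case (elim s)
      have st: "\<bar>s - t\<bar> > 0" using elim by simp
      have kq: "k s - k t = q s * (s - t)" using elim by (simp add: q_def)
      have "\<bar>s - t\<bar> * \<bar>1 - \<rho> t * q s\<bar> = \<bar>(s - t) - \<rho> t * (k s - k t)\<bar>"
        unfolding abs_mult[symmetric] kq by (simp add: algebra_simps)
      also have "\<dots> \<le> \<bar>\<rho> s - \<rho> t\<bar> * \<bar>k s - k t\<bar>" using rate elim by simp
      also have "\<dots> = \<bar>s - t\<bar> * (\<bar>\<rho> s - \<rho> t\<bar> * \<bar>q s\<bar>)" by (simp add: kq abs_mult)
      finally have 1: "\<bar>1 - \<rho> t * q s\<bar> \<le> \<bar>\<rho> s - \<rho> t\<bar> * \<bar>q s\<bar>" using st by simp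
      also have "\<dots> \<le> \<bar>\<rho> t\<bar> / 2 * \<bar>q s\<bar>" using elim by (intro mult_right_mono) auto
      finally have "\<bar>\<rho> t * q s\<bar> - 1 \<le> \<bar>\<rho> t\<bar> / 2 * \<bar>q s\<bar>" by linarith
      then have "\<bar>\<rho> t\<bar> * \<bar>q s\<bar> \<le> 2" by (simp add: abs_mult)
      then have 2: "\<bar>q s\<bar> \<le> 2 / \<bar>\<rho> t\<bar>" using \<rho>(2) by (simp add: pos_le_divide_eq mult.commute)
      have "norm (q s - 1 / \<rho> t) = \<bar>1 - \<rho> t * q s\<bar> / \<bar>\<rho> t\<bar>"
        using \<rho>(2) by (simp add: abs_divide[symmetric] diff_divide_distrib abs_minus_commute)
      also have "\<dots> \<le> \<bar>\<rho> s - \<rho> t\<bar> * (2 / \<bar>\<rho> t\<bar>) / \<bar>\<rho> t\<bar>"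
        using 1 2 by (intro divide_right_mono order_trans[OF 1] mult_left_mono) auto
      finally show ?case .
    qed
  qed
  then have "(q \<longlongrightarrow> 1 / \<rho> t) (at t within S)" by (rule LIM_zero_cancel)
  then show ?thesis by (simp add: has_field_derivative_iff q_def[abs_def])
qed

lemma has_trace_continuous:
  assumes f: "continuous_on {0..L} f" and L: "L > 0"
  shows "has_trace L f 0 (f 0)" "has_trace L f L (f L)"
proof -
  have int: "integrable (lebesgue_on {0<..<L}) f"
    using f by (intro integral_Icc_eq_Ioo continuous_imp_integrable_real)
  have ev: "\<forall>\<^sub>F r in at_right 0. 0 < r \<and> r < L" unfolding eventually_at_right_field using L by blast
  have "((\<lambda>r. integral {0..r} f / (r - 0)) \<longlongrightarrow> f 0) (at_right 0)"
    using L ev by (intro average_tendsto[OF f]) (auto elim!: eventually_mono)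
  then show "has_trace L f 0 (f 0)" using has_trace_left_iff[OF int L] by simp
  have "((\<lambda>r. L - r) \<longlongrightarrow> L - 0) (at_right 0)" by (intro tendsto_intros)
  then have "((\<lambda>r. integral {L - r..L} f / (L - (L - r))) \<longlongrightarrow> f L) (at_right 0)"
    using L ev by (intro average_tendsto[OF f]) (auto elim!: eventually_mono)
  then show "has_trace L f L (f L)" using has_trace_right_iff[OF int L] by simp
qed

text \<open>Meant for the velocity, which jumps at the facet ends but is constant near the
  boundary.\<close>

lemma has_trace_constant_near:
  assumes int: "integrable (lebesgue_on {0<..<L}) f" and d: "0 < d" "d \<le> L"
  shows "(\<And>x. x \<in> {0..d} \<Longrightarrow> f x = c) \<Longrightarrow> has_trace L f 0 c"
    "(\<And>x. x \<in> {L - d..L} \<Longrightarrow> f x = c) \<Longrightarrow> has_trace L f L c"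
proof -
  have L: "L > 0" using d by simp
  have ev: "\<forall>\<^sub>F r in at_right 0. 0 < r \<and> r < d" unfolding eventually_at_right_field using d by blast
  show "has_trace L f 0 c" if c: "\<And>x. x \<in> {0..d} \<Longrightarrow> f x = c"
    unfolding has_trace_left_iff[OF int L]
  proof (rule tendsto_eventually, use ev in eventually_elim)
    case (elim r)
    have "integral {0..r} f = integral {0..r} (\<lambda>x. c)" using elim c by (intro integral_cong) auto
    then show ?case using elim by simp
  qed
  show "has_trace L f L c" if c: "\<And>x. x \<in> {L - d..L} \<Longrightarrow> f x = c"
    unfolding has_trace_right_iff[OF int L]
  proof (rule tendsto_eventually, use ev in eventually_elim)
    case (elim r)
    have "integral {L - r..L} f = integral {L - r..L} (\<lambda>x. c)" using elim c by (intro integral_cong) auto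
    then show ?case using elim by simp
  qed
qed

lemma has_trace_cong_AE:
  assumes f: "f \<in> borel_measurable (lebesgue_on {0<..<L})" and g: "g \<in> borel_measurable (lebesgue_on {0<..<L})"
    and eq: "AE x in lebesgue_on {0<..<L}. f x = g x" and tr: "has_trace L g i c"
  shows "has_trace L f i c"
proof -
  have "(\<integral>x. f x \<partial>lebesgue_on ({0<..<L} \<inter> ball i r)) = (\<integral>x. g x \<partial>lebesgue_on ({0<..<L} \<inter> ball i r))" for r
  proof (rule integral_cong_AE)
    show "f \<in> borel_measurable (lebesgue_on ({0<..<L} \<inter> ball i r))"
      using f by (rule measurable_restrict_mono) simp
    show "g \<in> borel_measurable (lebesgue_on ({0<..<L} \<inter> ball i r))"
      using g by (rule measurable_restrict_mono) simp
    have "AE x in lebesgue. x \<in> {0<..<L} \<longrightarrow> f x = g x"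
      using eq by (subst (asm) AE_restrict_space_iff) auto
    then have "AE x in lebesgue. x \<in> {0<..<L} \<inter> ball i r \<longrightarrow> f x = g x"
      by eventually_elim simp
    then show "AE x in lebesgue_on ({0<..<L} \<inter> ball i r). f x = g x"
      by (subst AE_restrict_space_iff) auto
  qed
  then show ?thesis using tr by (simp add: has_trace_def)
qed

section \<open>Arrival times and the positions of the facet ends\<close>

locale facet_flow =
  fixes L b0 chi :: real and w0 :: "real \<Rightarrow> real"
  assumes b0: "0 < b0" "b0 < L" and chi: "\<bar>chi\<bar> = 1"
    and w0_cont: "continuous_on {0..L} w0" and w0_mono: "mono_on {0..L} w0"
    and w0_strict: "strict_mono_on {0..b0} w0" and w0_flat: "\<And>x. x \<in> {b0..L} \<Longrightarrow> w0 x = w0 b0"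
begin

lemma chi_square: "chi * chi = 1" "chi\<^sup>2 = 1" "chi * (chi * x) = x"
proof -
  have "chi = 1 \<or> chi = -1" using chi by (auto simp: abs_if split: if_splits)
  then show "chi * chi = 1" "chi\<^sup>2 = 1" "chi * (chi * x) = x" by auto
qed

lemma w0_le: "0 \<le> x \<Longrightarrow> x \<le> y \<Longrightarrow> y \<le> L \<Longrightarrow> w0 x \<le> w0 y"
  using w0_mono by (auto simp: mono_on_def)

lemma w0_less: "0 \<le> x \<Longrightarrow> x < y \<Longrightarrow> y \<le> b0 \<Longrightarrow> w0 x < w0 y"
  using w0_strict by (auto simp: strict_mono_on_def)

text \<open>\<open>A x = \<integral>\<^sub>0\<^sup>x (1 + s) dw\<^sub>0(s)\<close> and \<open>B x = \<integral>\<^sub>x\<^sup>b\<^sup>0 (1 + L - s) dw\<^sub>0(s)\<close> (Stieltjes integrals, integrated by parts)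
  are the times at which the left and the right facet reach the point \<open>x\<close>.\<close>

definition A :: "real \<Rightarrow> real" where
  "A x = (1 + x) * w0 x - w0 0 - integral {0..x} w0"

text \<open>A primitive: formally \<open>dC = (1 + L - x) dw0\<close>, since the
  \<open>w0 dx\<close> terms cancel. \<open>B\<close> is its decrease, normalised to vanish at
  \<open>b0\<close>.\<close>

definition C :: "real \<Rightarrow> real" where
  "C x = (1 + L - x) * w0 x + integral {0..x} w0"

definition B :: "real \<Rightarrow> real" where
  "B x = C b0 - C x"

lemma integral_w0_bounds:
  assumes "0 \<le> x" "x \<le> y" "y \<le> L"
  shows "w0 x * (y - x) \<le> integral {0..y} w0 - integral {0..x} w0"
    "integral {0..y} w0 - integral {0..x} w0 \<le> w0 y * (y - x)"
proof -
  have ion: "w0 integrable_on {p..q}" if "0 \<le> p" "q \<le> L" for p q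
    using that by (intro integrable_continuous_interval continuous_on_subset[OF w0_cont]) auto
  have eq: "integral {0..y} w0 - integral {0..x} w0 = integral {x..y} w0"
    using Henstock_Kurzweil_Integration.integral_combine[of 0 x y w0] assms ion[of 0 y] by simp
  have "integral {x..y} (\<lambda>s. w0 x) \<le> integral {x..y} w0"
    using assms w0_le by (intro integral_le ion) auto
  then show "w0 x * (y - x) \<le> integral {0..y} w0 - integral {0..x} w0"
    using assms unfolding eq by (simp add: mult.commute)
  have "integral {x..y} w0 \<le> integral {x..y} (\<lambda>s. w0 y)"
    using assms w0_le by (intro integral_le ion) auto
  then show "integral {0..y} w0 - integral {0..x} w0 \<le> w0 y * (y - x)"
    using assms unfolding eq by (simp add: mult.commute)
qed

text \<open>The weight \<open>1 + s\<close> is increasing and \<open>dw0\<close> is nonnegative, so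
  an increment of \<open>A\<close> lies between the endpoint weights times the increment of
  \<open>w0\<close>. The speed of the left facet is derived from this pair of inequalities.\<close>

lemma A_bounds:
  assumes "0 \<le> x" "x \<le> y" "y \<le> L"
  shows "(1 + x) * (w0 y - w0 x) \<le> A y - A x" "A y - A x \<le> (1 + y) * (w0 y - w0 x)"
  using integral_w0_bounds[OF assms] by (simp_all add: A_def algebra_simps)

lemma B_bounds:
  assumes "0 \<le> x" "x \<le> y" "y \<le> L"
  shows "(1 + L - y) * (w0 y - w0 x) \<le> B x - B y" "B x - B y \<le> (1 + L - x) * (w0 y - w0 x)"
  using integral_w0_bounds[OF assms] by (simp_all add: B_def C_def algebra_simps)

lemma A_less: "0 \<le> x \<Longrightarrow> x < y \<Longrightarrow> y \<le> b0 \<Longrightarrow> A x < A y"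
proof -
  assume xy: "0 \<le> x" "x < y" "y \<le> b0"
  then have "0 < (1 + x) * (w0 y - w0 x)" using w0_less by simp
  then show ?thesis using A_bounds(1)[of x y] xy b0 by simp
qed

lemma B_less: "0 \<le> x \<Longrightarrow> x < y \<Longrightarrow> y \<le> b0 \<Longrightarrow> B y < B x"
proof -
  assume xy: "0 \<le> x" "x < y" "y \<le> b0"
  then have "0 < (1 + L - y) * (w0 y - w0 x)" using w0_less b0 by simp
  then show ?thesis using B_bounds(1)[of x y] xy b0 by simp
qed

lemma AB_cont: "continuous_on {0..L} A" "continuous_on {0..L} B"
proof -
  have "continuous_on {0..L} (\<lambda>x. integral {0..x} w0)"
    by (intro indefinite_integral_continuous_1 integrable_continuous_interval w0_cont)
  then show "continuous_on {0..L} A" "continuous_on {0..L} B"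
    unfolding A_def[abs_def] B_def[abs_def] C_def[abs_def] by (intro continuous_intros w0_cont; assumption)+
qed

lemma A_0: "A 0 = 0" and B_b0: "B b0 = 0" by (simp_all add: A_def B_def)

text \<open>The point where the facets meet: on \<open>{0..b0}\<close> the function \<open>A\<close>
  increases strictly from 0 and \<open>B\<close> decreases strictly to 0, so they agree at exactly
  one interior point, which \<open>SOME\<close> picks.\<close>

definition xc :: real where "xc = (SOME x. 0 < x \<and> x < b0 \<and> A x = B x)"

definition T :: real where "T = A xc"

lemma xc: "0 < xc" "xc < b0" "A xc = B xc"
proof -
  have "continuous_on {0..b0} (\<lambda>x. A x - B x)"
    using b0 by (intro continuous_intros continuous_on_subset[OF AB_cont(1)] continuous_on_subset[OF AB_cont(2)]) auto
  moreover have "A 0 - B 0 < 0" "0 < A b0 - B b0"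
    using A_less[of 0 b0] B_less[of 0 b0] b0 A_0 B_b0 by auto
  ultimately obtain x where x: "0 \<le> x" "x \<le> b0" "A x - B x = 0"
    using IVT'[of "\<lambda>x. A x - B x" 0 0 b0] b0 by auto
  moreover have "x \<noteq> 0" "x \<noteq> b0" using x(3) \<open>A 0 - B 0 < 0\<close> \<open>0 < A b0 - B b0\<close> by auto
  ultimately have "0 < x \<and> x < b0 \<and> A x = B x" by simp
  then have "0 < xc \<and> xc < b0 \<and> A xc = B xc" unfolding xc_def by (rule someI)
  then show "0 < xc" "xc < b0" "A xc = B xc" by simp_all
qed

lemma T_pos: "T > 0"
  using A_less[of 0 xc] xc A_0 by (simp add: T_def)

text \<open>Clamping the time to \<open>[0, T]\<close> makes the evolution Lipschitz on the whole time axis and stationary after \<open>T\<close>.\<close>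

definition clock :: "real \<Rightarrow> real" where "clock t = max 0 (min t T)"

text \<open>The inverse is taken on \<open>{0..xc}\<close> because \<open>A\<close> maps this
  interval onto \<open>{0..T}\<close>, the range of the clock.\<close>

definition a :: "real \<Rightarrow> real" where "a t = inv_into {0..xc} A (clock t)"

definition b :: "real \<Rightarrow> real" where "b t = inv_into {xc..b0} B (clock t)"

lemma clock: "0 \<le> clock t" "clock t \<le> T" "0 \<le> t \<Longrightarrow> t \<le> T \<Longrightarrow> clock t = t" "T \<le> t \<Longrightarrow> clock t = T"
  using T_pos by (auto simp: clock_def)

lemma A_image: "A ` {0..xc} = {0..T}"
proof
  have le: "A x \<le> A y" if "0 \<le> x" "x \<le> y" "y \<le> b0" for x y
    using A_less[of x y] that by (cases "x = y") auto
  show "A ` {0..xc} \<subseteq> {0..T}"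
    using le[of 0] le[of _ xc] xc A_0 by (force simp: T_def)
  show "{0..T} \<subseteq> A ` {0..xc}"
  proof
    fix y assume "y \<in> {0..T}"
    moreover have "continuous_on {0..xc} A" using xc b0 by (intro continuous_on_subset[OF AB_cont(1)]) auto
    ultimately show "y \<in> A ` {0..xc}" using IVT'[of A 0 y xc] xc A_0 by (auto simp: T_def)
  qed
qed

lemma B_image: "B ` {xc..b0} = {0..T}"
proof
  have le: "B y \<le> B x" if "0 \<le> x" "x \<le> y" "y \<le> b0" for x y
    using B_less[of x y] that by (cases "x = y") auto
  show "B ` {xc..b0} \<subseteq> {0..T}"
    using le[of xc] le[of _ b0] xc B_b0 by (force simp: T_def)
  show "{0..T} \<subseteq> B ` {xc..b0}"
  proof
    fix y assume "y \<in> {0..T}"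
    moreover have "continuous_on {xc..b0} B" using xc b0 by (intro continuous_on_subset[OF AB_cont(2)]) auto
    ultimately show "y \<in> B ` {xc..b0}" using IVT2'[of B b0 y xc] xc B_b0 by (auto simp: T_def)
  qed
qed

lemma a: "a t \<in> {0..xc}" "A (a t) = clock t"
proof -
  have "clock t \<in> A ` {0..xc}" unfolding A_image using clock by simp
  then show "a t \<in> {0..xc}" "A (a t) = clock t"
    unfolding a_def by (rule inv_into_into, rule f_inv_into_f)
qed

lemma b: "b t \<in> {xc..b0}" "B (b t) = clock t"
proof -
  have "clock t \<in> B ` {xc..b0}" unfolding B_image using clock by simp
  then show "b t \<in> {xc..b0}" "B (b t) = clock t"
    unfolding b_def by (rule inv_into_into, rule f_inv_into_f)
qed

lemma a_b_bounds: "0 \<le> a t" "a t \<le> xc" "xc \<le> b t" "b t \<le> b0" "a t \<le> b t" "b t < L" "a t < L" "a t \<le> b0" "0 < b t"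
  using a(1)[of t] b(1)[of t] xc b0 by auto

lemma a_eqI: "0 \<le> x \<Longrightarrow> x \<le> b0 \<Longrightarrow> A x = clock t \<Longrightarrow> a t = x"
  using A_less[of x "a t"] A_less[of "a t" x] a[of t] a_b_bounds[of t] by (metis less_irrefl linorder_neqE_linordered_idom)

lemma b_eqI: "0 \<le> x \<Longrightarrow> x \<le> b0 \<Longrightarrow> B x = clock t \<Longrightarrow> b t = x"
  using B_less[of x "b t"] B_less[of "b t" x] b[of t] a_b_bounds[of t] by (metis less_irrefl linorder_neqE_linordered_idom less_imp_le)

lemma a_0: "a 0 = 0" and b_0: "b 0 = b0"
  using a_eqI[of 0 0] b_eqI[of b0 0] A_0 B_b0 b0 clock(3)[of 0] T_pos by auto

lemma a_T: "T \<le> t \<Longrightarrow> a t = xc" and b_T: "T \<le> t \<Longrightarrow> b t = xc"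
  using a_eqI[of xc t] b_eqI[of xc t] xc clock(4)[of t] by (auto simp: T_def)

lemma clock_mono: "s \<le> t \<Longrightarrow> clock s \<le> clock t"
  by (auto simp: clock_def)

lemma a_mono: "s \<le> t \<Longrightarrow> a s \<le> a t"
proof (rule ccontr)
  assume "s \<le> t" "\<not> a s \<le> a t"
  then have "A (a t) < A (a s)" using A_less[of "a t" "a s"] a_b_bounds by simp
  then show False using a(2) clock_mono[OF \<open>s \<le> t\<close>] by simp
qed

lemma b_mono: "s \<le> t \<Longrightarrow> b t \<le> b s"
proof (rule ccontr)
  assume "s \<le> t" "\<not> b t \<le> b s"
  then have "B (b t) < B (b s)" using B_less[of "b s" "b t"] a_b_bounds[of s] a_b_bounds[of t] by simp
  then show False using b(2) clock_mono[OF \<open>s \<le> t\<close>] by simp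
qed

text \<open>Each end is compared with \<open>xc\<close>, not with the other end: reaching
  \<open>xc\<close> would force the clock to show \<open>T\<close>.\<close>

lemma a_less_b: "t < T \<Longrightarrow> a t < xc" "t < T \<Longrightarrow> xc < b t"
proof -
  assume "t < T"
  then have c: "clock t < T" using T_pos by (simp add: clock_def)
  have "a t \<noteq> xc" using a(2)[of t] c by (auto simp: T_def)
  then show "a t < xc" using a_b_bounds[of t] by simp
  have "b t \<noteq> xc" using b(2)[of t] c xc by (auto simp: T_def)
  then show "xc < b t" using a_b_bounds[of t] by simp
qed

lemma a_pos: "0 < t \<Longrightarrow> 0 < a t"
proof -
  assume "0 < t"
  then have "clock t \<noteq> 0" using T_pos by (auto simp: clock_def)
  then have "a t \<noteq> 0" using a(2)[of t] A_0 by auto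
  then show ?thesis using a_b_bounds[of t] by simp
qed

text \<open>A continuous injection on a compact interval has a continuous inverse; composing with
  the clock extends this to all times.\<close>

lemma a_cont: "continuous_on UNIV a" and b_cont: "continuous_on UNIV b"
proof -
  have cl: "continuous_on UNIV clock" unfolding clock_def[abs_def] by (intro continuous_intros)
  have im: "clock ` UNIV \<subseteq> {0..T}" using clock by auto
  have "inj_on A {0..xc}"
    using A_less xc by (intro linorder_inj_onI) force+
  moreover have "continuous_on {0..xc} A" using xc b0 by (intro continuous_on_subset[OF AB_cont(1)]) auto
  ultimately have "continuous_on {0..T} (inv_into {0..xc} A)"
    using continuous_on_inv[of "{0..xc}" A "inv_into {0..xc} A"] A_image by (simp add: inv_into_f_f)
  then show "continuous_on UNIV a" unfolding a_def[abs_def] by (rule continuous_on_compose2[OF _ cl im])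
  have "inj_on B {xc..b0}"
  proof (intro linorder_inj_onI)
    fix x y assume "x < y" "x \<in> {xc..b0}" "y \<in> {xc..b0}"
    then show "B x \<noteq> B y" using B_less[of x y] xc by auto
  qed auto
  moreover have "continuous_on {xc..b0} B" using xc b0 by (intro continuous_on_subset[OF AB_cont(2)]) auto
  ultimately have "continuous_on {0..T} (inv_into {xc..b0} B)"
    using continuous_on_inv[of "{xc..b0}" B "inv_into {xc..b0} B"] B_image by (simp add: inv_into_f_f)
  then show "continuous_on UNIV b" unfolding b_def[abs_def] by (rule continuous_on_compose2[OF _ cl im])
qed

section \<open>Heights of the left facet (\<open>k\<close>) and the right facet (\<open>m\<close>),
  up to the factor \<open>chi\<close>\<close>

definition k :: "real \<Rightarrow> real" where "k t = w0 (a t)"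

definition m :: "real \<Rightarrow> real" where "m t = w0 (b t)"

text \<open>Difference form of \<open>dk/dt = 1 / (1 + a)\<close>: \<open>A_bounds\<close> between
  \<open>a s\<close> and \<open>a t\<close>, where \<open>A\<close> returns the clock.\<close>

lemma k_rate:
  assumes "s \<le> t"
  shows "(1 + a s) * (k t - k s) \<le> clock t - clock s" "clock t - clock s \<le> (1 + a t) * (k t - k s)" "k s \<le> k t"
  using A_bounds[of "a s" "a t"] a_b_bounds[of s] a_b_bounds[of t] a_mono[OF assms] a(2) w0_le[of "a s" "a t"]
  by (simp_all add: k_def)

lemma m_rate:
  assumes "s \<le> t"
  shows "(1 + L - b s) * (m s - m t) \<le> clock t - clock s" "clock t - clock s \<le> (1 + L - b t) * (m s - m t)" "m t \<le> m s"
  using B_bounds[of "b t" "b s"] a_b_bounds[of s] a_b_bounds[of t] b_mono[OF assms] b(2) w0_le[of "b t" "b s"]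
  by (simp_all add: m_def)

lemma clock_lipschitz: "\<bar>clock s - clock t\<bar> \<le> \<bar>s - t\<bar>"
  by (auto simp: clock_def max_def min_def)

text \<open>Both weights are at least 1, so the heights change no faster than the clock, which is
  itself 1-Lipschitz.\<close>

lemma k_lipschitz: "\<bar>k s - k t\<bar> \<le> \<bar>s - t\<bar>" and m_lipschitz: "\<bar>m s - m t\<bar> \<le> \<bar>s - t\<bar>"
proof -
  have *: "\<bar>k s - k t\<bar> \<le> \<bar>s - t\<bar> \<and> \<bar>m s - m t\<bar> \<le> \<bar>s - t\<bar>" if "s \<le> t" for s t
  proof -
    note kr = k_rate[OF that] and mr = m_rate[OF that]
    have "1 * (k t - k s) \<le> (1 + a s) * (k t - k s)"
      using kr a_b_bounds[of s] by (intro mult_right_mono) auto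
    moreover have "1 * (m s - m t) \<le> (1 + L - b s) * (m s - m t)"
      using mr a_b_bounds[of s] by (intro mult_right_mono) auto
    ultimately show ?thesis using kr mr clock_lipschitz[of t s] clock_mono[OF that] that by auto
  qed
  show "\<bar>k s - k t\<bar> \<le> \<bar>s - t\<bar>" "\<bar>m s - m t\<bar> \<le> \<bar>s - t\<bar>"
    using *[of s t] *[of t s] by (cases "s \<le> t"; force simp: abs_minus_commute)+
qed

lemma k_derivative:
  assumes t: "t \<in> {0..T}"
  shows "(k has_real_derivative 1 / (1 + a t)) (at t within {0..T})"
proof (rule has_derivative_from_rate[where \<rho> = "\<lambda>t. 1 + a t"])
  have "continuous_on {0..T} a" using a_cont by (rule continuous_on_subset) simp
  then show "continuous (at t within {0..T}) (\<lambda>t. 1 + a t)"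
    using t by (intro continuous_intros) (simp add: continuous_on_eq_continuous_within)
  show "1 + a t \<noteq> 0" using a_b_bounds(1)[of t] by simp
  fix s assume s: "s \<in> {0..T}"
  have c: "clock s = s" "clock t = t" using s t clock by auto
  show "\<bar>s - t - (1 + a t) * (k s - k t)\<bar> \<le> \<bar>1 + a s - (1 + a t)\<bar> * \<bar>k s - k t\<bar>"
  proof (cases "s \<le> t")
    case True
    note r = k_rate[OF this] and am = a_mono[OF this]
    \<comment> \<open>The two bounds in \<open>k_rate\<close> differ by exactly this product, which
      is the error that \<open>has_derivative_from_rate\<close> admits.\<close>
    have "\<bar>1 + a s - (1 + a t)\<bar> * \<bar>k s - k t\<bar> = (a t - a s) * (k t - k s)" using r(3) am by simp
    then show ?thesis using r am unfolding c by (simp add: algebra_simps abs_le_iff)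
  next
    case False
    then have "t \<le> s" by simp
    note r = k_rate[OF this] and am = a_mono[OF this]
    have "\<bar>1 + a s - (1 + a t)\<bar> * \<bar>k s - k t\<bar> = (a s - a t) * (k s - k t)" using r(3) am by simp
    then show ?thesis using r am unfolding c by (simp add: algebra_simps abs_le_iff)
  qed
qed (use t in auto)

lemma m_derivative:
  assumes t: "t \<in> {0..T}"
  shows "(m has_real_derivative - 1 / (1 + L - b t)) (at t within {0..T})"
proof -
  \<comment> \<open>The height \<open>m\<close> decreases, so its reciprocal speed carries the
    negative sign.\<close>
  have "(m has_real_derivative 1 / (- (1 + L - b t))) (at t within {0..T})"
  proof (rule has_derivative_from_rate[where \<rho> = "\<lambda>t. - (1 + L - b t)"])
    have "continuous_on {0..T} b" using b_cont by (rule continuous_on_subset) simp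
    then show "continuous (at t within {0..T}) (\<lambda>t. - (1 + L - b t))"
      using t by (intro continuous_intros) (simp add: continuous_on_eq_continuous_within)
    show "- (1 + L - b t) \<noteq> 0" using a_b_bounds(6)[of t] by simp
    fix s assume s: "s \<in> {0..T}"
    have c: "clock s = s" "clock t = t" using s t clock by auto
    show "\<bar>s - t - - (1 + L - b t) * (m s - m t)\<bar> \<le> \<bar>- (1 + L - b s) - - (1 + L - b t)\<bar> * \<bar>m s - m t\<bar>"
    proof (cases "s \<le> t")
      case True
      note r = m_rate[OF this] and bm = b_mono[OF this]
      have "\<bar>- (1 + L - b s) - - (1 + L - b t)\<bar> * \<bar>m s - m t\<bar> = (b s - b t) * (m s - m t)" using r(3) bm by simp
      then show ?thesis using r bm unfolding c by (simp add: algebra_simps abs_le_iff)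
    next
      case False
      then have "t \<le> s" by simp
      note r = m_rate[OF this] and bm = b_mono[OF this]
      have "\<bar>- (1 + L - b s) - - (1 + L - b t)\<bar> * \<bar>m s - m t\<bar> = (b t - b s) * (m t - m s)" using r(3) bm by simp
      then show ?thesis using r bm unfolding c by (simp add: algebra_simps abs_le_iff)
    qed
  qed (use t in auto)
  then show ?thesis by (simp only: divide_minus_right divide_minus_left)
qed

section \<open>The profile at time \<open>t\<close> and its velocity\<close>

text \<open>Clamping \<open>w0\<close> between the two heights gives the three-piece formula on
  \<open>{0..L}\<close>, while continuity, monotonicity and the Lipschitz bound in time are
  inherited directly from \<open>k\<close>, \<open>m\<close> and \<open>w0\<close>.\<close>

definition w :: "real \<Rightarrow> real \<Rightarrow> real" where "w t x = max (k t) (min (m t) (w0 x))"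

text \<open>This is the right derivative, which decides the values at the ends: the facets grow, so
  the points \<open>a t\<close> and \<open>b t\<close> already move with their facets.\<close>

definition rate :: "real \<Rightarrow> real \<Rightarrow> real" where
  "rate t x = (if t < T then if x \<le> a t then 1 / (1 + a t) else if x < b t then 0 else - 1 / (1 + L - b t) else 0)"

lemma k_le_m: "k t \<le> m t"
  using a_b_bounds[of t] by (simp add: k_def m_def w0_le)

lemma w_left: "0 \<le> x \<Longrightarrow> x \<le> a t \<Longrightarrow> w t x = k t"
  using w0_le[of x "a t"] a_b_bounds[of t] k_le_m[of t] by (auto simp: w_def k_def)

lemma w_right: "b t \<le> x \<Longrightarrow> x \<le> L \<Longrightarrow> w t x = m t"
  using w0_le[of "b t" x] a_b_bounds[of t] k_le_m[of t] by (auto simp: w_def m_def)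

lemma w_middle: "a t \<le> x \<Longrightarrow> x \<le> b t \<Longrightarrow> w t x = w0 x"
  using w0_le[of "a t" x] w0_le[of x "b t"] a_b_bounds[of t] by (auto simp: w_def m_def k_def)

lemma w_initial: "x \<in> {0..L} \<Longrightarrow> w 0 x = w0 x"
  using w_middle[of 0 x] w_right[of 0 x] w0_flat[of x] a_0 b_0 by (cases "x \<le> b0") (auto simp: m_def)

lemma w_const: "T \<le> t \<Longrightarrow> w t x = w0 xc"
  by (simp add: w_def k_def m_def a_T b_T)

lemma w_cont: "continuous_on {0..L} (w t)"
  unfolding w_def[abs_def] by (intro continuous_intros w0_cont)

lemma w_mono: "mono_on {0..L} (w t)"
  using w0_le by (auto simp: mono_on_def w_def max_def min_def) (meson order_trans le_cases)+

lemma w_lipschitz: "\<bar>w s x - w t x\<bar> \<le> \<bar>s - t\<bar>"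
proof -
  have "\<bar>max p (min q y) - max p' (min q' y)\<bar> \<le> max \<bar>p - p'\<bar> \<bar>q - q'\<bar>" for p p' q q' y :: real
    by (auto simp: max_def min_def)
  from order_trans[OF this] show ?thesis unfolding w_def using k_lipschitz[of s t] m_lipschitz[of s t] by simp
qed

lemma rate_bound: "\<bar>rate t x\<bar> \<le> 1"
  using a_b_bounds[of t] by (auto simp: rate_def)

text \<open>By continuity of \<open>a\<close> and \<open>b\<close>, a point strictly between the
  facets stays there for all times near \<open>t\<close>, where the profile is still
  \<open>w0\<close>.\<close>

lemma w_derivative_middle:
  assumes "a t < x" "x < b t"
  shows "((\<lambda>s. w s x) has_real_derivative 0) (at t)"
proof -
  have "open {s. a s < x}" "open {s. x < b s}"
    using a_cont b_cont by (auto intro!: open_Collect_less continuous_intros)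
  then have op: "open ({s. a s < x} \<inter> {s. x < b s})" by (rule open_Int)
  have "((\<lambda>s. w0 x) has_real_derivative 0) (at t)" by simp
  then show ?thesis
    by (rule has_field_derivative_transform_within_open[OF _ op]) (use assms w_middle in auto)
qed

text \<open>A point covered by a facet remains covered at later times, by monotonicity of
  \<open>a\<close> and \<open>b\<close>; hence the facet ends can be included.\<close>

lemma w_derivative_right:
  assumes t: "0 \<le> t" and x: "x \<in> {0..L}"
  shows "((\<lambda>s. w s x) has_real_derivative rate t x) (at_right t)"
proof (cases "t < T")
  case False
  have "((\<lambda>s. w0 xc) has_real_derivative 0) (at_right t)" by simp
  then have "((\<lambda>s. w s x) has_real_derivative 0) (at t within {t..})"
  proof (rule_tac has_field_derivative_transform_within[of "\<lambda>s. w0 xc" 0 t "{t..}" 1])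
    show "((\<lambda>s. w0 xc) has_real_derivative 0) (at t within {t..})" by simp
  qed (use False w_const in auto)
  then show ?thesis using False by (auto simp: rate_def intro: has_field_derivative_subset)
next
  case True
  have tT: "t \<in> {0..T}" using t True by simp
  have within: "at_right t = at t within {t..T}" using True by (simp add: at_within_Icc_at_right)
  consider "x \<le> a t" | "b t \<le> x" | "a t < x" "x < b t" by linarith
  then show ?thesis
  proof cases
    case 1
    have "(k has_real_derivative 1 / (1 + a t)) (at t within {t..T})"
      using k_derivative[OF tT] t by (rule_tac has_field_derivative_subset) auto
    then have "((\<lambda>s. w s x) has_real_derivative 1 / (1 + a t)) (at t within {t..T})"
    proof (rule has_field_derivative_transform_within[of _ _ _ _ 1])
      show "k s = w s x" if "s \<in> {t..T}" for s
        using w_left[of x s] x 1 a_mono[of t s] that by auto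
    qed (use True in auto)
    then show ?thesis using 1 True by (simp add: rate_def within)
  next
    case 2
    have ab: "a t < b t" using a_less_b[OF True] by simp
    have "(m has_real_derivative - 1 / (1 + L - b t)) (at t within {t..T})"
      using m_derivative[OF tT] t by (rule_tac has_field_derivative_subset) auto
    then have "((\<lambda>s. w s x) has_real_derivative - 1 / (1 + L - b t)) (at t within {t..T})"
    proof (rule has_field_derivative_transform_within[of _ _ _ _ 1])
      show "m s = w s x" if "s \<in> {t..T}" for s
        using w_right[of s x] x 2 b_mono[of t s] that by auto
    qed (use True in auto)
    then show ?thesis using 2 True ab by (simp add: rate_def within)
  next
    case 3
    then have "((\<lambda>s. w s x) has_real_derivative 0) (at t)" by (rule w_derivative_middle)
    then show ?thesis using 3 True by (auto simp: rate_def intro: has_field_derivative_at_within)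
  qed
qed

text \<open>At the facet ends and at the stopping time the one-sided derivatives need not agree, so
  these are left out; they form null sets in space and in time.\<close>

lemma w_derivative:
  assumes t: "0 < t" "t \<noteq> T" and x: "x \<in> {0..L}" "x \<noteq> a t" "x \<noteq> b t"
  shows "((\<lambda>s. w s x) has_real_derivative rate t x) (at t)"
proof (cases "t < T")
  case False
  have "((\<lambda>s. w0 xc) has_real_derivative 0) (at t)" by simp
  then have "((\<lambda>s. w s x) has_real_derivative 0) (at t)"
    by (rule has_field_derivative_transform_within_open[of _ _ _ "{T<..}"]) (use False t w_const in auto)
  then show ?thesis using False by (simp add: rate_def)
next
  case True
  have tT: "t \<in> {0..T}" using t True by simp
  have at: "at t within {0..T} = at t" using t True by (intro at_within_interior) simp
  have ab: "a t < b t" using a_less_b[OF True] by simp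
  consider "x < a t" | "b t < x" | "a t < x" "x < b t" using x by linarith
  then show ?thesis
  proof cases
    case 1
    have op: "open {s. x < a s}" using a_cont by (intro open_Collect_less continuous_intros)
    have "((\<lambda>s. w s x) has_real_derivative 1 / (1 + a t)) (at t)"
      by (rule has_field_derivative_transform_within_open[OF k_derivative[OF tT, unfolded at] op])
        (use 1 x w_left in auto)
    then show ?thesis using 1 True by (simp add: rate_def)
  next
    case 2
    have op: "open {s. b s < x}" using b_cont by (intro open_Collect_less continuous_intros)
    have "((\<lambda>s. w s x) has_real_derivative - 1 / (1 + L - b t)) (at t)"
      by (rule has_field_derivative_transform_within_open[OF m_derivative[OF tT, unfolded at] op])
        (use 2 x w_right in auto)
    then show ?thesis using 2 True ab by (simp add: rate_def)
  next
    case 3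
    then have "((\<lambda>s. w s x) has_real_derivative 0) (at t)" by (rule w_derivative_middle)
    then show ?thesis using 3 True by (auto simp: rate_def)
  qed
qed

lemma w_measurable: "w t \<in> borel_measurable (lebesgue_on {0<..<L})"
  by (intro continuous_imp_measurable_on_sets_lebesgue continuous_on_subset[OF w_cont]) auto

lemma rate_measurable: "rate t \<in> borel_measurable (lebesgue_on S)"
proof -
  have "rate t \<in> borel_measurable borel"
    unfolding rate_def[abs_def] by (cases "t < T") simp_all
  then show ?thesis by (intro measurable_restrict_space1 measurable_completion) simp
qed

lemma integrable_const_Ioo: "integrable (lebesgue_on {0<..<L}) (\<lambda>x. c :: real)"
  by (intro integral_Icc_eq_Ioo continuous_imp_integrable_real) simp

lemma integral_const_Ioo: "(\<integral>x. c \<partial>lebesgue_on {0<..<L}) = (c :: real) * L"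
proof -
  have "integrable (lebesgue_on {0..L}) (\<lambda>x. c)" by (intro continuous_imp_integrable_real) simp
  from integral_Icc_eq_Ioo(2)[OF this, symmetric] have "(\<integral>x. c \<partial>lebesgue_on {0<..<L}) = (\<integral>x. c \<partial>lebesgue_on {0..L})" .
  also have "\<dots> = c * (L - 0)" using b0 by (intro lebesgue_integral_const_Icc) simp
  finally show ?thesis unfolding diff_0_right .
qed

lemma bounded_integrable:
  assumes "f \<in> borel_measurable (lebesgue_on {0<..<L})" "\<And>x. x \<in> {0..L} \<Longrightarrow> \<bar>f x\<bar> \<le> (c :: real)"
  shows "integrable (lebesgue_on {0<..<L}) f"
proof (rule Bochner_Integration.integrable_bound[OF integrable_const_Ioo assms(1)])
  show "AE x in lebesgue_on {0<..<L}. norm (f x) \<le> norm c"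
  proof (rule AE_I2)
    fix x assume "x \<in> space (lebesgue_on {0<..<L})"
    then have "\<bar>f x\<bar> \<le> c" using assms(2)[of x] by auto
    then show "norm (f x) \<le> norm c" by simp
  qed
qed

lemma w_integrable: "integrable (lebesgue_on {0<..<L}) (w t)"
  using w_cont by (intro integral_Icc_eq_Ioo continuous_imp_integrable_real)

lemma rate_integrable: "integrable (lebesgue_on {0<..<L}) (rate t)"
  by (rule bounded_integrable[OF rate_measurable rate_bound])

text \<open>One function supplies both the bulk and the boundary component, so the trace of
  \<open>u\<close> agrees with \<open>v\<close> by construction.\<close>

definition S :: "real \<Rightarrow> state" where "S t = (\<lambda>x. chi * w t x, \<lambda>x. chi * w t x)"

definition R :: "real \<Rightarrow> state" where "R t = (\<lambda>x. chi * rate t x, \<lambda>x. chi * rate t x)"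

lemma S_H_space: "S t \<in> H_space L"
proof -
  have "integrable (lebesgue_on {0<..<L}) (\<lambda>x. (w t x)\<^sup>2)"
    using w_cont by (intro integral_Icc_eq_Ioo continuous_imp_integrable_real continuous_intros)
  then show ?thesis using w_measurable by (simp add: H_space_def S_def L2_def power_mult_distrib chi_square)
qed

lemma R_H_space: "R t \<in> H_space L"
proof -
  have "integrable (lebesgue_on {0<..<L}) (\<lambda>x. (rate t x)\<^sup>2)"
  proof (rule bounded_integrable)
    show "(\<lambda>x. (rate t x)\<^sup>2) \<in> borel_measurable (lebesgue_on {0<..<L})"
      using rate_measurable by (intro borel_measurable_power)
    show "\<bar>(rate t x)\<^sup>2\<bar> \<le> 1" for x using rate_bound[of t x] by (simp add: abs_square_le_1)
  qed
  then show ?thesis using rate_measurable by (simp add: H_space_def R_def L2_def power_mult_distrib chi_square)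
qed

lemma H_norm_chi:
  "H_norm L (\<lambda>x. chi * f x, \<lambda>x. chi * f x) = sqrt ((\<integral>x. (f x)\<^sup>2 \<partial>lebesgue_on {0<..<L}) + ((f 0)\<^sup>2 + (f L)\<^sup>2))"
proof -
  have "chi * y * (chi * y) = y\<^sup>2" for y
    using chi_square(3)[of "y * y"] by (simp add: power2_eq_square algebra_simps)
  then show ?thesis using b0 by (simp add: H_norm_def H_inner_def)
qed

text \<open>The set \<open>Z\<close> covers the two-sided and the right derivative at once.
  Difference quotients and \<open>rate\<close> are bounded by 1, so pointwise convergence almost
  everywhere upgrades to convergence in the bulk norm; the two boundary points carry mass and need
  genuine pointwise limits.\<close>

lemma S_has_derivative:
  assumes ae: "AE x in lebesgue_on {0<..<L}. ((\<lambda>h. (w (t + h) x - w t x) / h) \<longlongrightarrow> rate t x) (at 0 within Z)"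
    and bd: "\<And>x. x \<in> {0, L} \<Longrightarrow> ((\<lambda>h. (w (t + h) x - w t x) / h) \<longlongrightarrow> rate t x) (at 0 within Z)"
  shows "H_has_derivative L S (R t) t (at 0 within Z)"
proof -
  define e where "e h x = (w (t + h) x - w t x) / h - rate t x" for h x
  have eq: "H_diff (H_scale (1 / h) (H_diff (S (t + h)) (S t))) (R t) = (\<lambda>x. chi * e h x, \<lambda>x. chi * e h x)" for h
    by (auto simp: H_diff_def H_scale_def S_def R_def e_def algebra_simps diff_divide_distrib)
  have bound: "(e h x)\<^sup>2 \<le> 4" if "h \<noteq> 0" for h x
  proof -
    have "\<bar>w (t + h) x - w t x\<bar> / \<bar>h\<bar> \<le> 1" using w_lipschitz[of "t + h" x t] that by simp
    then have "\<bar>(w (t + h) x - w t x) / h\<bar> \<le> 1" by (simp add: abs_divide)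
    then have "\<bar>e h x\<bar> \<le> 2" using rate_bound[of t x] unfolding e_def by linarith
    then have "\<bar>e h x\<bar>\<^sup>2 \<le> 2\<^sup>2" by (intro power_mono) auto
    then show ?thesis by simp
  qed
  have em: "(\<lambda>x. (e h x)\<^sup>2) \<in> borel_measurable (lebesgue_on {0<..<L})" for h
    unfolding e_def using w_measurable rate_measurable
    by (intro borel_measurable_power borel_measurable_diff borel_measurable_divide borel_measurable_const)
  have sq: "((\<lambda>h. (e h x)\<^sup>2) \<longlongrightarrow> 0) (at 0 within Z)"
    if "((\<lambda>h. (w (t + h) x - w t x) / h) \<longlongrightarrow> rate t x) (at 0 within Z)" for x
  proof -
    have "((\<lambda>h. (e h x)\<^sup>2) \<longlongrightarrow> (rate t x - rate t x)\<^sup>2) (at 0 within Z)"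
      unfolding e_def by (intro tendsto_intros that)
    then show ?thesis by simp
  qed
  have "((\<lambda>h. \<integral>x. (e h x)\<^sup>2 \<partial>lebesgue_on {0<..<L}) \<longlongrightarrow> 0) (at 0 within Z)"
    \<comment> \<open>Dominated convergence is applied along an arbitrary sequence of
      increments.\<close>
    unfolding tendsto_at_iff_sequentially
  proof (intro allI impI)
    fix X :: "nat \<Rightarrow> real" assume X: "\<forall>i. X i \<in> Z - {0}" "X \<longlonglongrightarrow> 0"
    have F: "filterlim X (at 0 within Z) sequentially" using X by (simp add: filterlim_at)
    have "(\<lambda>n. \<integral>x. (e (X n) x)\<^sup>2 \<partial>lebesgue_on {0<..<L}) \<longlonglongrightarrow> (\<integral>x. 0 \<partial>lebesgue_on {0<..<L})"
    proof (rule integral_dominated_convergence[where w = "\<lambda>x. 4"])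
      show "AE x in lebesgue_on {0<..<L}. (\<lambda>n. (e (X n) x)\<^sup>2) \<longlonglongrightarrow> 0"
        using ae
      proof eventually_elim
        case (elim x)
        show ?case by (rule filterlim_compose[OF sq[OF elim] F])
      qed
      show "AE x in lebesgue_on {0<..<L}. norm ((e (X n) x)\<^sup>2) \<le> 4" for n
        using bound[of "X n"] X by (intro always_eventually allI) simp
    qed (use em integrable_const_Ioo in auto)
    then show "((\<lambda>h. \<integral>x. (e h x)\<^sup>2 \<partial>lebesgue_on {0<..<L}) \<circ> X) \<longlonglongrightarrow> 0" by (simp add: o_def)
  qed
  then have "((\<lambda>h. sqrt ((\<integral>x. (e h x)\<^sup>2 \<partial>lebesgue_on {0<..<L}) + ((e h 0)\<^sup>2 + (e h L)\<^sup>2))) \<longlongrightarrow> sqrt (0 + (0 + 0))) (at 0 within Z)"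
    by (intro tendsto_real_sqrt tendsto_add sq bd) auto
  then show ?thesis unfolding H_has_derivative_def eq H_norm_chi using R_H_space by simp
qed

lemma S_has_right_derivative: "0 \<le> t \<Longrightarrow> H_has_derivative L S (R t) t (at_right 0)"
proof -
  assume t: "0 \<le> t"
  have *: "((\<lambda>h. (w (t + h) x - w t x) / h) \<longlongrightarrow> rate t x) (at_right 0)" if "x \<in> {0..L}" for x
  proof -
    have "((\<lambda>s. (w s x - w t x) / (s - t)) \<longlongrightarrow> rate t x) (at_right t)"
      using w_derivative_right[OF t that] by (simp add: has_field_derivative_iff)
    then show ?thesis by (subst (asm) filterlim_at_right_to_0) (simp add: add.commute)
  qed
  show ?thesis
  proof (rule S_has_derivative)
    show "AE x in lebesgue_on {0<..<L}. ((\<lambda>h. (w (t + h) x - w t x) / h) \<longlongrightarrow> rate t x) (at_right 0)"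
      by (rule AE_I2, rule *) auto
  qed (use * b0 in auto)
qed

lemma S_has_two_sided_derivative:
  assumes t: "0 < t" "t \<noteq> T"
  shows "H_has_derivative L S (R t) t (at 0)"
proof -
  have *: "((\<lambda>h. (w (t + h) x - w t x) / h) \<longlongrightarrow> rate t x) (at 0)"
    if "x \<in> {0..L}" "x \<noteq> a t" "x \<noteq> b t" for x
    using w_derivative[OF t that] by (simp add: DERIV_def)
  have ae: "AE x in lebesgue_on {0<..<L}. ((\<lambda>h. (w (t + h) x - w t x) / h) \<longlongrightarrow> rate t x) (at 0)"
    by (rule AE_lebesgue_on_except_finite[of "{a t, b t}"]) (use * in auto)
  show ?thesis
    \<comment> \<open>For \<open>t > 0\<close> both facet ends lie strictly inside the interval, so
      the exceptional points avoid 0 and \<open>L\<close>.\<close>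
    using a_pos[OF t(1)] a_b_bounds[of t] b0 by (intro S_has_derivative ae *) auto
qed

text \<open>The constant \<open>L + 2\<close> is the total mass of the interval and the two boundary
  points; the pointwise bound \<open>w_lipschitz\<close> is integrated against it.\<close>

lemma S_lipschitz: "H_norm L (H_diff (S s) (S t)) \<le> sqrt (L + 2) * \<bar>s - t\<bar>"
proof -
  have eq: "H_diff (S s) (S t) = (\<lambda>x. chi * (w s x - w t x), \<lambda>x. chi * (w s x - w t x))"
    by (simp add: H_diff_def S_def right_diff_distrib)
  have sq: "(w s x - w t x)\<^sup>2 \<le> (s - t)\<^sup>2" for x
    using w_lipschitz[of s x t] by (simp add: abs_le_square_iff)
  have "(\<integral>x. (w s x - w t x)\<^sup>2 \<partial>lebesgue_on {0<..<L}) \<le> (\<integral>x. (s - t)\<^sup>2 \<partial>lebesgue_on {0<..<L})"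
  proof (rule integral_mono)
    show "integrable (lebesgue_on {0<..<L}) (\<lambda>x. (w s x - w t x)\<^sup>2)"
      using w_cont by (intro integral_Icc_eq_Ioo continuous_imp_integrable_real continuous_intros)
  qed (use sq integrable_const_Ioo in auto)
  then have "(\<integral>x. (w s x - w t x)\<^sup>2 \<partial>lebesgue_on {0<..<L}) + ((w s 0 - w t 0)\<^sup>2 + (w s L - w t L)\<^sup>2)
      \<le> (L + 2) * (s - t)\<^sup>2"
    using sq[of 0] sq[of L] unfolding integral_const_Ioo by (simp add: algebra_simps)
  then have "H_norm L (H_diff (S s) (S t)) \<le> sqrt ((L + 2) * (s - t)\<^sup>2)"
    unfolding eq H_norm_chi by simp
  then show ?thesis by (simp add: real_sqrt_mult)
qed

lemma S_absolutely_continuous: "H_absolutely_continuous_on L T' S"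
  unfolding H_absolutely_continuous_on_def
proof (intro allI impI)
  fix \<epsilon> :: real assume "\<epsilon> > 0"
  define c where "c = sqrt (L + 2)"
  have c: "c > 0" using b0 by (simp add: c_def)
  show "\<exists>\<delta>>0. \<forall>D S'. D division_of S' \<and> S' \<subseteq> {0..T'} \<and> (\<Sum>K\<in>D. Sup K - Inf K) < \<delta> \<longrightarrow>
      (\<Sum>K\<in>D. H_norm L (H_diff (S (Sup K)) (S (Inf K)))) < \<epsilon>"
  proof (intro exI[of _ "\<epsilon> / c"] conjI allI impI)
    show "0 < \<epsilon> / c" using \<open>\<epsilon> > 0\<close> c by simp
    fix D S' assume D: "D division_of S' \<and> S' \<subseteq> {0..T'} \<and> (\<Sum>K\<in>D. Sup K - Inf K) < \<epsilon> / c"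
    have "(\<Sum>K\<in>D. H_norm L (H_diff (S (Sup K)) (S (Inf K)))) \<le> (\<Sum>K\<in>D. c * (Sup K - Inf K))"
    proof (intro sum_mono)
      fix K assume K: "K \<in> D"
      then obtain p q where "K = cbox p q" using D by (metis cbox_division_memE)
      moreover have "K \<noteq> {}" using D K by auto
      ultimately have "Inf K \<le> Sup K" by auto
      then show "H_norm L (H_diff (S (Sup K)) (S (Inf K))) \<le> c * (Sup K - Inf K)"
        using S_lipschitz[of "Sup K" "Inf K"] by (simp add: c_def)
    qed
    also have "\<dots> = c * (\<Sum>K\<in>D. Sup K - Inf K)" by (simp add: sum_distrib_left)
    also have "\<dots> < \<epsilon>" using D c by (simp add: pos_less_divide_eq mult.commute)
    finally show "(\<Sum>K\<in>D. H_norm L (H_diff (S (Sup K)) (S (Inf K)))) < \<epsilon>" .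
  qed
qed

section \<open>The velocity is the negative of a subgradient\<close>

lemma integral_rate_mult:
  assumes t: "0 < t" "t < T" and y: "integrable (lebesgue_on {0<..<L}) y"
  shows "(\<integral>x. y x * rate t x \<partial>lebesgue_on {0<..<L})
    = integral {0..a t} y / (1 + a t) - integral {b t..L} y / (1 + L - b t)"
proof -
  note bd = a_pos[OF t(1)] a_b_bounds[of t] a_less_b[OF t(2)] b0
  \<comment> \<open>The ramp heights are speed times facet length, so the slopes are the facet
    velocities and the derivative equals \<open>rate t\<close> off the facet ends.\<close>
  define xs where "xs = [(a t / (1 + a t), 0, a t), (- (L - b t) / (1 + L - b t), b t, L)]"
  have deriv: "ramps_deriv xs x = rate t x" if "x \<in> {0<..<L}" "x \<noteq> a t" "x \<noteq> b t" for x
  proof -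
    have c1: "a t / (1 + a t) / (a t - 0) = 1 / (1 + a t)" using bd by simp
    have "- d / e / d = - 1 / e" if "d \<noteq> 0" for d e :: real using that by simp
    moreover have "L - b t \<noteq> 0" using bd by simp
    ultimately have c2: "- (L - b t) / (1 + L - b t) / (L - b t) = - 1 / (1 + L - b t)" by blast
    have "ramps_deriv xs x = a t / (1 + a t) / (a t - 0) * indicator {0<..<a t} x
        + - (L - b t) / (1 + L - b t) / (L - b t) * indicator {b t<..<L} x"
      by (simp add: ramps_deriv_def xs_def)
    then show ?thesis unfolding c1 c2 using that t bd by (auto simp: rate_def indicator_def)
  qed
  have xs: "\<forall>(c, p, q)\<in>set xs. 0 \<le> p \<and> q \<le> L" using bd by (auto simp: xs_def)
  have "(\<integral>x. y x * rate t x \<partial>lebesgue_on {0<..<L}) = (\<integral>x. y x * ramps_deriv xs x \<partial>lebesgue_on {0<..<L})"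
  proof (rule integral_cong_AE)
    show "(\<lambda>x. y x * rate t x) \<in> borel_measurable (lebesgue_on {0<..<L})"
      using borel_measurable_integrable[OF y] rate_measurable by (rule borel_measurable_times)
    show "(\<lambda>x. y x * ramps_deriv xs x) \<in> borel_measurable (lebesgue_on {0<..<L})"
      using has_ramps_integral(1)[OF y xs] by (rule borel_measurable_integrable)
    show "AE x in lebesgue_on {0<..<L}. y x * rate t x = y x * ramps_deriv xs x"
      by (rule AE_lebesgue_on_except_finite[of "{a t, b t}"]) (use deriv in auto)
  qed
  also have "\<dots> = ramps_integral xs y" by (rule has_ramps_integral(2)[OF y xs])
  also have "\<dots> = integral {0..a t} y / (1 + a t) - integral {b t..L} y / (1 + L - b t)"
  proof -
    have *: "d / e * J / d = J / e" "- d / e * J / d = - (J / e)" if "d \<noteq> 0" for d e J :: real using that by simp_all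
    have "a t \<noteq> 0" "L - b t \<noteq> 0" using bd by simp_all
    note * = *(1)[OF this(1)] *(2)[OF this(2)]
    have "ramps_integral xs y = a t / (1 + a t) * integral {0..a t} y / a t
        + - (L - b t) / (1 + L - b t) * integral {b t..L} y / (L - b t)"
      by (simp add: ramps_integral_def xs_def)
    then show ?thesis unfolding * by simp
  qed
  finally show ?thesis .
qed

lemma rate_ends:
  assumes t: "0 \<le> t" "t < T"
  shows "x \<in> {0..a t} \<Longrightarrow> rate t x = 1 / (1 + a t)" "x \<in> {b t..L} \<Longrightarrow> rate t x = - 1 / (1 + L - b t)"
  using t a_less_b[OF t(2)] a_b_bounds[of t] by (auto simp: rate_def)

lemma integral_const_cong:
  assumes "p \<le> q" "\<And>x. x \<in> {p..q} \<Longrightarrow> f x = (c::real)"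
  shows "integral {p..q} f = c * (q - p)"
proof -
  have "integral {p..q} f = integral {p..q} (\<lambda>x. c)" using assms(2) by (rule integral_cong)
  then show ?thesis using assms(1) by simp
qed

text \<open>With \<open>p = 1 + a t\<close> the left facet contributes
  \<open>(p - 1) / p\<^sup>2\<close> from the bulk and \<open>1 / p\<^sup>2\<close> from the
  boundary, in total \<open>1 / p\<close>; likewise on the right.\<close>

lemma R_H_norm_square:
  assumes t: "0 < t" "t < T"
  shows "(H_norm L (R t))\<^sup>2 = 1 / (1 + a t) + 1 / (1 + L - b t)"
proof -
  note bd = a_pos[OF t(1)] a_b_bounds[of t] a_less_b[OF t(2)] b0
  define p q where "p = 1 + a t" and "q = 1 + L - b t"
  have pq: "p > 0" "q > 0" using bd by (auto simp: p_def q_def)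
  note re = rate_ends[of t, unfolded p_def[symmetric] q_def[symmetric]]
  have "integral {0..a t} (rate t) = 1 / p * (a t - 0)" using bd t re by (intro integral_const_cong) auto
  moreover have "integral {b t..L} (rate t) = - 1 / q * (L - b t)" using bd t re by (intro integral_const_cong) auto
  ultimately have I: "(\<integral>x. rate t x * rate t x \<partial>lebesgue_on {0<..<L}) = (p - 1) / p / p + (q - 1) / q / q"
    unfolding integral_rate_mult[OF t rate_integrable] by (simp add: p_def q_def)
  have "(H_norm L (R t))\<^sup>2 = (\<integral>x. rate t x * rate t x \<partial>lebesgue_on {0<..<L}) + ((rate t 0)\<^sup>2 + (rate t L)\<^sup>2)"
    unfolding R_def H_norm_chi by (simp add: power2_eq_square)
  also have "rate t 0 = 1 / p" using re(1)[of 0] t bd by simp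
  also have "rate t L = - 1 / q" using re(2)[of L] t bd by simp
  also have "(\<integral>x. rate t x * rate t x \<partial>lebesgue_on {0<..<L}) + ((1 / p)\<^sup>2 + (- 1 / q)\<^sup>2) = 1 / p + 1 / q"
    unfolding I using pq by (simp add: power2_eq_square diff_divide_distrib)
  finally show ?thesis by (simp add: p_def q_def)
qed

lemma R_T: "T \<le> t \<Longrightarrow> R t = (\<lambda>x. 0, \<lambda>x. 0)"
  by (simp add: R_def rate_def)

text \<open>Measurability in time is read off a closed formula: continuous in \<open>t\<close>,
  bounded by 2, and cut off at \<open>T\<close>.\<close>

lemma R_square_integrable: "integrable (lebesgue_on {0<..<T'}) (\<lambda>t. (H_norm L (R t))\<^sup>2)"
proof -
  define g where "g t = 1 / (1 + a t) + 1 / (1 + L - b t)" for t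
  have ne: "1 + a t \<noteq> 0" "1 + L - b t \<noteq> 0" for t using a_b_bounds[of t] by auto
  have g: "continuous_on UNIV g"
    unfolding g_def[abs_def] by (intro continuous_intros a_cont b_cont) (use ne in auto)
  have gm: "(\<lambda>t. if t < T then g t else 0) \<in> borel_measurable (lebesgue_on {0<..<T'})"
  proof -
    have "g \<in> borel_measurable borel" using g by (rule borel_measurable_continuous_onI)
    then have "(\<lambda>t. if t < T then g t else 0) \<in> borel_measurable borel" by measurable
    then show ?thesis by (intro measurable_restrict_space1 measurable_completion) simp
  qed
  have gb: "\<bar>if t < T then g t else 0\<bar> \<le> 2" for t
  proof -
    have "0 \<le> 1 / (1 + a t)" "1 / (1 + a t) \<le> 1" "0 \<le> 1 / (1 + L - b t)" "1 / (1 + L - b t) \<le> 1"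
      using a_b_bounds[of t] by auto
    then show ?thesis by (simp add: g_def)
  qed
  have "integrable (lebesgue_on {0<..<T'}) (\<lambda>t. if t < T then g t else 0)"
  proof (rule Bochner_Integration.integrable_bound)
    show "integrable (lebesgue_on {0<..<T'}) (\<lambda>t. 2 :: real)"
      by (intro integral_Icc_eq_Ioo continuous_imp_integrable_real) simp
    show "AE t in lebesgue_on {0<..<T'}. norm (if t < T then g t else 0) \<le> norm (2 :: real)"
      using gb by (intro always_eventually allI) simp
  qed (rule gm)
  then show ?thesis
  proof (rule Bochner_Integration.integrable_cong[THEN iffD1, rotated 2])
    fix t assume "t \<in> space (lebesgue_on {0<..<T'})"
    then have "0 < t" by simp
    then show "(if t < T then g t else 0) = (H_norm L (R t))\<^sup>2"
      using R_H_norm_square[of t] R_T[of t] by (auto simp: g_def H_norm_def H_inner_def)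
  qed simp
qed

text \<open>An upper bound is enough, because the matching lower bound comes from the calibration.
  The boundary term vanishes, as the traces agree with the boundary values.\<close>

lemma S_energy: "energy L (S t) \<le> ereal (m t - k t)" "fst (S t) \<in> BV L"
proof -
  have L: "L > 0" using b0 by simp
  have "w t L = m t" "w t 0 = k t" using w_right[of t L] w_left[of 0 t] a_b_bounds[of t] b0 by auto
  then have tv: "total_variation L (\<lambda>x. chi * w t x) \<le> ereal (m t - k t)"
    using total_variation_monotone_le[OF L w_mono w_integrable, of chi t] chi by simp
  then have "total_variation L (\<lambda>x. chi * w t x) < \<infinity>" by (rule le_less_trans) simp
  then show BV: "fst (S t) \<in> BV L" using w_integrable by (simp add: BV_def S_def)
  have "continuous_on {0..L} (\<lambda>x. chi * w t x)" using w_cont by (intro continuous_intros)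
  from has_trace_continuous[OF this L] have "trace_at L (\<lambda>x. chi * w t x) 0 = chi * w t 0"
     "trace_at L (\<lambda>x. chi * w t x) L = chi * w t L" by (auto intro: trace_atI)
  then show "energy L (S t) \<le> ereal (m t - k t)"
    using tv BV b0 by (simp add: energy_def S_def)
qed

lemma H_inner_chi:
  assumes "integrable (lebesgue_on {0<..<L}) y"
  shows "H_inner L (R t) (\<lambda>x. y x, v) = chi * ((\<integral>x. y x * rate t x \<partial>lebesgue_on {0<..<L}) + rate t 0 * v 0 + rate t L * v L)"
proof -
  have "(\<integral>x. chi * rate t x * y x \<partial>lebesgue_on {0<..<L}) = chi * (\<integral>x. y x * rate t x \<partial>lebesgue_on {0<..<L})"
    by (simp add: mult.assoc mult.commute[of "rate t _"])
  then show ?thesis using b0 by (simp add: H_inner_def R_def algebra_simps)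
qed

text \<open>The solution saturates the calibration inequality: on the left facet the bulk weight
  \<open>a / (1 + a)\<close> and the boundary weight \<open>1 / (1 + a)\<close> add up to 1, so the
  height \<open>k t\<close> enters with weight 1; likewise \<open>m t\<close> on the right.\<close>

lemma R_S_inner:
  assumes t: "0 < t" "t < T"
  shows "H_inner L (R t) (S t) = k t - m t"
proof -
  note bd = a_pos[OF t(1)] a_b_bounds[of t] a_less_b[OF t(2)] b0
  define p q where "p = 1 + a t" and "q = 1 + L - b t"
  have pq: "p > 0" "q > 0" using bd by (auto simp: p_def q_def)
  note re = rate_ends[of t, unfolded p_def[symmetric] q_def[symmetric]]
  have I1: "integral {0..a t} (\<lambda>x. chi * w t x) = chi * k t * (a t - 0)"
    using bd w_left by (intro integral_const_cong) auto
  have I2: "integral {b t..L} (\<lambda>x. chi * w t x) = chi * m t * (L - b t)"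
    using bd w_right by (intro integral_const_cong) auto
  have "integrable (lebesgue_on {0<..<L}) (\<lambda>x. chi * w t x)" using w_integrable by simp
  from integral_rate_mult[OF t this]
  have I: "(\<integral>x. chi * w t x * rate t x \<partial>lebesgue_on {0<..<L}) = chi * k t * (p - 1) / p - chi * m t * (q - 1) / q"
    unfolding I1 I2 by (simp add: p_def q_def)
  have "H_inner L (R t) (S t) = chi * ((\<integral>x. chi * w t x * rate t x \<partial>lebesgue_on {0<..<L})
      + rate t 0 * (chi * w t 0) + rate t L * (chi * w t L))"
    unfolding S_def using w_integrable by (intro H_inner_chi) simp
  also have "rate t 0 = 1 / p" using re(1)[of 0] t bd by simp
  also have "rate t L = - 1 / q" using re(2)[of L] t bd by simp
  also have "w t 0 = k t" using w_left[of 0 t] bd by simp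
  also have "w t L = m t" using w_right[of t L] bd by simp
  also have "chi * ((\<integral>x. chi * w t x * rate t x \<partial>lebesgue_on {0<..<L}) + 1 / p * (chi * k t) + - 1 / q * (chi * m t))
     = chi * (chi * (k t - m t))"
    unfolding I using pq by (simp add: field_simps)
  finally show ?thesis by (simp add: chi_square)
qed

text \<open>The calibration with end values \<open>1 / p\<close> and \<open>1 / q\<close> and sign
  \<open>- chi\<close> handles the bulk. What remains are the mismatches between trace and boundary
  value, with factors \<open>1 / p\<close> and \<open>1 / q\<close> of at most 1, so the boundary
  part of the energy absorbs them.\<close>

lemma energy_ge_inner:
  assumes t: "0 < t" "t < T" and Y: "fst Y \<in> BV L"
  shows "ereal (- H_inner L (R t) Y) \<le> energy L Y"
proof -
  note bd = a_pos[OF t(1)] a_b_bounds[of t] a_less_b[OF t(2)] b0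
  obtain y v where Yyv: "Y = (y, v)" by (cases Y)
  have L: "L > 0" using b0 by simp
  have y: "y \<in> BV L" "integrable (lebesgue_on {0<..<L}) y" using Y by (auto simp: Yyv BV_def)
  obtain c0 cL where tr: "has_trace L y 0 c0" "has_trace L y L cL" using BV_has_trace[OF y(1) L] by blast
  define p q where "p = 1 + a t" and "q = 1 + L - b t"
  have pq: "p \<ge> 1" "q \<ge> 1" using bd by (auto simp: p_def q_def)
  note re = rate_ends[of t, unfolded p_def[symmetric] q_def[symmetric]]
  have r: "rate t 0 = 1 / p" "rate t L = - 1 / q" using re(1)[of 0] re(2)[of L] t bd by auto
  define J0 JL where "J0 = integral {0..a t} y" and "JL = integral {b t..L} y"
  have inner: "H_inner L (R t) Y = chi * (J0 / p - JL / q + v 0 / p - v L / q)"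
    unfolding Yyv using H_inner_chi[OF y(2)] integral_rate_mult[OF t y(2)] by (simp add: r J0_def JL_def p_def q_def)
  have e1: "(1 - 1 / p) * J0 / a t = J0 / p"
  proof -
    have "1 - 1 / p = a t / p" using pq by (simp add: p_def diff_divide_eq_iff)
    then show ?thesis using bd by simp
  qed
  have e2: "(1 - 1 / q) * JL / (L - b t) = JL / q"
  proof -
    have "1 - 1 / q = (L - b t) / q" using pq by (simp add: q_def diff_divide_eq_iff)
    then show ?thesis using bd by simp
  qed
  have tv: "ereal (- chi * (1 / p * c0 + J0 / p - JL / q - 1 / q * cL)) \<le> total_variation L y"
    using total_variation_ge_calibration[OF y(1), of "a t" "b t" "1 / p" "1 / q" "- chi" c0 cL] bd pq tr chi
    unfolding J0_def[symmetric] JL_def[symmetric] e1 e2 by simp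
  have s: "chi = 1 \<or> chi = - 1" using chi by (auto simp: abs_if split: if_splits)
  have d0: "\<bar>(c0 - v 0) / p\<bar> \<le> \<bar>c0 - v 0\<bar>" and dL: "\<bar>(cL - v L) / q\<bar> \<le> \<bar>cL - v L\<bar>"
    using pq divide_left_mono[of 1 p "\<bar>c0 - v 0\<bar>"] divide_left_mono[of 1 q "\<bar>cL - v L\<bar>"] by (simp_all add: abs_divide)
  have "- H_inner L (R t) Y = - chi * (1 / p * c0 + J0 / p - JL / q - 1 / q * cL)
      + (chi * ((c0 - v 0) / p) - chi * ((cL - v L) / q))"
    unfolding inner by (simp add: algebra_simps diff_divide_distrib)
  also have "\<dots> \<le> - chi * (1 / p * c0 + J0 / p - JL / q - 1 / q * cL) + (\<bar>c0 - v 0\<bar> + \<bar>cL - v L\<bar>)"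
  proof -
    have "chi * x - chi * x' \<le> e + e'" if "\<bar>x\<bar> \<le> e" "\<bar>x'\<bar> \<le> e'" for x x' e e' :: real
      using s that by auto
    from this[OF d0 dL] show ?thesis by simp
  qed
  finally have "ereal (- H_inner L (R t) Y) \<le> ereal (- chi * (1 / p * c0 + J0 / p - JL / q - 1 / q * cL)) + ereal (\<bar>c0 - v 0\<bar> + \<bar>cL - v L\<bar>)"
    by simp
  also have "\<dots> \<le> total_variation L y + ereal (\<bar>c0 - v 0\<bar> + \<bar>cL - v L\<bar>)"
    using tv by (rule add_right_mono)
  also have "\<dots> = energy L Y" using y tr trace_atI b0 by (simp add: energy_def Yyv)
  finally show ?thesis .
qed

text \<open>Before \<open>T\<close>, the energy of \<open>S t\<close> is at most
  \<open>m t - k t\<close>, which equals \<open>- H_inner L (R t) (S t)\<close>, so the subgradient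
  inequality reduces to \<open>energy_ge_inner\<close>. From \<open>T\<close> on, both the energy
  and the velocity are zero.\<close>

lemma S_subdifferential:
  assumes t: "0 < t" "t \<noteq> T"
  shows "H_scale (- 1) (R t) \<in> subdifferential L (S t)"
  unfolding subdifferential_def
proof (intro CollectI conjI ballI)
  show "H_scale (- 1) (R t) \<in> H_space L" by (rule H_space_scale[OF R_H_space])
  show "energy L (S t) < \<infinity>" using S_energy(1) by (rule le_less_trans) simp
  fix Y assume Y: "Y \<in> H_space L"
  have inner: "H_inner L (H_scale (- 1) (R t)) (H_diff Y (S t)) = H_inner L (R t) (S t) - H_inner L (R t) Y"
    using Y by (simp add: H_inner_scale_left H_inner_diff_right R_H_space S_H_space)
  show "energy L (S t) + ereal (H_inner L (H_scale (- 1) (R t)) (H_diff Y (S t))) \<le> energy L Y"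
  proof (cases "fst Y \<in> BV L")
    case False
    then show ?thesis by (simp add: energy_def)
  next
    case True
    show ?thesis
    proof (cases "t < T")
      case tT: True
      have "energy L (S t) + ereal (H_inner L (H_scale (- 1) (R t)) (H_diff Y (S t)))
          \<le> ereal (m t - k t) + ereal (H_inner L (H_scale (- 1) (R t)) (H_diff Y (S t)))"
        using S_energy(1) by (rule add_right_mono)
      also have "\<dots> = ereal (- H_inner L (R t) Y)"
        unfolding inner R_S_inner[OF t(1) tT] by simp
      also have "\<dots> \<le> energy L Y" by (rule energy_ge_inner[OF t(1) tT True])
      finally show ?thesis .
    next
      case False
      then have "T \<le> t" by simp
      then have "m t = k t" by (simp add: m_def k_def a_T b_T)
      then have "energy L (S t) \<le> 0" using S_energy(1)[of t] by (simp add: zero_ereal_def)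
      moreover have "H_inner L (R t) X = 0" for X by (simp add: R_T[OF \<open>T \<le> t\<close>] H_inner_def)
      ultimately have "energy L (S t) + ereal (H_inner L (H_scale (- 1) (R t)) (H_diff Y (S t))) \<le> 0"
        by (simp add: inner)
      then show ?thesis using energy_nonneg by (rule order_trans)
    qed
  qed
qed

lemma S_gradient_flow:
  assumes "\<And>x. x \<in> {0..L} \<Longrightarrow> u0 x = chi * w0 x"
  shows "gradient_flow L (u0, u0) S"
  unfolding gradient_flow_def
proof (intro conjI exI[of _ R])
  have ae: "AE t in lebesgue_on {0<..}. 0 < t \<and> t \<noteq> T"
    by (rule AE_lebesgue_on_except_finite[of "{T}"]) auto
  show "W12_loc L S R"
    unfolding W12_loc_def
  proof (intro conjI allI impI)
    show "AE t in lebesgue_on {0<..}. H_has_derivative L S (R t) t (at 0)"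
      using ae by eventually_elim (use S_has_two_sided_derivative in blast)
  qed (use S_H_space S_absolutely_continuous R_square_integrable in auto)
  show "AE t in lebesgue_on {0<..}. H_scale (- 1) (R t) \<in> subdifferential L (S t)"
    using ae by eventually_elim (use S_subdifferential in blast)
  have "AE x in lebesgue_on {0<..<L}. chi * w 0 x = u0 x"
    using assms w_initial by (intro AE_I2) auto
  then show "H_eq L (S 0) (u0, u0)"
    using assms w_initial b0 by (simp add: H_eq_def S_def)
qed

end

section \<open>Transfer to an arbitrary solution, and the facets of the profile\<close>

lemma H_norm_cong:
  assumes L: "L \<noteq> 0" and X: "X \<in> H_space L" and Y: "Y \<in> H_space L" and eq: "H_eq L X Y"
  shows "H_norm L X = H_norm L Y"
  using H_norm_reverse_triangle[OF X Y] H_norm_zero_iff[OF L X Y] eq by simp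

text \<open>A given solution coincides with the explicit one only as an element of \<open>H\<close>
  and only at nonnegative times, so its derivative is recovered from the difference quotients with
  \<open>h > 0\<close>.\<close>

lemma H_has_derivative_cong:
  assumes L: "L \<noteq> 0" and t: "0 \<le> t"
    and U: "\<And>s. 0 \<le> s \<Longrightarrow> U s \<in> H_space L" and V: "\<And>s. 0 \<le> s \<Longrightarrow> V s \<in> H_space L"
    and eq: "\<And>s. 0 \<le> s \<Longrightarrow> H_eq L (U s) (V s)" and V': "H_has_derivative L V W t (at_right 0)"
  shows "H_has_derivative L U W t (at_right 0)"
proof -
  let ?q = "\<lambda>U h. H_diff (H_scale (1 / h) (H_diff (U (t + h)) (U t))) W"
  have W: "W \<in> H_space L" using V' by (simp add: H_has_derivative_def)
  have "H_norm L (?q U h) = H_norm L (?q V h)" if h: "0 < h" for h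
  proof (rule H_norm_cong[OF L])
    have th: "0 \<le> t + h" using t h by simp
    show "?q U h \<in> H_space L" "?q V h \<in> H_space L"
      using U[OF t] U[OF th] V[OF t] V[OF th] W by (simp_all add: H_space_diff H_space_scale)
    have "AE x in lebesgue_on {0<..<L}. fst (U (t + h)) x = fst (V (t + h)) x"
         "AE x in lebesgue_on {0<..<L}. fst (U t) x = fst (V t) x"
      using eq[OF t] eq[OF th] by (simp_all add: H_eq_def)
    then have "AE x in lebesgue_on {0<..<L}. fst (?q U h) x = fst (?q V h) x"
      by eventually_elim (simp add: H_diff_def H_scale_def)
    then show "H_eq L (?q U h) (?q V h)"
      using eq[OF t] eq[OF th] by (simp add: H_eq_def H_diff_def H_scale_def)
  qed
  then have "\<forall>\<^sub>F h in at_right 0. H_norm L (?q U h) = H_norm L (?q V h)"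
    unfolding eventually_at_right_field by (intro exI[of _ 1]) auto
  moreover have "((\<lambda>h. H_norm L (?q V h)) \<longlongrightarrow> 0) (at_right 0)"
    using V' by (simp add: H_has_derivative_def)
  ultimately have "((\<lambda>h. H_norm L (?q U h)) \<longlongrightarrow> 0) (at_right 0)"
    by (simp add: tendsto_cong)
  then show ?thesis using W by (simp add: H_has_derivative_def)
qed

context facet_flow
begin

lemma chi_nonzero: "chi \<noteq> 0"
  using chi by auto

lemma right_facet:
  assumes t: "0 \<le> t" "t < T"
  shows "is_facet L (\<lambda>x. chi * w t x) (b t) L"
  unfolding is_facet_def
proof (intro conjI allI impI)
  note bd = a_b_bounds[of t] a_less_b[OF t(2)] b0
  show "b t < L" "{b t..L} \<subseteq> {0..L}" using bd by auto
  show "(\<lambda>x. chi * w t x) constant_on {b t..L}"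
    unfolding constant_on_def using w_right[of t] by (intro exI[of _ "chi * m t"]) auto
  fix p' q' assume *: "{b t..L} \<subseteq> {p'..q'} \<and> {p'..q'} \<subseteq> {0..L} \<and> (\<lambda>x. chi * w t x) constant_on {p'..q'}"
  then have pq: "p' \<le> b t" "L \<le> q'" using bd by auto
  then have "p' \<in> {0..L}" "q' \<in> {0..L}" using * bd by (auto simp: subset_iff)
  with pq show "q' = L" by simp
  obtain c where c: "\<And>x. x \<in> {p'..q'} \<Longrightarrow> chi * w t x = c" using * by (auto simp: constant_on_def)
  show "p' = b t"
  proof (rule ccontr)
    assume "p' \<noteq> b t"
    \<comment> \<open>Cutting at \<open>a t\<close> keeps \<open>x\<close> in the zone where the
      profile is \<open>w0\<close>, whose strict monotonicity contradicts constancy up to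
      \<open>b t\<close>.\<close>
    define x where "x = max p' (a t)"
    have x: "a t \<le> x" "x < b t" "p' \<le> x" using \<open>p' \<noteq> b t\<close> pq bd by (auto simp: x_def)
    have "chi * w t x = chi * w t (b t)" using c[of x] c[of "b t"] x pq bd by simp
    then have "w0 x = w0 (b t)" using w_middle[of t x] w_middle[of t "b t"] x bd by (simp add: chi_nonzero)
    then show False using w0_less[of x "b t"] x bd by simp
  qed
qed

lemma left_facet:
  assumes t: "0 < t" "t < T"
  shows "is_facet L (\<lambda>x. chi * w t x) 0 (a t)"
  unfolding is_facet_def
proof (intro conjI allI impI)
  note bd = a_b_bounds[of t] a_less_b[OF t(2)] b0 a_pos[OF t(1)]
  show "0 < a t" "{0..a t} \<subseteq> {0..L}" using bd by auto
  show "(\<lambda>x. chi * w t x) constant_on {0..a t}"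
    unfolding constant_on_def using w_left[of _ t] by (intro exI[of _ "chi * k t"]) auto
  fix p' q' assume *: "{0..a t} \<subseteq> {p'..q'} \<and> {p'..q'} \<subseteq> {0..L} \<and> (\<lambda>x. chi * w t x) constant_on {p'..q'}"
  then have pq: "p' \<le> 0" "a t \<le> q'" using bd by auto
  then have "p' \<in> {0..L}" "q' \<in> {0..L}" using * bd by (auto simp: subset_iff)
  with pq show "p' = 0" by simp
  obtain c where c: "\<And>x. x \<in> {p'..q'} \<Longrightarrow> chi * w t x = c" using * by (auto simp: constant_on_def)
  show "q' = a t"
  proof (rule ccontr)
    assume "q' \<noteq> a t"
    \<comment> \<open>Again a point of the zone where the profile is the strictly increasing
      \<open>w0\<close>.\<close>
    define x where "x = min q' (b t)"
    have x: "a t < x" "x \<le> b t" "x \<le> q'" using \<open>q' \<noteq> a t\<close> pq bd by (auto simp: x_def)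
    have "chi * w t x = chi * w t (a t)" using c[of x] c[of "a t"] x pq bd by simp
    then have "w0 x = w0 (a t)" using w_middle[of t x] w_middle[of t "a t"] x bd by (simp add: chi_nonzero)
    then show False using w0_less[of "a t" x] x bd by simp
  qed
qed

lemma no_initial_left_facet: "\<not> is_facet L (\<lambda>x. chi * w 0 x) 0 q"
proof
  assume "is_facet L (\<lambda>x. chi * w 0 x) 0 q"
  then obtain c where q: "0 < q" "\<And>x. x \<in> {0..q} \<Longrightarrow> chi * w 0 x = c"
    by (auto simp: is_facet_def constant_on_def)
  \<comment> \<open>A point at most \<open>b0\<close>, within reach of strict monotonicity.\<close>
  define x where "x = min q b0"
  have x: "0 < x" "x \<le> b0" "x \<le> q" using q b0 by (auto simp: x_def)
  have "chi * w 0 x = chi * w 0 0" using q(2)[of x] q(2)[of 0] x by simp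
  then have "w0 x = w0 0" using w_initial x b0 by (simp add: chi_nonzero)
  then show False using w0_less[of 0 x] x by simp
qed

text \<open>For \<open>t > 0\<close> both facets have positive length, so \<open>rate t\<close> is
  constant near each endpoint; from \<open>T\<close> on it is zero everywhere.\<close>

lemma rate_has_trace:
  assumes t: "0 < t"
  shows "has_trace L (\<lambda>x. chi * rate t x) 0 (chi * rate t 0)" "has_trace L (\<lambda>x. chi * rate t x) L (chi * rate t L)"
proof -
  have int: "integrable (lebesgue_on {0<..<L}) (\<lambda>x. chi * rate t x)" using rate_integrable by simp
  note bd = a_b_bounds[of t] b0 a_pos[OF t]
  show "has_trace L (\<lambda>x. chi * rate t x) 0 (chi * rate t 0)"
    using bd by (intro has_trace_constant_near(1)[OF int, of "a t"]) (auto simp: rate_def)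
  show "has_trace L (\<lambda>x. chi * rate t x) L (chi * rate t L)"
  proof (rule has_trace_constant_near(2)[OF int, of "L - b t"])
    show "0 < L - b t" "L - b t \<le> L" using bd by auto
    show "chi * rate t x = chi * rate t L" if "x \<in> {L - (L - b t)..L}" for x
      using that rate_ends(2)[of t] bd t by (cases "t < T") (auto simp: rate_def)
  qed
qed

end

theorem theorem7p1:
  fixes L b0 chi :: real and u0 :: "real \<Rightarrow> real"
  assumes b0: "b0 \<in> {0<..<L}"
    and lipschitz: "\<exists>C. C-lipschitz_on {0..L} u0"
    and monotone:
      "(chi = 1 \<and> mono_on {0..L} u0 \<and> strict_mono_on {0..b0} u0) \<or>
       (chi = -1 \<and> antimono_on {0..L} u0 \<and> strict_antimono_on {0..b0} u0)"
    and one_facet: "\<forall>p q. is_facet L u0 p q \<longleftrightarrow> p = b0 \<and> q = L"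
  shows
    \<comment> \<open>existence and uniqueness of the solution\<close>
    "(\<exists>U. gradient_flow L (u0, u0) U) \<and>
     (\<forall>U V. gradient_flow L (u0, u0) U \<and> gradient_flow L (u0, u0) V \<longrightarrow>
        (\<forall>t\<ge>0. H_eq L (U t) (V t))) \<and>
     (\<forall>U. gradient_flow L (u0, u0) U \<longrightarrow>
       (\<exists>(u :: real \<Rightarrow> real \<Rightarrow> real) (ut :: real \<Rightarrow> real \<Rightarrow> real) (vt :: real \<Rightarrow> real \<Rightarrow> real)
          (T :: real) (a :: real \<Rightarrow> real) (b :: real \<Rightarrow> real) (hl :: real \<Rightarrow> real) (hr :: real \<Rightarrow> real).
          \<comment> \<open>\<open>u t\<close> is the continuous representative of the bulk component, and \<open>(ut t, vt t)\<close>
             the right time derivative, in \<open>H\<close> and (for \<open>u\<close>) pointwise\<close>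
          (\<forall>t\<ge>0. continuous_on {0..L} (u t) \<and>
                 (AE x in lebesgue_on {0<..<L}. fst (U t) x = u t x) \<and>
                 H_has_derivative L U (ut t, vt t) t (at_right 0) \<and>
                 (\<forall>x\<in>{0..L}. ((\<lambda>s. u s x) has_real_derivative ut t x) (at_right t))) \<and>
          \<comment> \<open>the critical time\<close>
          T > 0 \<and> continuous_on {0..T} a \<and> continuous_on {0..T} b \<and>
          (\<forall>t\<in>{0..<T}. a t < b t) \<and> a T = b T \<and>
          \<comment> \<open>part 1\<close>
          b 0 = b0 \<and>
          (\<forall>t\<in>{0..<T}. is_facet L (u t) (b t) L \<and>
             (\<forall>x\<in>{b t..L}. u t x = hr t \<and>
                ut t x = - chi / (1 + L - b t) \<and>
                (hr has_real_derivative ut t x) (at t within {0..<T}))) \<and>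
          calibrable L b0 L chi \<and> coherent L b0 L chi \<and>
          hr 0 = u 0 L \<and>
          (\<forall>t\<in>{0..T}. b t \<in> {0..b0} \<and> hr t = u0 (b t) \<and> b t = inv_into {0..b0} u0 (hr t)) \<and>
          \<comment> \<open>part 2\<close>
          a 0 = 0 \<and> \<not> (\<exists>q. is_facet L (u 0) 0 q) \<and> ut 0 0 = chi \<and>
          (\<forall>t\<in>{0<..<T}. is_facet L (u t) 0 (a t) \<and>
             calibrable L 0 (a t) chi \<and> coherent L 0 (a t) chi) \<and>
          (\<forall>t\<in>{0..<T}. \<forall>x\<in>{0..a t}. u t x = hl t \<and>
             ut t x = chi / (1 + a t) \<and>
             (hl has_real_derivative ut t x) (at t within {0..<T})) \<and>
          hl 0 = u 0 0 \<and>
          (\<forall>t\<in>{0..T}. a t \<in> {0..b0} \<and> hl t = u0 (a t) \<and> a t = inv_into {0..b0} u0 (hl t)) \<and>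
          continuous (at 0 within {0..}) (\<lambda>t. ut t 0) \<and>
          \<comment> \<open>part 3\<close>
          (\<forall>t\<in>{0..<T}. \<forall>x\<in>{0..L}.
             u t x = (if x \<le> a t then hl t else if x < b t then u0 x else hr t)) \<and>
          (\<forall>t\<ge>0. \<forall>i\<in>{0, L}. has_trace L (fst (U t)) i (snd (U t) i)) \<and>
          (\<forall>t>0. \<forall>i\<in>{0, L}. has_trace L (ut t) i (vt t i))))"
proof -
  define w0 where "w0 x = chi * u0 x" for x
  have chi: "chi = 1 \<or> chi = -1" and chi2: "chi * (chi * y) = y" for y using monotone by auto
  have u0: "u0 x = chi * w0 x" for x by (simp add: w0_def chi2)
  interpret facet_flow L b0 chi w0
  proof
    show "0 < b0" "b0 < L" using b0 by auto
    show "\<bar>chi\<bar> = 1" using chi by auto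
    obtain c where "c-lipschitz_on {0..L} u0" using lipschitz by blast
    then have "continuous_on {0..L} u0" by (rule lipschitz_on_continuous_on)
    then show "continuous_on {0..L} w0" unfolding w0_def[abs_def] by (intro continuous_intros)
    show "mono_on {0..L} w0" "strict_mono_on {0..b0} w0"
      using monotone by (auto simp: w0_def monotone_on_def)
    have "is_facet L u0 b0 L" using one_facet by blast
    then show "w0 x = w0 b0" if "x \<in> {b0..L}" for x
      using that b0 by (auto simp: is_facet_def constant_on_def w0_def)
  qed
  have L: "L > 0" using b0 by simp
  have ex: "\<exists>U. gradient_flow L (u0, u0) U" using S_gradient_flow u0 by blast
  have uniq: "\<forall>U V. gradient_flow L (u0, u0) U \<and> gradient_flow L (u0, u0) V \<longrightarrow> (\<forall>t\<ge>0. H_eq L (U t) (V t))"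
    using gradient_flow_unique[OF L] by blast
  show ?thesis
  proof (intro conjI, rule ex, rule uniq, intro allI impI, goal_cases)
    case U: (1 U)
    \<comment> \<open>Uniqueness identifies the given solution with the explicit one; the pointwise
      statements below concern its continuous representative.\<close>
    have US: "H_eq L (U t) (S t)" if "0 \<le> t" for t
      using uniq U S_gradient_flow u0 that by blast
    obtain W where "W12_loc L U W" using U unfolding gradient_flow_def by blast
    then have UH: "U t \<in> H_space L" if "0 \<le> t" for t using W12_locD(1) that by blast
    define u where "u t = (\<lambda>x. chi * w t x)" for t
    define ut where "ut t = (\<lambda>x. chi * rate t x)" for t
    define hl where "hl t = chi * k t" for t
    define hr where "hr t = chi * m t" for t
    have u_cont: "continuous_on {0..L} (u t)" for t unfolding u_def by (intro continuous_intros w_cont)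
    have ut_left: "ut t x = chi / (1 + a t)" if "0 \<le> t" "t < T" "x \<in> {0..a t}" for t x
      using rate_ends(1)[of t x] that by (simp add: ut_def)
    have ut_right: "ut t x = - chi / (1 + L - b t)" if "0 \<le> t" "t < T" "x \<in> {b t..L}" for t x
      using rate_ends(2)[of t x] that by (simp add: ut_def)
    \<comment> \<open>Injectivity turns the height equations into the stated inverse formulas for
      the facet ends.\<close>
    have inj: "inj_on u0 {0..b0}"
    proof (rule linorder_inj_onI)
      fix x y assume "x < y" "x \<in> {0..b0}" "y \<in> {0..b0}"
      then show "u0 x \<noteq> u0 y" using w0_less[of x y] by (auto simp: w0_def)
    qed auto
    have f1: "\<forall>t\<ge>0. continuous_on {0..L} (u t) \<and>
                 (AE x in lebesgue_on {0<..<L}. fst (U t) x = u t x) \<and>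
                 H_has_derivative L U (ut t, ut t) t (at_right 0) \<and>
                 (\<forall>x\<in>{0..L}. ((\<lambda>s. u s x) has_real_derivative ut t x) (at_right t))"
    proof (intro allI impI conjI ballI u_cont)
      fix t :: real assume t: "0 \<le> t"
      show "AE x in lebesgue_on {0<..<L}. fst (U t) x = u t x"
        using US[OF t] by (simp add: H_eq_def S_def u_def)
      have "H_has_derivative L U (R t) t (at_right 0)"
        by (rule H_has_derivative_cong[OF _ t UH S_H_space US S_has_right_derivative[OF t]]) (use L in auto)
      then show "H_has_derivative L U (ut t, ut t) t (at_right 0)" by (simp add: R_def ut_def)
      fix x assume "x \<in> {0..L}"
      then show "((\<lambda>s. u s x) has_real_derivative ut t x) (at_right t)"
        unfolding u_def ut_def by (intro DERIV_cmult w_derivative_right t)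
    qed
    have ab_cont: "continuous_on {0..T} a" "continuous_on {0..T} b"
      using a_cont b_cont by (auto intro: continuous_on_subset)
    have ab: "\<forall>t\<in>{0..<T}. a t < b t" using a_less_b by fastforce
    have abT: "a T = b T" by (simp add: a_T b_T)
    have f2: "\<forall>t\<in>{0..<T}. is_facet L (u t) (b t) L \<and>
             (\<forall>x\<in>{b t..L}. u t x = hr t \<and>
                ut t x = - chi / (1 + L - b t) \<and>
                (hr has_real_derivative ut t x) (at t within {0..<T}))"
    proof (intro ballI conjI)
      fix t assume "t \<in> {0..<T}"
      then have t: "0 \<le> t" "t < T" by auto
      show "is_facet L (u t) (b t) L" unfolding u_def by (rule right_facet[OF t])
      fix x assume x: "x \<in> {b t..L}"
      show "u t x = hr t" using w_right[of t x] x by (simp add: u_def hr_def)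
      show ut: "ut t x = - chi / (1 + L - b t)" by (rule ut_right[OF t x])
      have "(m has_real_derivative - 1 / (1 + L - b t)) (at t within {0..<T})"
        using m_derivative[of t] t by (rule_tac has_field_derivative_subset) auto
      from DERIV_cmult[OF this, of chi] show "(hr has_real_derivative ut t x) (at t within {0..<T})"
        unfolding ut hr_def[abs_def] by simp
    qed
    have f3: "calibrable L b0 L chi" "coherent L b0 L chi"
      using right_facet_calibrable_coherent b0 chi by auto
    have f4: "hr 0 = u 0 L" using w_right[of 0 L] b_0 b0 by (simp add: hr_def u_def)
    have f5: "\<forall>t\<in>{0..T}. b t \<in> {0..b0} \<and> hr t = u0 (b t) \<and> b t = inv_into {0..b0} u0 (hr t)"
    proof
      fix t
      have "b t \<in> {0..b0}" "hr t = u0 (b t)" using a_b_bounds[of t] by (auto simp: hr_def m_def u0)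
      then show "b t \<in> {0..b0} \<and> hr t = u0 (b t) \<and> b t = inv_into {0..b0} u0 (hr t)"
        using inv_into_f_f[OF inj] by simp
    qed
    have f6: "\<not> (\<exists>q. is_facet L (u 0) 0 q)" using no_initial_left_facet by (simp add: u_def)
    have f7: "ut 0 0 = chi" using ut_left[of 0 0] T_pos a_0 by simp
    have f8: "\<forall>t\<in>{0<..<T}. is_facet L (u t) 0 (a t) \<and> calibrable L 0 (a t) chi \<and> coherent L 0 (a t) chi"
      using left_facet left_facet_calibrable_coherent a_pos a_b_bounds(7) chi by (auto simp: u_def)
    have f9: "\<forall>t\<in>{0..<T}. \<forall>x\<in>{0..a t}. u t x = hl t \<and>
             ut t x = chi / (1 + a t) \<and>
             (hl has_real_derivative ut t x) (at t within {0..<T})"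
    proof (intro ballI conjI)
      fix t x assume "t \<in> {0..<T}" and x: "x \<in> {0..a t}"
      then have t: "0 \<le> t" "t < T" by auto
      show "u t x = hl t" using w_left[of x t] x by (simp add: u_def hl_def)
      show ut: "ut t x = chi / (1 + a t)" by (rule ut_left[OF t x])
      have "(k has_real_derivative 1 / (1 + a t)) (at t within {0..<T})"
        using k_derivative[of t] t by (rule_tac has_field_derivative_subset) auto
      from DERIV_cmult[OF this, of chi] show "(hl has_real_derivative ut t x) (at t within {0..<T})"
        unfolding ut hl_def[abs_def] by simp
    qed
    have f10: "hl 0 = u 0 0" using w_left[of 0 0] a_0 by (simp add: hl_def u_def)
    have f11: "\<forall>t\<in>{0..T}. a t \<in> {0..b0} \<and> hl t = u0 (a t) \<and> a t = inv_into {0..b0} u0 (hl t)"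
    proof
      fix t
      have "a t \<in> {0..b0}" "hl t = u0 (a t)" using a_b_bounds[of t] by (auto simp: hl_def k_def u0)
      then show "a t \<in> {0..b0} \<and> hl t = u0 (a t) \<and> a t = inv_into {0..b0} u0 (hl t)"
        using inv_into_f_f[OF inj] by simp
    qed
    have f12: "continuous (at 0 within {0..}) (\<lambda>t. ut t 0)"
    \<comment> \<open>Up to time \<open>T\<close> the velocity at 0 is the continuous function
      \<open>chi / (1 + a t)\<close>, including at \<open>t = 0\<close>, where the facet degenerates
      to a point.\<close>
    proof (rule continuous_transform_within[where \<delta> = T])
      have "continuous (at 0 within {0..}) a"
        using a_cont by (simp add: continuous_on_eq_continuous_at continuous_at_imp_continuous_at_within)
      then show "continuous (at 0 within {0..}) (\<lambda>t. chi / (1 + a t))"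
        using a_0 by (intro continuous_intros) auto
      show "chi / (1 + a t) = ut t 0" if "t \<in> {0..}" "dist t 0 < T" for t
        using ut_left[of t 0] that a_b_bounds[of t] by (simp add: dist_real_def)
    qed (use T_pos in auto)
    have f13: "\<forall>t\<in>{0..<T}. \<forall>x\<in>{0..L}. u t x = (if x \<le> a t then hl t else if x < b t then u0 x else hr t)"
      using w_left w_middle w_right by (auto simp: u_def hl_def hr_def u0)
    have f14: "\<forall>t\<ge>0. \<forall>i\<in>{0, L}. has_trace L (fst (U t)) i (snd (U t) i)"
    proof (intro allI impI ballI)
      fix t i assume t: "0 \<le> (t::real)" and i: "i \<in> {0, L}"
      have "has_trace L (u t) i (u t i)" using has_trace_continuous[OF u_cont L] i by auto
      then have "has_trace L (fst (U t)) i (u t i)"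
      proof (rule has_trace_cong_AE[rotated 3])
        show "fst (U t) \<in> borel_measurable (lebesgue_on {0<..<L})"
          using UH[OF t] by (simp add: H_space_def L2_def)
        show "u t \<in> borel_measurable (lebesgue_on {0<..<L})"
          unfolding u_def using w_measurable by (intro borel_measurable_times borel_measurable_const)
        show "AE x in lebesgue_on {0<..<L}. fst (U t) x = u t x" using f1 t by blast
      qed
      moreover have "snd (U t) i = u t i" using US[OF t] i by (auto simp: H_eq_def S_def u_def)
      ultimately show "has_trace L (fst (U t)) i (snd (U t) i)" by simp
    qed
    have f15: "\<forall>t>0. \<forall>i\<in>{0, L}. has_trace L (ut t) i (ut t i)"
      using rate_has_trace by (auto simp: ut_def)
    \<comment> \<open>The bulk and the boundary velocity are the same function, so \<open>ut\<close>
      is the witness for \<open>vt\<close> as well.\<close>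
    show ?case
      by (rule exI[of _ u], rule exI[of _ ut], rule exI[of _ ut], rule exI[of _ T], rule exI[of _ a],
          rule exI[of _ b], rule exI[of _ hl], rule exI[of _ hr], intro conjI;
          fact f1 T_pos ab_cont ab abT b_0 f2 f3 f4 f5 a_0 f6 f7 f8 f9 f10 f11 f12 f13 f14 f15)
  qed
qed

end
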